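(* Let $R$ be a totally ordered set and let $C$ and $C'$ be chain complexes of persistence modules indexed by $R$ (in degrees $n\ge0$) of the form $C_n\cong\bigoplus_{j\in J_n}\mathbb{I}\lceil b_{n,j},\infty\rfloor$ and $C'_n\cong\bigoplus_{j\in J'_n}\mathbb{I}\lceil b'_{n,j},\infty\rfloor$, with $J_n,J'_n$ finite and all $b_{n,j},b'_{n,j}<\infty$. Let $C\to C'$ be a map of chain complexes, with $C_n\to C'_n$ represented by a matrix $X_n$. Let $T_n,S_n,P_n$ (for $C$) and $T'_n,S'_n,P'_n$ (for $C'$) be produced by the persistent homology algorithm described in the context. Then the induced map on homology $H_n\to H'_n$ is represented, with respect to the interval decompositions of $H_n$ and $H'_n$ produced by the algorithm (including any empty bars), by the submatrix of $S'_n(T'_n)^{-1}X_nT_n(S_n)^{-1}$ consisting of the columns indexed by $J_n\setminus P_n$ and the rows indexed by $J'_n\setminus P'_n$.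
   Context: Fix a field $F$; all vector spaces are over $F$. A persistence module indexed by $R$ is a functor from the poset $R$ to vector spaces; morphisms are natural transformations; direct sums, kernels, quotients are pointwise. A cut of $R$ is a pair $c=(c^\downarrow,c^\uparrow)$ of (possibly empty) subsets with $c^\downarrow\cup c^\uparrow=R$ and $r_1<r_2$ for all $r_1\in c^\downarrow$, $r_2\in c^\uparrow$; cuts are ordered by inclusion of $c^\downarrow$; $\infty=(R,\varnothing)$. For cuts $b\le d$, $\lceil b,d\rfloor=b^\uparrow\cap d^\downarrow$. The interval module $\mathbb{I}\lceil b,d\rfloor$ is $F$ at $t\in\lceil b,d\rfloor$ and $0$ elsewhere, with identity structure maps inside the interval and zero maps otherwise. Empty bars $b=d$ (zero modules) are allowed in decompositions. Matrix representation: with respect to finite interval decompositions $A\cong\bigoplus_{j\in J}\mathbb{I}\lceil a'_j,c'_j\rfloor$ and $B\cong\bigoplus_{i\in I}\mathbb{I}\lceil a_i,c_i\rfloor$, a matrix $X=\{x_{i,j}\}$ over $F$ represents a morphism $\varphi\colon A\to B$ if $x_{i,j}=0$ whenever $a_i>a'_j$ or $c_i>c'_j$, and for all $i,j$ and all $t\in\lceil a_i,c_i\rfloor\cap\lceil a'_j,c'_j\rfloor$ the composite $\mathbb{I}\lceil a'_j,c'_j\rfloor_t\to A_t\xrightarrow{\varphi_t}B_t\to\mathbb{I}\lceil a_i,c_i\rfloor_t$ is multiplication by $x_{i,j}$. Ordered column reduction of a matrix with ordered rows and columns: process columns from least to greatest; if the current column is zero, move on; otherwise its first (least-row) nonzero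 entry is its pivot, and multiples of the current column are added to each greater column to make the entry in the pivot's row zero. Ordered row reduction interchanges rows and columns. The algorithm (classical): let $\partial_n$ denote also the matrix of the boundary map $C_n\to C_{n-1}$ ($C_{-1}=0$). Begin with $M_0$ a zero matrix, $T_0$ the identity, $P_0=\varnothing$. Inductively put $M_{n+1}=T_n^{-1}\partial_{n+1}$. Order the columns of $M_{n+1}$ by birth times ($b_{n+1,j}$ increasing) and the rows in reverse by birth times ($b_{n,j}$ decreasing), ties arbitrary, and perform ordered row and column reduction to obtain $D_{n+1}=S_nM_{n+1}T_{n+1}$ with pivots as its only nonzero entries; $S_n$ and $T_{n+1}$ are the products of the elementary matrices of the row and column operations used. $P_{n+1}$ is the set of $j\in J_{n+1}$ such that column $j$ of $D_{n+1}$ contains a pivot. The homology $H_n=\ker\partial_n/\operatorname{im}\partial_{n+1}$ has an interval decomposition indexed by $J_n\setminus P_n$: the bar of $j$ is $\lceil b_{n,j},\infty\rfloor$ if row $j$ of $D_{n+1}$ has no pivot, and $\lceil b_{n,j},b_{n+1,p(j)}\rfloor$ (possibly empty) if $D_{n+1}$ has a pivot in position $j,p(j)$; the generator of the bar of $j$ is the homology class of the cycle given by column $j$ of $T_nS_n^{-1}$. The analogous construction is applied to $C'$. *)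

theory Defs
  imports "HOL-Algebra.AbelCoset" "Jordan_Normal_Form.VS_Connect"
begin

hide_const (open) Modules.module_hom

section \<open>Cuts of a totally ordered set\<close>

text \<open>The totally ordered set \<open>R\<close> is the type \<^typ>\<open>'r\<close> of class \<^class>\<open>linorder\<close>.\<close>

typedef (overloaded) ('r::linorder) cut =
  "{(L :: 'r set, U :: 'r set). L \<union> U = UNIV \<and> (\<forall>r1\<in>L. \<forall>r2\<in>U. r1 < r2)}"
  by (rule exI[of _ "(UNIV, {})"]) simp

definition lower :: "('r::linorder) cut \<Rightarrow> 'r set" where
  "lower c = fst (Rep_cut c)"

definition upper :: "('r::linorder) cut \<Rightarrow> 'r set" where
  "upper c = snd (Rep_cut c)"

lemma cut_union: "lower c \<union> upper c = UNIV"
  and cut_less: "r1 \<in> lower c \<Longrightarrow> r2 \<in> upper c \<Longrightarrow> r1 < r2"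
  using Rep_cut[of c] by (auto simp: lower_def upper_def)

lemma upper_eq: "upper c = - lower c"
  using cut_union[of c] cut_less[of _ c] by fastforce

lemma cut_eqI: "lower c = lower d \<Longrightarrow> c = d"
  using upper_eq[of c] upper_eq[of d]
  by (metis Rep_cut_inject lower_def prod.expand upper_def)

lemma lower_chain: "lower c \<subseteq> lower d \<or> lower d \<subseteq> lower c"
proof (rule ccontr)
  assume "\<not> ?thesis"
  then obtain x y where "x \<in> lower c" "x \<notin> lower d" "y \<in> lower d" "y \<notin> lower c"
    by blast
  then have "x < y" "y < x"
    using cut_less[of x c y] cut_less[of y d x] by (auto simp: upper_eq)
  then show False by simp
qed

instantiation cut :: (linorder) linorder
begin

definition less_eq_cut :: "'a cut \<Rightarrow> 'a cut \<Rightarrow> bool" where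
  "c \<le> d \<longleftrightarrow> lower c \<subseteq> lower d"

definition less_cut :: "'a cut \<Rightarrow> 'a cut \<Rightarrow> bool" where
  "c < d \<longleftrightarrow> lower c \<subset> lower d"

instance
  by standard (use lower_chain in \<open>auto simp: less_eq_cut_def less_cut_def intro: cut_eqI\<close>)

end

definition cut_infinity :: "('r::linorder) cut" where
  "cut_infinity = Abs_cut (UNIV, {})"

definition bar :: "('r::linorder) cut \<Rightarrow> 'r cut \<Rightarrow> 'r set" where
  "bar b d = upper b \<inter> lower d"


section \<open>Persistence modules\<close>

text \<open>The field \<open>F\<close> is the type \<^typ>\<open>'f\<close> of class \<^class>\<open>field\<close>; vector spaces over it are
  the carrier-based vector spaces over \<^term>\<open>class_ring\<close>.\<close>

record ('r, 'f, 'v) pers_module =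
  fib :: "'r \<Rightarrow> ('f, 'v) module"
  str :: "'r \<Rightarrow> 'r \<Rightarrow> 'v \<Rightarrow> 'v"

definition is_pers_module :: "('r::linorder, 'f::field, 'v) pers_module \<Rightarrow> bool" where
  "is_pers_module A \<longleftrightarrow>
     (\<forall>t. vectorspace class_ring (fib A t)) \<and>
     (\<forall>s t. s \<le> t \<longrightarrow> str A s t \<in> module_hom class_ring (fib A s) (fib A t)) \<and>
     (\<forall>t. \<forall>x\<in>carrier (fib A t). str A t t x = x) \<and>
     (\<forall>r s t. r \<le> s \<longrightarrow> s \<le> t \<longrightarrow>
        (\<forall>x\<in>carrier (fib A r). str A s t (str A r s x) = str A r t x))"

definition pers_morphism ::
  "('r::linorder, 'f::field, 'v) pers_module \<Rightarrow> ('r, 'f, 'w) pers_module \<Rightarrow>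
   ('r \<Rightarrow> 'v \<Rightarrow> 'w) \<Rightarrow> bool" where
  "pers_morphism A B \<phi> \<longleftrightarrow>
     (\<forall>t. \<phi> t \<in> module_hom class_ring (fib A t) (fib B t)) \<and>
     (\<forall>s t. s \<le> t \<longrightarrow>
        (\<forall>x\<in>carrier (fib A s). \<phi> t (str A s t x) = str B s t (\<phi> s x)))"

definition pers_iso ::
  "('r::linorder, 'f::field, 'v) pers_module \<Rightarrow> ('r, 'f, 'w) pers_module \<Rightarrow>
   ('r \<Rightarrow> 'v \<Rightarrow> 'w) \<Rightarrow> bool" where
  "pers_iso A B \<phi> \<longleftrightarrow> pers_morphism A B \<phi> \<and>
     (\<forall>t. bij_betw (\<phi> t) (carrier (fib A t)) (carrier (fib B t)))"

text \<open>The \<^const>\<open>mult\<close> and \<^const>\<open>one\<close> fields of module records, inherited from rings, carry no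
  meaning for vector spaces and are filled arbitrarily.\<close>

definition interval_module :: "('r::linorder) cut \<Rightarrow> 'r cut \<Rightarrow> ('r, 'f::field, 'f) pers_module"
  where
  "interval_module b d =
     \<lparr>fib = (\<lambda>t. \<lparr>carrier = (if t \<in> bar b d then UNIV else {0}),
                 mult = (*), one = 1, zero = 0, add = (+), smult = (*)\<rparr>),
      str = (\<lambda>s t x. if s \<in> bar b d \<and> t \<in> bar b d then x else 0)\<rparr>"

text \<open>Direct sums are only formed over finite index sets, where they agree with products.\<close>

definition direct_sum_pm ::
  "'j set \<Rightarrow> ('j \<Rightarrow> ('r::linorder, 'f::field, 'v) pers_module) \<Rightarrow> ('r, 'f, 'j \<Rightarrow> 'v) pers_module"
  where
  "direct_sum_pm J A =
     \<lparr>fib = (\<lambda>t. \<lparr>carrier = (\<Pi>\<^sub>E j\<in>J. carrier (fib (A j) t)),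
                 mult = (\<lambda>v w. undefined), one = undefined,
                 zero = (\<lambda>j\<in>J. \<zero>\<^bsub>fib (A j) t\<^esub>),
                 add = (\<lambda>v w. \<lambda>j\<in>J. v j \<oplus>\<^bsub>fib (A j) t\<^esub> w j),
                 smult = (\<lambda>a v. \<lambda>j\<in>J. a \<odot>\<^bsub>fib (A j) t\<^esub> v j)\<rparr>),
      str = (\<lambda>s t v. \<lambda>j\<in>J. str (A j) s t (v j))\<rparr>"

definition sub_pm ::
  "('r, 'f, 'v) pers_module \<Rightarrow> ('r \<Rightarrow> 'v set) \<Rightarrow> ('r, 'f, 'v) pers_module" where
  "sub_pm A Z = A\<lparr>fib := (\<lambda>t. (fib A t)\<lparr>carrier := Z t\<rparr>)\<rparr>"

text \<open>The quotient by a family \<open>N\<close> of subspaces: its elements are cosets.\<close>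

definition quotient_pm ::
  "('r, 'f, 'v) pers_module \<Rightarrow> ('r \<Rightarrow> 'v set) \<Rightarrow> ('r, 'f, 'v set) pers_module" where
  "quotient_pm A N =
     \<lparr>fib = (\<lambda>t. \<lparr>carrier = a_rcosets\<^bsub>fib A t\<^esub> (N t),
                 mult = (\<lambda>U V. undefined), one = undefined,
                 zero = N t,
                 add = set_add (fib A t),
                 smult = (\<lambda>a U. \<Union>u\<in>U. N t +>\<^bsub>fib A t\<^esub> (a \<odot>\<^bsub>fib A t\<^esub> u))\<rparr>),
      str = (\<lambda>s t U. \<Union>u\<in>U. N t +>\<^bsub>fib A t\<^esub> str A s t u)\<rparr>"


section \<open>Chain complexes and homology\<close>

text \<open>\<open>bd n\<close> is the boundary map from degree \<open>n\<close> to degree \<open>n - 1\<close>. As the complex is zero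
  in degree \<open>-1\<close>, the value \<open>bd 0\<close> is never used.\<close>

record ('r, 'f, 'v) complex_pm =
  obj :: "nat \<Rightarrow> ('r, 'f, 'v) pers_module"
  bd :: "nat \<Rightarrow> 'r \<Rightarrow> 'v \<Rightarrow> 'v"

definition chain_complex :: "('r::linorder, 'f::field, 'v) complex_pm \<Rightarrow> bool" where
  "chain_complex C \<longleftrightarrow>
     (\<forall>n. is_pers_module (obj C n)) \<and>
     (\<forall>n. pers_morphism (obj C (Suc n)) (obj C n) (bd C (Suc n))) \<and>
     (\<forall>n t. \<forall>x\<in>carrier (fib (obj C (Suc (Suc n))) t).
        bd C (Suc n) t (bd C (Suc (Suc n)) t x) = \<zero>\<^bsub>fib (obj C n) t\<^esub>)"

definition chain_map ::
  "('r::linorder, 'f::field, 'v) complex_pm \<Rightarrow> ('r, 'f, 'w) complex_pm \<Rightarrow>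
   (nat \<Rightarrow> 'r \<Rightarrow> 'v \<Rightarrow> 'w) \<Rightarrow> bool" where
  "chain_map C C' f \<longleftrightarrow>
     (\<forall>n. pers_morphism (obj C n) (obj C' n) (f n)) \<and>
     (\<forall>n t. \<forall>x\<in>carrier (fib (obj C (Suc n)) t).
        f n t (bd C (Suc n) t x) = bd C' (Suc n) t (f (Suc n) t x))"

fun cycles :: "('r, 'f, 'v) complex_pm \<Rightarrow> nat \<Rightarrow> 'r \<Rightarrow> 'v set" where
  "cycles C 0 t = carrier (fib (obj C 0) t)"
| "cycles C (Suc n) t =
     a_kernel (fib (obj C (Suc n)) t) (fib (obj C n) t) (bd C (Suc n) t)"

definition boundaries :: "('r, 'f, 'v) complex_pm \<Rightarrow> nat \<Rightarrow> 'r \<Rightarrow> 'v set" where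
  "boundaries C n t = bd C (Suc n) t ` carrier (fib (obj C (Suc n)) t)"

definition homology :: "('r, 'f, 'v) complex_pm \<Rightarrow> nat \<Rightarrow> ('r, 'f, 'v set) pers_module" where
  "homology C n = quotient_pm (sub_pm (obj C n) (cycles C n)) (boundaries C n)"

definition homology_class :: "('r, 'f, 'v) complex_pm \<Rightarrow> nat \<Rightarrow> 'r \<Rightarrow> 'v \<Rightarrow> 'v set" where
  "homology_class C n t z = boundaries C n t +>\<^bsub>fib (obj C n) t\<^esub> z"

definition homology_map ::
  "('r, 'f, 'w) complex_pm \<Rightarrow> (nat \<Rightarrow> 'r \<Rightarrow> 'v \<Rightarrow> 'w) \<Rightarrow> nat \<Rightarrow> 'r \<Rightarrow> 'v set \<Rightarrow> 'w set" where
  "homology_map C' f n t U = (\<Union>u\<in>U. homology_class C' n t (f n t u))"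


section \<open>Matrices indexed by finite sets\<close>

text \<open>A matrix with rows \<open>I\<close> and columns \<open>J\<close> is a function vanishing outside \<open>I \<times> J\<close>.\<close>

definition mat_on :: "'i set \<Rightarrow> 'j set \<Rightarrow> ('i \<Rightarrow> 'j \<Rightarrow> 'f::zero) set" where
  "mat_on I J = {A. \<forall>i j. A i j \<noteq> 0 \<longrightarrow> i \<in> I \<and> j \<in> J}"

definition mat_prod ::
  "('i \<Rightarrow> 'k \<Rightarrow> 'f::field) \<Rightarrow> 'k set \<Rightarrow> ('k \<Rightarrow> 'j \<Rightarrow> 'f) \<Rightarrow> 'i \<Rightarrow> 'j \<Rightarrow> 'f"
  (\<open>(_ \<star>\<^bsub>_\<^esub> _)\<close> [70, 0, 71] 70) where
  "A \<star>\<^bsub>K\<^esub> B = (\<lambda>i j. \<Sum>k\<in>K. A i k * B k j)"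

definition mat_id :: "'j set \<Rightarrow> 'j \<Rightarrow> 'j \<Rightarrow> 'f::field" where
  "mat_id J = (\<lambda>i j. if i = j \<and> j \<in> J then 1 else 0)"

definition mat_inv :: "'j set \<Rightarrow> ('j \<Rightarrow> 'j \<Rightarrow> 'f::field) \<Rightarrow> 'j \<Rightarrow> 'j \<Rightarrow> 'f" where
  "mat_inv J A = (THE B. B \<in> mat_on J J \<and> A \<star>\<^bsub>J\<^esub> B = mat_id J \<and> B \<star>\<^bsub>J\<^esub> A = mat_id J)"

definition mat_transpose :: "('i \<Rightarrow> 'j \<Rightarrow> 'f) \<Rightarrow> 'j \<Rightarrow> 'i \<Rightarrow> 'f" where
  "mat_transpose A = (\<lambda>j i. A i j)"

definition mat_restrict :: "'i set \<Rightarrow> 'j set \<Rightarrow> ('i \<Rightarrow> 'j \<Rightarrow> 'f::zero) \<Rightarrow> 'i \<Rightarrow> 'j \<Rightarrow> 'f" where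
  "mat_restrict I J A = (\<lambda>i j. if i \<in> I \<and> j \<in> J then A i j else 0)"

text \<open>Right multiplication by \<open>mat_elem J c k a\<close>, for \<open>c \<noteq> k\<close>, adds \<open>a\<close> times column \<open>c\<close> to
  column \<open>k\<close>.\<close>

definition mat_elem :: "'j set \<Rightarrow> 'j \<Rightarrow> 'j \<Rightarrow> 'f \<Rightarrow> 'j \<Rightarrow> 'j \<Rightarrow> 'f::field" where
  "mat_elem J c k a = (\<lambda>i j. mat_id J i j + (if i = c \<and> j = k then a else 0))"


section \<open>Interval decompositions and matrix representations\<close>

record (overloaded) ('j, 'r, 'f, 'v) decomposition =
  idx :: "'j set"
  birth :: "'j \<Rightarrow> ('r::linorder) cut"
  death :: "'j \<Rightarrow> 'r cut"
  iso :: "'r \<Rightarrow> ('j \<Rightarrow> 'f) \<Rightarrow> 'v"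

definition interval_sum ::
  "('j, 'r::linorder, 'f::field, 'v) decomposition \<Rightarrow> ('r, 'f, 'j \<Rightarrow> 'f) pers_module" where
  "interval_sum \<D> = direct_sum_pm (idx \<D>) (\<lambda>j. interval_module (birth \<D> j) (death \<D> j))"

definition interval_decomposition ::
  "('r::linorder, 'f::field, 'v) pers_module \<Rightarrow> ('j, 'r, 'f, 'v) decomposition \<Rightarrow> bool" where
  "interval_decomposition A \<D> \<longleftrightarrow>
     is_pers_module A \<and> finite (idx \<D>) \<and>
     (\<forall>j\<in>idx \<D>. birth \<D> j \<le> death \<D> j) \<and>
     pers_iso (interval_sum \<D>) A (iso \<D>)"

definition summand_incl ::
  "('j, 'r::linorder, 'f::field, 'v) decomposition \<Rightarrow> 'j \<Rightarrow> 'r \<Rightarrow> 'f \<Rightarrow> 'v" where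
  "summand_incl \<D> j t x = iso \<D> t (\<lambda>k\<in>idx \<D>. if k = j then x else 0)"

definition summand_proj ::
  "('j, 'r::linorder, 'f::field, 'v) decomposition \<Rightarrow> 'j \<Rightarrow> 'r \<Rightarrow> 'v \<Rightarrow> 'f" where
  "summand_proj \<D> i t y = inv_into (carrier (fib (interval_sum \<D>) t)) (iso \<D> t) y i"

definition represents ::
  "('r::linorder, 'f::field, 'v) pers_module \<Rightarrow> ('j, 'r, 'f, 'v) decomposition \<Rightarrow>
   ('r, 'f, 'w) pers_module \<Rightarrow> ('i, 'r, 'f, 'w) decomposition \<Rightarrow>
   ('r \<Rightarrow> 'v \<Rightarrow> 'w) \<Rightarrow> ('i \<Rightarrow> 'j \<Rightarrow> 'f) \<Rightarrow> bool" where
  "represents A \<A> B \<B> \<phi> X \<longleftrightarrow>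
     interval_decomposition A \<A> \<and> interval_decomposition B \<B> \<and> pers_morphism A B \<phi> \<and>
     X \<in> mat_on (idx \<B>) (idx \<A>) \<and>
     (\<forall>i\<in>idx \<B>. \<forall>j\<in>idx \<A>.
        (birth \<B> i > birth \<A> j \<or> death \<B> i > death \<A> j \<longrightarrow> X i j = 0) \<and>
        (\<forall>t\<in>bar (birth \<B> i) (death \<B> i) \<inter> bar (birth \<A> j) (death \<A> j).
           \<forall>x. summand_proj \<B> i t (\<phi> t (summand_incl \<A> j t x)) = X i j * x))"

definition ray_decomposition ::
  "'j set \<Rightarrow> ('j \<Rightarrow> ('r::linorder) cut) \<Rightarrow> ('r \<Rightarrow> ('j \<Rightarrow> 'f) \<Rightarrow> 'v) \<Rightarrow>
   ('j, 'r, 'f, 'v) decomposition" where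
  "ray_decomposition J b \<gamma> = \<lparr>idx = J, birth = b, death = (\<lambda>j. cut_infinity), iso = \<gamma>\<rparr>"


section \<open>Ordered column and row reduction\<close>

text \<open>Ordered index sets are given as lists, from least to greatest. The state is a pair of the
  current matrix and the product of the elementary matrices applied so far. In \<open>clear_row J p c ks\<close>
  the entries in the pivot row \<open>p\<close> of the columns \<open>ks\<close> are cleared using column \<open>c\<close>.\<close>

fun clear_row ::
  "'j set \<Rightarrow> 'i \<Rightarrow> 'j \<Rightarrow> 'j list \<Rightarrow> ('i \<Rightarrow> 'j \<Rightarrow> 'f::field) \<times> ('j \<Rightarrow> 'j \<Rightarrow> 'f) \<Rightarrow>
   ('i \<Rightarrow> 'j \<Rightarrow> 'f) \<times> ('j \<Rightarrow> 'j \<Rightarrow> 'f)" where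
  "clear_row J p c [] (M, T) = (M, T)"
| "clear_row J p c (k # ks) (M, T) =
     (let E = mat_elem J c k (- (M p k / M p c))
      in clear_row J p c ks (M \<star>\<^bsub>J\<^esub> E, T \<star>\<^bsub>J\<^esub> E))"

fun process_columns ::
  "'j set \<Rightarrow> 'i list \<Rightarrow> 'j list \<Rightarrow> ('i \<Rightarrow> 'j \<Rightarrow> 'f::field) \<times> ('j \<Rightarrow> 'j \<Rightarrow> 'f) \<Rightarrow>
   ('i \<Rightarrow> 'j \<Rightarrow> 'f) \<times> ('j \<Rightarrow> 'j \<Rightarrow> 'f)" where
  "process_columns J rs [] (M, T) = (M, T)"
| "process_columns J rs (c # cs) (M, T) =
     (case find (\<lambda>r. M r c \<noteq> 0) rs of
        None \<Rightarrow> process_columns J rs cs (M, T)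
      | Some p \<Rightarrow> process_columns J rs cs (clear_row J p c cs (M, T)))"

definition ordered_column_reduction ::
  "'i list \<Rightarrow> 'j list \<Rightarrow> ('i \<Rightarrow> 'j \<Rightarrow> 'f::field) \<Rightarrow> ('i \<Rightarrow> 'j \<Rightarrow> 'f) \<times> ('j \<Rightarrow> 'j \<Rightarrow> 'f)" where
  "ordered_column_reduction rs cs M = process_columns (set cs) rs cs (M, mat_id (set cs))"

definition ordered_row_reduction ::
  "'i list \<Rightarrow> 'j list \<Rightarrow> ('i \<Rightarrow> 'j \<Rightarrow> 'f::field) \<Rightarrow> ('i \<Rightarrow> 'j \<Rightarrow> 'f) \<times> ('i \<Rightarrow> 'i \<Rightarrow> 'f)" where
  "ordered_row_reduction rs cs M =
     map_prod mat_transpose mat_transpose (ordered_column_reduction cs rs (mat_transpose M))"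

text \<open>The two reductions may be carried out in either order.\<close>

definition row_column_reduction ::
  "'i list \<Rightarrow> 'j list \<Rightarrow> ('i \<Rightarrow> 'j \<Rightarrow> 'f::field) \<Rightarrow>
   ('i \<Rightarrow> 'i \<Rightarrow> 'f) \<Rightarrow> ('i \<Rightarrow> 'j \<Rightarrow> 'f) \<Rightarrow> ('j \<Rightarrow> 'j \<Rightarrow> 'f) \<Rightarrow> bool" where
  "row_column_reduction rs cs M S D T \<longleftrightarrow>
     (\<exists>N. ordered_row_reduction rs cs M = (N, S) \<and> ordered_column_reduction rs cs N = (D, T)) \<or>
     (\<exists>N. ordered_column_reduction rs cs M = (N, T) \<and> ordered_row_reduction rs cs N = (D, S))"

definition increasing_listing :: "'j set \<Rightarrow> ('j \<Rightarrow> 'a::linorder) \<Rightarrow> 'j list \<Rightarrow> bool" where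
  "increasing_listing J b js \<longleftrightarrow>
     distinct js \<and> set js = J \<and> sorted_wrt (\<lambda>x y. b x \<le> b y) js"

definition decreasing_listing :: "'j set \<Rightarrow> ('j \<Rightarrow> 'a::linorder) \<Rightarrow> 'j list \<Rightarrow> bool" where
  "decreasing_listing J b js \<longleftrightarrow>
     distinct js \<and> set js = J \<and> sorted_wrt (\<lambda>x y. b y \<le> b x) js"


section \<open>The persistent homology algorithm\<close>

text \<open>\<open>\<Delta> n\<close> is the matrix of the boundary map from degree \<open>n\<close> to degree \<open>n - 1\<close>. The nonzero
  entries of \<open>D n\<close> are its pivots.\<close>

definition ph_algorithm ::
  "(nat \<Rightarrow> 'j set) \<Rightarrow> (nat \<Rightarrow> 'j \<Rightarrow> ('r::linorder) cut) \<Rightarrow> (nat \<Rightarrow> 'j \<Rightarrow> 'j \<Rightarrow> 'f::field) \<Rightarrow>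
   (nat \<Rightarrow> 'j \<Rightarrow> 'j \<Rightarrow> 'f) \<Rightarrow> (nat \<Rightarrow> 'j \<Rightarrow> 'j \<Rightarrow> 'f) \<Rightarrow> (nat \<Rightarrow> 'j \<Rightarrow> 'j \<Rightarrow> 'f) \<Rightarrow>
   (nat \<Rightarrow> 'j \<Rightarrow> 'j \<Rightarrow> 'f) \<Rightarrow> (nat \<Rightarrow> 'j set) \<Rightarrow> bool" where
  "ph_algorithm J b \<Delta> M D S T P \<longleftrightarrow>
     M 0 = (\<lambda>i j. 0) \<and> T 0 = mat_id (J 0) \<and> P 0 = {} \<and>
     (\<forall>n. M (Suc n) = mat_inv (J n) (T n) \<star>\<^bsub>J n\<^esub> \<Delta> (Suc n)) \<and>
     (\<forall>n. \<exists>rs cs. decreasing_listing (J n) (b n) rs \<and>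
        increasing_listing (J (Suc n)) (b (Suc n)) cs \<and>
        row_column_reduction rs cs (M (Suc n)) (S n) (D (Suc n)) (T (Suc n))) \<and>
     (\<forall>n. P (Suc n) = {j \<in> J (Suc n). \<exists>i\<in>J n. D (Suc n) i j \<noteq> 0})"

definition ph_death ::
  "(nat \<Rightarrow> 'j set) \<Rightarrow> (nat \<Rightarrow> 'j \<Rightarrow> ('r::linorder) cut) \<Rightarrow> (nat \<Rightarrow> 'j \<Rightarrow> 'j \<Rightarrow> 'f::field) \<Rightarrow>
   nat \<Rightarrow> 'j \<Rightarrow> 'r cut" where
  "ph_death J b D n j =
     (if \<exists>p\<in>J (Suc n). D (Suc n) j p \<noteq> 0
      then b (Suc n) (THE p. p \<in> J (Suc n) \<and> D (Suc n) j p \<noteq> 0)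
      else cut_infinity)"

text \<open>The generator of the bar of \<open>j\<close> at time \<open>t\<close>, where \<open>\<gamma> n\<close> identifies column vectors with
  elements of the complex in degree \<open>n\<close>.\<close>

definition ph_generator ::
  "('r::linorder, 'f::field, 'v) complex_pm \<Rightarrow> (nat \<Rightarrow> 'j set) \<Rightarrow>
   (nat \<Rightarrow> 'r \<Rightarrow> ('j \<Rightarrow> 'f) \<Rightarrow> 'v) \<Rightarrow> (nat \<Rightarrow> 'j \<Rightarrow> 'j \<Rightarrow> 'f) \<Rightarrow> (nat \<Rightarrow> 'j \<Rightarrow> 'j \<Rightarrow> 'f) \<Rightarrow>
   nat \<Rightarrow> 'r \<Rightarrow> 'j \<Rightarrow> 'v set" where
  "ph_generator C J \<gamma> S T n t j =
     homology_class C n t (\<gamma> n t (\<lambda>k\<in>J n. (T n \<star>\<^bsub>J n\<^esub> mat_inv (J n) (S n)) k j))"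

definition ph_decomposition ::
  "('r::linorder, 'f::field, 'v) complex_pm \<Rightarrow> (nat \<Rightarrow> 'j set) \<Rightarrow> (nat \<Rightarrow> 'j \<Rightarrow> 'r cut) \<Rightarrow>
   (nat \<Rightarrow> 'r \<Rightarrow> ('j \<Rightarrow> 'f) \<Rightarrow> 'v) \<Rightarrow>
   (nat \<Rightarrow> 'j \<Rightarrow> 'j \<Rightarrow> 'f) \<Rightarrow> (nat \<Rightarrow> 'j \<Rightarrow> 'j \<Rightarrow> 'f) \<Rightarrow> (nat \<Rightarrow> 'j \<Rightarrow> 'j \<Rightarrow> 'f) \<Rightarrow> (nat \<Rightarrow> 'j set) \<Rightarrow>
   nat \<Rightarrow> ('j, 'r, 'f, 'v set) decomposition" where
  "ph_decomposition C J b \<gamma> D S T P n =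
     \<lparr>idx = J n - P n,
      birth = b n,
      death = ph_death J b D n,
      iso = (\<lambda>t v. \<Oplus>\<^bsub>fib (homology C n) t\<^esub> j\<in>{j \<in> J n - P n. t \<in> bar (b n j) (ph_death J b D n j)}.
               v j \<odot>\<^bsub>fib (homology C n) t\<^esub> ph_generator C J \<gamma> S T n t j)\<rparr>"

end

theory Submission imports Defs begin

text \<open>Write \<open>G n = T n \<star> S n\<inverse>\<close>. Reduction only adds a basis element to elements born no earlier, so
  \<open>G n\<close> and its inverse respect births and give a basis of \<open>C n\<close> at every time. In these bases the
  boundary map is \<open>D\<close> up to scaling of columns, hence monomial. It follows that the cycles are spanned by
  the generators outside \<open>P n\<close>, the boundaries at time \<open>t\<close> by those of the pivot rows whose pivot column
  is born by \<open>t\<close>, and the chain map has the matrix \<open>Y n = G' n\<inverse> \<star> X n \<star> G n\<close>. The vanishing of the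
  entries with decreasing deaths is read off from \<open>D' \<star> Y (n + 1) = Y n \<star> D\<close>, with \<open>D\<close> and \<open>D'\<close> so
  scaled, since \<open>Y (n + 1)\<close> respects births and the deaths in degree \<open>n\<close> are births in degree
  \<open>n + 1\<close>.\<close>

section \<open>Matrices with controlled support\<close>

text \<open>The obstacle is that \<open>D (n + 1)\<close> describes the boundary map from the basis
  \<open>T (n + 1)\<close> to the basis \<open>G n\<close>, whereas the generators in degree
  \<open>n + 1\<close> also involve \<open>S (n + 1)\<close>, the row operations of the following
  step. Passing to them multiplies \<open>D (n + 1)\<close> on the right by the inverse of
  \<open>S (n + 1)\<close>, which could destroy its monomial shape. It does not, because the
  boundary squares to zero: this makes the rows \<open>P (n + 1)\<close> of \<open>M (n + 2)\<close>
  vanish, so that \<open>S (n + 1)\<close> cannot mix these indices with any others. The reduction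
  matrices are known only through their supports and those of their inverses; this information
  survives products, and it is why pivots are controlled only up to scaling. The condition on deaths
  in \<open>represents\<close> covers all pairs of bars, also empty or disjoint ones, for which the
  map on homology says nothing about the entry. It must therefore come from the chains one degree
  higher. Matrix identities are recovered from maps column by column, at a time at which the basis
  element is alive.\<close>

lemma mat_onI: "(\<And>i j. A i j \<noteq> 0 \<Longrightarrow> i \<in> I \<and> j \<in> J) \<Longrightarrow> A \<in> mat_on I J"
  by (auto simp: mat_on_def)

lemma mat_onD: "A \<in> mat_on I J \<Longrightarrow> A i j \<noteq> 0 \<Longrightarrow> i \<in> I \<and> j \<in> J"
  by (auto simp: mat_on_def)

lemma mat_on_zero: "A \<in> mat_on I J \<Longrightarrow> i \<notin> I \<or> j \<notin> J \<Longrightarrow> A i j = 0"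
  by (auto simp: mat_on_def)

lemma mat_prod_nonzeroE:
  assumes "(A \<star>\<^bsub>K\<^esub> B) i j \<noteq> 0"
  obtains k where "k \<in> K" "A i k \<noteq> 0" "B k j \<noteq> 0"
proof -
  have "\<exists>k\<in>K. A i k * B k j \<noteq> 0"
    using assms unfolding mat_prod_def by (meson sum.neutral)
  with that show thesis by auto
qed

lemma mat_prod_on: "A \<in> mat_on I K \<Longrightarrow> B \<in> mat_on K J \<Longrightarrow> A \<star>\<^bsub>K\<^esub> B \<in> mat_on I J"
  by (rule mat_onI) (auto elim!: mat_prod_nonzeroE dest: mat_onD)

lemma mat_id_on: "mat_id J \<in> mat_on J J"
  by (auto simp: mat_on_def mat_id_def)

lemma mat_prod_assoc:
  assumes "finite K" "finite L"
  shows "A \<star>\<^bsub>K\<^esub> B \<star>\<^bsub>L\<^esub> C = A \<star>\<^bsub>K\<^esub> (B \<star>\<^bsub>L\<^esub> C)"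
  by (rule ext)+
    (simp add: mat_prod_def sum_distrib_left sum_distrib_right mult.assoc sum.swap[of _ L K])

lemma mat_id_left:
  assumes "finite I" "A \<in> mat_on I J"
  shows "mat_id I \<star>\<^bsub>I\<^esub> A = A"
proof (intro ext)
  fix i j
  have "(mat_id I \<star>\<^bsub>I\<^esub> A) i j = (\<Sum>k\<in>I. if k = i then A i j else 0)"
    unfolding mat_prod_def by (rule sum.cong) (auto simp: mat_id_def)
  then show "(mat_id I \<star>\<^bsub>I\<^esub> A) i j = A i j"
    using assms by (simp add: mat_on_zero)
qed

lemma mat_id_right:
  assumes "finite J" "A \<in> mat_on I J"
  shows "A \<star>\<^bsub>J\<^esub> mat_id J = A"
proof (intro ext)
  fix i j
  have "(A \<star>\<^bsub>J\<^esub> mat_id J) i j = (\<Sum>k\<in>J. if k = j then A i j else 0)"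
    unfolding mat_prod_def by (rule sum.cong) (auto simp: mat_id_def)
  then show "(A \<star>\<^bsub>J\<^esub> mat_id J) i j = A i j"
    using assms by (simp add: mat_on_zero)
qed

lemma mat_transpose_transpose [simp]: "mat_transpose (mat_transpose A) = A"
  by (simp add: mat_transpose_def)

lemma mat_transpose_prod:
  "mat_transpose (A \<star>\<^bsub>K\<^esub> B) = mat_transpose B \<star>\<^bsub>K\<^esub> mat_transpose A"
  by (rule ext)+ (simp add: mat_transpose_def mat_prod_def mult.commute)

lemma mat_transpose_on: "A \<in> mat_on I J \<Longrightarrow> mat_transpose A \<in> mat_on J I"
  by (auto simp: mat_on_def mat_transpose_def)

lemma mat_transpose_id [simp]: "mat_transpose (mat_id J) = mat_id J"
  by (rule ext)+ (auto simp: mat_transpose_def mat_id_def)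

text \<open>For a preorder \<open>Q\<close> these are the units of the incidence algebra of \<open>Q\<close> on \<open>J\<close>.\<close>

definition incidence_units ::
  "'j set \<Rightarrow> ('j \<Rightarrow> 'j \<Rightarrow> bool) \<Rightarrow> ('j \<Rightarrow> 'j \<Rightarrow> 'f::field) set" where
  "incidence_units J Q = {A \<in> mat_on J J. (\<forall>i j. A i j \<noteq> 0 \<longrightarrow> Q i j) \<and>
     (\<exists>B\<in>mat_on J J. (\<forall>i j. B i j \<noteq> 0 \<longrightarrow> Q i j) \<and>
        A \<star>\<^bsub>J\<^esub> B = mat_id J \<and> B \<star>\<^bsub>J\<^esub> A = mat_id J)}"

lemma incidence_unitsI:
  assumes "A \<in> mat_on J J" "\<And>i j. A i j \<noteq> 0 \<Longrightarrow> Q i j"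
    and "B \<in> mat_on J J" "\<And>i j. B i j \<noteq> 0 \<Longrightarrow> Q i j"
    and "A \<star>\<^bsub>J\<^esub> B = mat_id J" "B \<star>\<^bsub>J\<^esub> A = mat_id J"
  shows "A \<in> incidence_units J Q"
  using assms unfolding incidence_units_def by blast

lemma incidence_units_on: "A \<in> incidence_units J Q \<Longrightarrow> A \<in> mat_on J J"
  and incidence_units_rel: "A \<in> incidence_units J Q \<Longrightarrow> A i j \<noteq> 0 \<Longrightarrow> Q i j"
  by (auto simp: incidence_units_def)

text \<open>Serves to treat row operations as column operations on the transpose; transposing
  reverses the preorder.\<close>

lemma incidence_units_transpose:
  assumes "A \<in> incidence_units J Q"
  shows "mat_transpose A \<in> incidence_units J (\<lambda>i j. Q j i)"
proof -
  obtain B where "B \<in> mat_on J J" "\<And>i j. B i j \<noteq> 0 \<Longrightarrow> Q i j"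
    "A \<star>\<^bsub>J\<^esub> B = mat_id J" "B \<star>\<^bsub>J\<^esub> A = mat_id J"
    using assms unfolding incidence_units_def by blast
  moreover from this have "mat_transpose B \<star>\<^bsub>J\<^esub> mat_transpose A = mat_id J"
      "mat_transpose A \<star>\<^bsub>J\<^esub> mat_transpose B = mat_id J"
    by (metis mat_transpose_prod mat_transpose_id)+
  ultimately show ?thesis
    using assms
    by (intro incidence_unitsI[where B = "mat_transpose B"])
      (simp_all add: mat_transpose_on incidence_units_on,
       simp_all add: mat_transpose_def incidence_units_rel[OF assms])
qed

lemma mat_id_unit: "finite J \<Longrightarrow> reflp Q \<Longrightarrow> mat_id J \<in> incidence_units J Q"
  by (rule incidence_unitsI[where B = "mat_id J"])
    (simp_all add: mat_id_left[OF _ mat_id_on] mat_id_on,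
      auto simp: mat_id_def reflp_def split: if_splits)

lemma incidence_units_prod:
  assumes fin: "finite J" and tr: "transp Q"
    and A: "A \<in> incidence_units J Q" and B: "B \<in> incidence_units J Q"
  shows "A \<star>\<^bsub>J\<^esub> B \<in> incidence_units J Q"
proof -
  have rel: "Q i j" if "(X \<star>\<^bsub>J\<^esub> Y) i j \<noteq> 0" "\<And>i j. X i j \<noteq> 0 \<Longrightarrow> Q i j" "\<And>i j. Y i j \<noteq> 0 \<Longrightarrow> Q i j"
    for i j and X Y :: "'a \<Rightarrow> 'a \<Rightarrow> 'b"
    using that(1) by (rule mat_prod_nonzeroE) (blast intro: transpD[OF tr] that)
  have cancel: "(X \<star>\<^bsub>J\<^esub> Y) \<star>\<^bsub>J\<^esub> (Y' \<star>\<^bsub>J\<^esub> X') = mat_id J"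
    if "Y \<star>\<^bsub>J\<^esub> Y' = mat_id J" "X \<star>\<^bsub>J\<^esub> X' = mat_id J" "X' \<in> mat_on J J"
    for X Y X' Y' :: "'a \<Rightarrow> 'a \<Rightarrow> 'b"
    using that mat_prod_assoc[OF fin fin, of Y Y' X'] mat_id_left[OF fin, of X']
    by (simp add: mat_prod_assoc[OF fin fin])
  obtain A' where A': "A' \<in> mat_on J J" "\<And>i j. A' i j \<noteq> 0 \<Longrightarrow> Q i j"
    "A \<star>\<^bsub>J\<^esub> A' = mat_id J" "A' \<star>\<^bsub>J\<^esub> A = mat_id J"
    using A unfolding incidence_units_def by blast
  obtain B' where B': "B' \<in> mat_on J J" "\<And>i j. B' i j \<noteq> 0 \<Longrightarrow> Q i j"
    "B \<star>\<^bsub>J\<^esub> B' = mat_id J" "B' \<star>\<^bsub>J\<^esub> B = mat_id J"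
    using B unfolding incidence_units_def by blast
  show ?thesis
  proof (rule incidence_unitsI[where B = "B' \<star>\<^bsub>J\<^esub> A'"])
    show "A \<star>\<^bsub>J\<^esub> B \<in> mat_on J J" "B' \<star>\<^bsub>J\<^esub> A' \<in> mat_on J J"
      using A B A' B' by (simp_all add: mat_prod_on incidence_units_on)
    show "Q i j" if "(A \<star>\<^bsub>J\<^esub> B) i j \<noteq> 0" for i j
      using that incidence_units_rel[OF A] incidence_units_rel[OF B] by (rule rel)
    show "Q i j" if "(B' \<star>\<^bsub>J\<^esub> A') i j \<noteq> 0" for i j
      using that B'(2) A'(2) by (rule rel)
    show "(A \<star>\<^bsub>J\<^esub> B) \<star>\<^bsub>J\<^esub> (B' \<star>\<^bsub>J\<^esub> A') = mat_id J"
      using B'(3) A'(3,1) by (rule cancel)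
    show "(B' \<star>\<^bsub>J\<^esub> A') \<star>\<^bsub>J\<^esub> (A \<star>\<^bsub>J\<^esub> B) = mat_id J"
      using A'(4) B'(4) incidence_units_on[OF B] by (rule cancel)
  qed
qed

text \<open>\<open>mat_inv\<close> is a definite description and says nothing until an inverse is
  known to exist. Membership in \<open>incidence_units\<close> provides one with support in
  \<open>Q\<close>, and associativity makes it the only one.\<close>

lemma
  assumes fin: "finite J" and A: "A \<in> incidence_units J Q"
  shows mat_inv_unit: "mat_inv J A \<in> incidence_units J Q"
    and mat_inv_right: "A \<star>\<^bsub>J\<^esub> mat_inv J A = mat_id J"
    and mat_inv_left: "mat_inv J A \<star>\<^bsub>J\<^esub> A = mat_id J"
proof -
  obtain B where B: "B \<in> mat_on J J" "\<And>i j. B i j \<noteq> 0 \<Longrightarrow> Q i j"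
    "A \<star>\<^bsub>J\<^esub> B = mat_id J" "B \<star>\<^bsub>J\<^esub> A = mat_id J"
    using A unfolding incidence_units_def by blast
  have "mat_inv J A = B"
    unfolding mat_inv_def
  proof (rule the_equality)
    fix B' assume B': "B' \<in> mat_on J J \<and> A \<star>\<^bsub>J\<^esub> B' = mat_id J \<and> B' \<star>\<^bsub>J\<^esub> A = mat_id J"
    then have "(B \<star>\<^bsub>J\<^esub> A) \<star>\<^bsub>J\<^esub> B' = B \<star>\<^bsub>J\<^esub> mat_id J"
      by (simp only: mat_prod_assoc[OF fin fin])
    with B B' show "B' = B" by (simp add: mat_id_left[OF fin, of _ J] mat_id_right[OF fin, of _ J])
  qed (use B in auto)
  moreover have "B \<in> incidence_units J Q"
    using B(1,2) incidence_units_on[OF A] incidence_units_rel[OF A] B(4,3) by (rule incidence_unitsI)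
  ultimately show "mat_inv J A \<in> incidence_units J Q" "A \<star>\<^bsub>J\<^esub> mat_inv J A = mat_id J"
      "mat_inv J A \<star>\<^bsub>J\<^esub> A = mat_id J"
    using B(3,4) by simp_all
qed

text \<open>As \<open>c \<noteq> k\<close>, the inverse is the elementary matrix with
  \<open>- a\<close>. Asking for \<open>Q c k\<close> only if \<open>a \<noteq> 0\<close> admits the
  operations with coefficient 0 that occur when an entry is already clear.\<close>

lemma mat_elem_unit:
  assumes fin: "finite J" and cJ: "c \<in> J" and kJ: "k \<in> J" and ck: "c \<noteq> k"
    and Q: "reflp Q" and Qck: "a \<noteq> 0 \<Longrightarrow> Q c k"
  shows "mat_elem J c k a \<in> incidence_units J Q"
proof -
  have on: "mat_elem J c k x \<in> mat_on J J" for x :: 'b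
    using cJ kJ by (auto simp: mat_on_def mat_elem_def mat_id_def split: if_splits)
  have rel: "Q i j" if "mat_elem J c k x i j \<noteq> 0" "x \<noteq> 0 \<Longrightarrow> Q c k" for x :: 'b and i j
    using that reflpD[OF Q] by (auto simp: mat_elem_def mat_id_def split: if_splits)
  have prod: "mat_elem J c k x \<star>\<^bsub>J\<^esub> mat_elem J c k (- x) = mat_id J" for x :: 'b
  proof (intro ext)
    fix i j
    have "(mat_elem J c k x \<star>\<^bsub>J\<^esub> mat_elem J c k (- x)) i j =
        (\<Sum>l\<in>J. mat_id J i l * mat_elem J c k (- x) l j + (if l = k then (if i = c then x * mat_elem J c k (- x) l j else 0) else 0))"
      unfolding mat_prod_def by (rule sum.cong) (auto simp: mat_elem_def[of J c k x] algebra_simps)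
    also have "\<dots> = mat_elem J c k (- x) i j + (if i = c then x * mat_elem J c k (- x) k j else 0)"
      using mat_id_left[OF fin on, THEN fun_cong, THEN fun_cong, of "- x" i j] fin kJ
      by (simp add: sum.distrib mat_prod_def)
    also have "\<dots> = mat_id J i j"
      using ck kJ cJ by (auto simp: mat_elem_def mat_id_def)
    finally show "(mat_elem J c k x \<star>\<^bsub>J\<^esub> mat_elem J c k (- x)) i j = mat_id J i j" .
  qed
  show ?thesis
    using Qck prod[of a] prod[of "- a"]
    by (intro incidence_unitsI[where B = "mat_elem J c k (- a)"] on) (simp_all, (metis rel neg_equal_0_iff_equal)+)
qed

lemma mat_prod_elem:
  assumes "finite J" "M \<in> mat_on I J" "c \<in> J"
  shows "(M \<star>\<^bsub>J\<^esub> mat_elem J c k a) i j = M i j + (if j = k then a * M i c else 0)"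
proof -
  have "(M \<star>\<^bsub>J\<^esub> mat_elem J c k a) i j =
      (\<Sum>l\<in>J. M i l * mat_id J l j + (if l = c then (if j = k then M i c * a else 0) else 0))"
    unfolding mat_prod_def by (rule sum.cong) (auto simp: mat_elem_def algebra_simps)
  also have "\<dots> = M i j + (if j = k then a * M i c else 0)"
    using mat_id_right[OF assms(1,2), THEN fun_cong, THEN fun_cong, of i j] assms(1,3)
    by (simp add: sum.distrib mat_prod_def mult.commute)
  finally show ?thesis .
qed

section \<open>Ordered reduction\<close>

text \<open>Clearing one column changes neither column \<open>c\<close> nor any other column, so all
  coefficients can be read off the initial \<open>M\<close>. The relation \<open>Q c k\<close> is
  demanded only where there is something to clear.\<close>

lemma clear_row_spec:
  fixes M :: "'i \<Rightarrow> 'j \<Rightarrow> 'f::field" and T :: "'j \<Rightarrow> 'j \<Rightarrow> 'f"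
  assumes fin: "finite J" and Q: "reflp Q" "transp Q" and c: "c \<in> J"
    and "distinct ks" "c \<notin> set ks" "set ks \<subseteq> J"
    and "M \<in> mat_on I J" "T \<in> mat_on J J" "M p c \<noteq> 0"
    and "\<And>k. k \<in> set ks \<Longrightarrow> M p k \<noteq> 0 \<Longrightarrow> Q c k"
  shows "\<exists>U\<in>incidence_units J Q. clear_row J p c ks (M, T) = (M \<star>\<^bsub>J\<^esub> U, T \<star>\<^bsub>J\<^esub> U) \<and>
    (\<forall>i j. (M \<star>\<^bsub>J\<^esub> U) i j = (if j \<in> set ks then M i j - M p j / M p c * M i c else M i j))"
  using assms(5-)
proof (induction ks arbitrary: M T)
  case Nil
  then show ?case
    using mat_id_unit[OF fin Q(1)] by (intro bexI[where x = "mat_id J"]) (simp_all add: mat_id_right[OF fin])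
next
  case (Cons k ks)
  let ?E = "mat_elem J c k (- (M p k / M p c))"
  have kJ: "k \<in> J" "c \<noteq> k" using Cons.prems by auto
  have E: "?E \<in> incidence_units J Q"
    using Cons.prems(7)[of k] by (intro mat_elem_unit fin c kJ Q) auto
  have ME: "(M \<star>\<^bsub>J\<^esub> ?E) i j = (if j = k then M i j - M p j / M p c * M i c else M i j)" for i j
    by (simp add: mat_prod_elem[OF fin Cons.prems(4) c])
  have on: "M \<star>\<^bsub>J\<^esub> ?E \<in> mat_on I J" "T \<star>\<^bsub>J\<^esub> ?E \<in> mat_on J J"
    using Cons.prems E by (simp_all add: mat_prod_on incidence_units_on)
  have "\<exists>U\<in>incidence_units J Q.
      clear_row J p c ks (M \<star>\<^bsub>J\<^esub> ?E, T \<star>\<^bsub>J\<^esub> ?E) = (M \<star>\<^bsub>J\<^esub> ?E \<star>\<^bsub>J\<^esub> U, T \<star>\<^bsub>J\<^esub> ?E \<star>\<^bsub>J\<^esub> U) \<and>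
      (\<forall>i j. (M \<star>\<^bsub>J\<^esub> ?E \<star>\<^bsub>J\<^esub> U) i j = (if j \<in> set ks then (M \<star>\<^bsub>J\<^esub> ?E) i j
         - (M \<star>\<^bsub>J\<^esub> ?E) p j / (M \<star>\<^bsub>J\<^esub> ?E) p c * (M \<star>\<^bsub>J\<^esub> ?E) i c else (M \<star>\<^bsub>J\<^esub> ?E) i j))"
  proof (rule Cons.IH)
    show "Q c l" if "l \<in> set ks" "(M \<star>\<^bsub>J\<^esub> ?E) p l \<noteq> 0" for l
      using that Cons.prems by (intro Cons.prems(7)) (auto simp: ME split: if_splits)
    show "(M \<star>\<^bsub>J\<^esub> ?E) p c \<noteq> 0" using Cons.prems kJ by (simp add: ME)
  qed (use Cons.prems on in auto)
  then obtain U where U: "U \<in> incidence_units J Q"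
    "clear_row J p c ks (M \<star>\<^bsub>J\<^esub> ?E, T \<star>\<^bsub>J\<^esub> ?E) = (M \<star>\<^bsub>J\<^esub> ?E \<star>\<^bsub>J\<^esub> U, T \<star>\<^bsub>J\<^esub> ?E \<star>\<^bsub>J\<^esub> U)"
    "\<And>i j. (M \<star>\<^bsub>J\<^esub> ?E \<star>\<^bsub>J\<^esub> U) i j = (if j \<in> set ks then (M \<star>\<^bsub>J\<^esub> ?E) i j
         - (M \<star>\<^bsub>J\<^esub> ?E) p j / (M \<star>\<^bsub>J\<^esub> ?E) p c * (M \<star>\<^bsub>J\<^esub> ?E) i c else (M \<star>\<^bsub>J\<^esub> ?E) i j)"
    by blast
  have "(M \<star>\<^bsub>J\<^esub> (?E \<star>\<^bsub>J\<^esub> U)) i j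
      = (if j \<in> set (k # ks) then M i j - M p j / M p c * M i c else M i j)" for i j
    using Cons.prems(1,2) U(3)[of i j]
    unfolding mat_prod_assoc[OF fin fin, symmetric] ME by (auto split: if_splits)
  moreover have "clear_row J p c (k # ks) (M, T) = (M \<star>\<^bsub>J\<^esub> (?E \<star>\<^bsub>J\<^esub> U), T \<star>\<^bsub>J\<^esub> (?E \<star>\<^bsub>J\<^esub> U))"
    using U(2) by (simp add: Let_def mat_prod_assoc[OF fin fin])
  ultimately show ?case
    using incidence_units_prod[OF fin Q(2) E U(1)] by blast
qed

text \<open>\<open>Z\<close> consists of zero columns. Such a column never supplies a pivot, and its
  entry in every pivot row is already 0, so it only takes part in operations with coefficient 0 and
  stays zero. Hence \<open>Q\<close> has to relate only indices outside \<open>Z\<close>.\<close>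

lemma process_columns_unit:
  fixes M :: "'i \<Rightarrow> 'j \<Rightarrow> 'f::field" and T :: "'j \<Rightarrow> 'j \<Rightarrow> 'f"
  assumes fin: "finite J" and Q: "reflp Q" "transp Q"
    and "distinct cs" "set cs \<subseteq> J" "M \<in> mat_on I J" "T \<in> mat_on J J"
    and "sorted_wrt (\<lambda>c k. c \<notin> Z \<longrightarrow> k \<notin> Z \<longrightarrow> Q c k) cs"
    and "\<And>i c. c \<in> Z \<Longrightarrow> M i c = 0"
  shows "\<exists>U\<in>incidence_units J Q. process_columns J rs cs (M, T) = (M \<star>\<^bsub>J\<^esub> U, T \<star>\<^bsub>J\<^esub> U)"
  using assms(4-)
proof (induction cs arbitrary: M T)
  case Nil
  then show ?case
    using mat_id_unit[OF fin Q(1)] by (intro bexI[where x = "mat_id J"]) (simp_all add: mat_id_right[OF fin])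
next
  case (Cons c cs)
  show ?case
  proof (cases "find (\<lambda>r. M r c \<noteq> 0) rs")
    case None
    then show ?thesis using Cons.IH[of M T] Cons.prems by auto
  next
    case (Some p)
    then have p: "M p c \<noteq> 0" by (auto simp: find_Some_iff)
    with Cons.prems(6) have "c \<notin> Z" by auto
    have "\<exists>U\<in>incidence_units J Q. clear_row J p c cs (M, T) = (M \<star>\<^bsub>J\<^esub> U, T \<star>\<^bsub>J\<^esub> U) \<and>
      (\<forall>i j. (M \<star>\<^bsub>J\<^esub> U) i j = (if j \<in> set cs then M i j - M p j / M p c * M i c else M i j))"
    proof (rule clear_row_spec[OF fin Q])
      show "Q c k" if "k \<in> set cs" "M p k \<noteq> 0" for k
        using that Cons.prems(5,6) \<open>c \<notin> Z\<close> by auto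
    qed (use Cons.prems p in auto)
    then obtain U where U: "U \<in> incidence_units J Q"
      "clear_row J p c cs (M, T) = (M \<star>\<^bsub>J\<^esub> U, T \<star>\<^bsub>J\<^esub> U)"
      "\<And>i j. (M \<star>\<^bsub>J\<^esub> U) i j = (if j \<in> set cs then M i j - M p j / M p c * M i c else M i j)"
      by blast
    have "\<exists>V\<in>incidence_units J Q. process_columns J rs cs (M \<star>\<^bsub>J\<^esub> U, T \<star>\<^bsub>J\<^esub> U)
        = (M \<star>\<^bsub>J\<^esub> U \<star>\<^bsub>J\<^esub> V, T \<star>\<^bsub>J\<^esub> U \<star>\<^bsub>J\<^esub> V)"
    proof (rule Cons.IH)
      show "M \<star>\<^bsub>J\<^esub> U \<in> mat_on I J" "T \<star>\<^bsub>J\<^esub> U \<in> mat_on J J"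
        using Cons.prems incidence_units_on[OF U(1)] by (simp_all add: mat_prod_on)
      show "(M \<star>\<^bsub>J\<^esub> U) i c = 0" if "c \<in> Z" for i c
        using Cons.prems(6)[OF that] by (simp add: U(3))
    qed (use Cons.prems in auto)
    then obtain V where V: "V \<in> incidence_units J Q" "process_columns J rs cs (M \<star>\<^bsub>J\<^esub> U, T \<star>\<^bsub>J\<^esub> U)
        = (M \<star>\<^bsub>J\<^esub> U \<star>\<^bsub>J\<^esub> V, T \<star>\<^bsub>J\<^esub> U \<star>\<^bsub>J\<^esub> V)"
      by blast
    show ?thesis
      using incidence_units_prod[OF fin Q(2) U(1) V(1)] V(2) Some U(2)
      by (intro bexI[where x = "U \<star>\<^bsub>J\<^esub> V"]) (simp_all add: mat_prod_assoc[OF fin fin])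
  qed
qed

section \<open>Shape of the reduced matrix\<close>

lemma process_columns_Some:
  fixes M :: "'i \<Rightarrow> 'j \<Rightarrow> 'f::field" and T :: "'j \<Rightarrow> 'j \<Rightarrow> 'f"
  assumes fin: "finite J" and "distinct (c # cs)" "set (c # cs) \<subseteq> J" "M \<in> mat_on I J" "T \<in> mat_on J J"
    and Some: "find (\<lambda>r. M r c \<noteq> 0) rs = Some p"
  obtains N V where "process_columns J rs (c # cs) (M, T) = process_columns J rs cs (N, V)"
    "N \<in> mat_on I J" "V \<in> mat_on J J"
    "\<And>i j. N i j = (if j \<in> set cs then M i j - M p j / M p c * M i c else M i j)"
proof -
  have p: "M p c \<noteq> 0" using Some by (auto simp: find_Some_iff)
  \<comment> \<open>The full relation is taken for \<open>Q\<close>, since only the formula for the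
    entries is wanted here.\<close>
  have "\<exists>U\<in>incidence_units J (\<lambda>_ _. True). clear_row J p c cs (M, T) = (M \<star>\<^bsub>J\<^esub> U, T \<star>\<^bsub>J\<^esub> U) \<and>
      (\<forall>i j. (M \<star>\<^bsub>J\<^esub> U) i j = (if j \<in> set cs then M i j - M p j / M p c * M i c else M i j))"
    using assms p by (intro clear_row_spec[OF fin]) (auto simp: reflp_def transp_def)
  then obtain U where U: "U \<in> incidence_units J (\<lambda>_ _. True)"
    "clear_row J p c cs (M, T) = (M \<star>\<^bsub>J\<^esub> U, T \<star>\<^bsub>J\<^esub> U)"
    "\<And>i j. (M \<star>\<^bsub>J\<^esub> U) i j = (if j \<in> set cs then M i j - M p j / M p c * M i c else M i j)"
    by blast
  show thesis
  proof (rule that[OF _ _ _ U(3)])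
    show "M \<star>\<^bsub>J\<^esub> U \<in> mat_on I J" "T \<star>\<^bsub>J\<^esub> U \<in> mat_on J J"
      using assms incidence_units_on[OF U(1)] by (simp_all add: mat_prod_on)
  qed (simp add: Some U(2))
qed

text \<open>Operations alter only columns still waiting in the list, so a column is final from its
  own turn on.\<close>

lemma process_columns_outside:
  fixes M :: "'i \<Rightarrow> 'j \<Rightarrow> 'f::field" and T :: "'j \<Rightarrow> 'j \<Rightarrow> 'f"
  assumes fin: "finite J" and "distinct cs" "set cs \<subseteq> J" "M \<in> mat_on I J" "T \<in> mat_on J J"
    and "k \<notin> set cs"
  shows "fst (process_columns J rs cs (M, T)) i k = M i k"
  using assms(2-)
proof (induction cs arbitrary: M T)
  case (Cons c cs)
  show ?case
  proof (cases "find (\<lambda>r. M r c \<noteq> 0) rs")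
    case None
    then show ?thesis using Cons.IH[of M T] Cons.prems by auto
  next
    case (Some p)
    obtain N V where NV: "process_columns J rs (c # cs) (M, T) = process_columns J rs cs (N, V)"
      "N \<in> mat_on I J" "V \<in> mat_on J J"
      "\<And>i j. N i j = (if j \<in> set cs then M i j - M p j / M p c * M i c else M i j)"
      using process_columns_Some[OF fin Cons.prems(1-4) Some] by blast
    show ?thesis
      unfolding NV(1) using Cons.prems NV(2,3) by (subst Cons.IH) (auto simp: NV(4))
  qed
qed simp

text \<open>Every operation adds a multiple of a remaining column, and all of these vanish in row
  \<open>i\<close>. Applied to a pivot row, this says that a cleared row stays clear.\<close>

lemma process_columns_zero_row:
  fixes M :: "'i \<Rightarrow> 'j \<Rightarrow> 'f::field" and T :: "'j \<Rightarrow> 'j \<Rightarrow> 'f"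
  assumes fin: "finite J" and "distinct cs" "set cs \<subseteq> J" "M \<in> mat_on I J" "T \<in> mat_on J J"
    and "\<And>k. k \<in> set cs \<Longrightarrow> M i k = 0" and "k \<in> set cs"
  shows "fst (process_columns J rs cs (M, T)) i k = 0"
  using assms(2-)
proof (induction cs arbitrary: M T)
  case (Cons c cs)
  have outside: "fst (process_columns J rs cs (N, V)) i k = N i k"
    if "k \<notin> set cs" "N \<in> mat_on I J" "V \<in> mat_on J J" for N and V :: "'j \<Rightarrow> 'j \<Rightarrow> 'f"
    using that Cons.prems by (intro process_columns_outside[OF fin]) auto
  show ?case
  proof (cases "find (\<lambda>r. M r c \<noteq> 0) rs")
    case None
    then show ?thesis using Cons.IH[of M T] Cons.prems outside[of M T] by auto
  next
    case (Some p)
    obtain N V where NV: "process_columns J rs (c # cs) (M, T) = process_columns J rs cs (N, V)"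
      "N \<in> mat_on I J" "V \<in> mat_on J J"
      "\<And>i j. N i j = (if j \<in> set cs then M i j - M p j / M p c * M i c else M i j)"
      using process_columns_Some[OF fin Cons.prems(1-4) Some] by blast
    have zero: "N i l = 0" if "l \<in> set (c # cs)" for l
      using that Cons.prems(5)[of l] Cons.prems(5)[of c] by (simp add: NV(4))
    show ?thesis
    proof (cases "k \<in> set cs")
      case True
      then show ?thesis
        unfolding NV(1) using Cons.prems by (intro Cons.IH NV(2,3)) (simp_all add: zero)
    next
      case False
      then show ?thesis
        unfolding NV(1) using outside[OF False NV(2,3)] zero[of k] Cons.prems by simp
    qed
  qed
qed simp

text \<open>A column is final from its turn on, so the first nonzero entry of the final column is
  the pivot used at that turn. Its row was then cleared in all later columns and stays
  clear.\<close>

lemma process_columns_leads: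
  fixes M :: "'i \<Rightarrow> 'j \<Rightarrow> 'f::field" and T :: "'j \<Rightarrow> 'j \<Rightarrow> 'f"
  assumes fin: "finite J" and "distinct cs" "set cs \<subseteq> J" "M \<in> mat_on I J" "T \<in> mat_on J J"
    and "N = fst (process_columns J rs cs (M, T))"
  shows "sorted_wrt (\<lambda>c k. \<forall>p. find (\<lambda>r. N r c \<noteq> 0) rs = Some p \<longrightarrow> N p k = 0) cs"
  using assms(2-5) unfolding assms(6)
proof (induction cs arbitrary: M T)
  case (Cons c cs)
  show ?case
  proof (cases "find (\<lambda>r. M r c \<noteq> 0) rs")
    case None
    moreover have "fst (process_columns J rs cs (M, T)) i c = M i c" for i
      using Cons.prems by (intro process_columns_outside[OF fin]) auto
    ultimately show ?thesis using Cons.IH[of M T] Cons.prems by simp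
  next
    case (Some p)
    obtain N V where NV: "process_columns J rs (c # cs) (M, T) = process_columns J rs cs (N, V)"
      "N \<in> mat_on I J" "V \<in> mat_on J J"
      "\<And>i j. N i j = (if j \<in> set cs then M i j - M p j / M p c * M i c else M i j)"
      using process_columns_Some[OF fin Cons.prems(1-4) Some] by blast
    have p: "M p c \<noteq> 0" using Some by (auto simp: find_Some_iff)
    have "fst (process_columns J rs cs (N, V)) i c = M i c" for i
      using Cons.prems NV(2,3) by (subst process_columns_outside[OF fin]) (auto simp: NV(4))
    moreover have "fst (process_columns J rs cs (N, V)) p k = 0" if "k \<in> set cs" for k
      using Cons.prems NV(2,3) p that by (intro process_columns_zero_row[OF fin]) (auto simp: NV(4))
    ultimately show ?thesis
      unfolding NV(1) using Cons.IH[of N V] Cons.prems NV(2,3) Some by simp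
  qed
qed simp

text \<open>The support is a partial bijection between rows and columns.\<close>

definition monomial_on :: "'i set \<Rightarrow> 'j set \<Rightarrow> ('i \<Rightarrow> 'j \<Rightarrow> 'f::zero) \<Rightarrow> bool" where
  "monomial_on I J D \<longleftrightarrow> (\<forall>i\<in>I. \<forall>j\<in>J. D i j \<noteq> 0 \<longrightarrow>
     (\<forall>i'\<in>I. D i' j \<noteq> 0 \<longrightarrow> i' = i) \<and> (\<forall>j'\<in>J. D i j' \<noteq> 0 \<longrightarrow> j' = j))"

text \<open>The hypothesis is what a preceding row reduction achieves: distinct nonzero rows begin
  in distinct columns. A row that is nonzero in the first column \<open>c\<close> begins there, so
  \<open>c\<close> has at most one nonzero entry. Clearing with this column changes only row
  \<open>p\<close>, which becomes zero on the remaining columns, so the hypothesis is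
  inherited.\<close>

lemma process_columns_monomial:
  fixes M :: "'i \<Rightarrow> 'j \<Rightarrow> 'f::field" and T :: "'j \<Rightarrow> 'j \<Rightarrow> 'f"
  assumes fin: "finite J" and "distinct cs" "set cs \<subseteq> J" "M \<in> mat_on I J" "T \<in> mat_on J J"
    and "\<And>r r' p. \<lbrakk>r \<in> set rs; r' \<in> set rs; find (\<lambda>c. M r c \<noteq> 0) cs = Some p;
        find (\<lambda>c. M r' c \<noteq> 0) cs = Some p\<rbrakk> \<Longrightarrow> r = r'"
  shows "monomial_on (set rs) (set cs) (fst (process_columns J rs cs (M, T)))"
  using assms(2-)
proof (induction cs arbitrary: M T)
  case (Cons c cs)
  show ?case
  proof (cases "find (\<lambda>r. M r c \<noteq> 0) rs")
    case None
    then have zero: "M r c = 0" if "r \<in> set rs" for r using that by (auto simp: find_None_iff)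
    have "monomial_on (set rs) (set cs) (fst (process_columns J rs cs (M, T)))"
    proof (rule Cons.IH)
      show "r = r'" if "r \<in> set rs" "r' \<in> set rs" "find (\<lambda>c. M r c \<noteq> 0) cs = Some p"
        "find (\<lambda>c. M r' c \<noteq> 0) cs = Some p" for r r' p
        using that by (intro Cons.prems(5)[of r r' p]) (simp_all add: zero)
    qed (use Cons.prems in auto)
    moreover have "fst (process_columns J rs cs (M, T)) i c = M i c" for i
      using Cons.prems by (intro process_columns_outside[OF fin]) auto
    ultimately show ?thesis using None zero by (auto simp: monomial_on_def)
  next
    case (Some p)
    obtain N V where NV: "process_columns J rs (c # cs) (M, T) = process_columns J rs cs (N, V)"
      "N \<in> mat_on I J" "V \<in> mat_on J J"
      "\<And>i j. N i j = (if j \<in> set cs then M i j - M p j / M p c * M i c else M i j)"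
      using process_columns_Some[OF fin Cons.prems(1-4) Some] by blast
    have p: "p \<in> set rs" "M p c \<noteq> 0" using Some by (auto simp: find_Some_iff)
    have zero: "M r c = 0" if "r \<in> set rs" "r \<noteq> p" for r
      by (rule ccontr) (use Cons.prems(5)[of r p c] that p in simp)
    have Np: "N p k = 0" if "k \<in> set cs" for k using that p by (simp add: NV(4))
    have Nr: "N r k = M r k" if "r \<in> set rs" "r \<noteq> p" for r k using zero[OF that] by (simp add: NV(4))
    let ?D = "fst (process_columns J rs cs (N, V))"
    have "monomial_on (set rs) (set cs) ?D"
    proof (rule Cons.IH)
      fix r r' q
      assume *: "r \<in> set rs" "r' \<in> set rs" "find (\<lambda>c. N r c \<noteq> 0) cs = Some q"
        "find (\<lambda>c. N r' c \<noteq> 0) cs = Some q"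
      have "r \<noteq> p" "r' \<noteq> p"
        using *(3,4) Np by (auto simp: find_Some_iff)
      with * show "r = r'"
        by (intro Cons.prems(5)[of r r' q]) (simp_all add: zero Nr)
    qed (use Cons.prems NV(2,3) in auto)
    moreover have "?D i c = M i c" for i
      using Cons.prems NV(2,3) by (subst process_columns_outside[OF fin]) (auto simp: NV(4))
    moreover have "?D p k = 0" if "k \<in> set cs" for k
      using Cons.prems NV(2,3) that Np by (intro process_columns_zero_row[OF fin]) auto
    ultimately show ?thesis
      unfolding NV(1) using p zero by (simp add: monomial_on_def) metis
  qed
qed (simp add: monomial_on_def)

lemma ordered_column_reduction_unit:
  assumes red: "ordered_column_reduction rs cs M = (N, T)"
    and "distinct cs" "M \<in> mat_on I (set cs)" and Q: "reflp Q" "transp Q"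
    and "sorted_wrt (\<lambda>c k. c \<notin> Z \<longrightarrow> k \<notin> Z \<longrightarrow> Q c k) cs"
    and "\<And>i c. c \<in> Z \<Longrightarrow> M i c = 0"
  shows "T \<in> incidence_units (set cs) Q \<and> N = M \<star>\<^bsub>set cs\<^esub> T"
proof -
  have "\<exists>U\<in>incidence_units (set cs) Q. process_columns (set cs) rs cs (M, mat_id (set cs))
      = (M \<star>\<^bsub>set cs\<^esub> U, mat_id (set cs) \<star>\<^bsub>set cs\<^esub> U)"
    using assms by (intro process_columns_unit[where I = I and Z = Z]) (simp_all add: mat_id_on)
  then obtain U where U: "U \<in> incidence_units (set cs) Q"
    "process_columns (set cs) rs cs (M, mat_id (set cs))
      = (M \<star>\<^bsub>set cs\<^esub> U, mat_id (set cs) \<star>\<^bsub>set cs\<^esub> U)"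
    by blast
  moreover from this have "mat_id (set cs) \<star>\<^bsub>set cs\<^esub> U = U"
    by (intro mat_id_left) (auto intro: incidence_units_on)
  ultimately show ?thesis
    using red by (auto simp: ordered_column_reduction_def)
qed

text \<open>If \<open>c\<close> and \<open>c'\<close> were different, the earlier one would have
  cleared row \<open>p\<close> in the later one.\<close>

lemma ordered_column_reduction_leads:
  assumes red: "ordered_column_reduction rs cs M = (N, T)"
    and "distinct cs" "M \<in> mat_on I (set cs)"
    and c: "c \<in> set cs" "c' \<in> set cs" "find (\<lambda>r. N r c \<noteq> 0) rs = Some p"
      "find (\<lambda>r. N r c' \<noteq> 0) rs = Some p"
  shows "c = c'"
proof -
  have sorted: "sorted_wrt (\<lambda>c k. \<forall>p. find (\<lambda>r. N r c \<noteq> 0) rs = Some p \<longrightarrow> N p k = 0) cs"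
    using assms by (intro process_columns_leads[of "set cs" _ M I "mat_id (set cs)"])
      (auto simp: mat_id_on ordered_column_reduction_def)
  obtain i j where ij: "i < length cs" "j < length cs" "cs ! i = c" "cs ! j = c'"
    using c by (auto simp: in_set_conv_nth)
  have "N p c \<noteq> 0" "N p c' \<noteq> 0" using c by (auto simp: find_Some_iff)
  then have "\<not> i < j" "\<not> j < i"
    using sorted_wrt_nth_less[OF sorted, of i j] sorted_wrt_nth_less[OF sorted, of j i] ij c by auto
  then show ?thesis using ij by simp
qed

lemma ordered_column_reduction_monomial:
  assumes red: "ordered_column_reduction rs cs M = (N, T)"
    and "distinct cs" "M \<in> mat_on I (set cs)"
    and "\<And>r r' p. \<lbrakk>r \<in> set rs; r' \<in> set rs; find (\<lambda>c. M r c \<noteq> 0) cs = Some p;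
        find (\<lambda>c. M r' c \<noteq> 0) cs = Some p\<rbrakk> \<Longrightarrow> r = r'"
  shows "monomial_on (set rs) (set cs) N"
  using process_columns_monomial[of "set cs" cs M I "mat_id (set cs)" rs] assms
  by (simp add: mat_id_on ordered_column_reduction_def)

lemma ordered_row_reduction_transpose:
  "ordered_row_reduction rs cs M = (N, S) \<longleftrightarrow>
     ordered_column_reduction cs rs (mat_transpose M) = (mat_transpose N, mat_transpose S)"
  by (cases "ordered_column_reduction cs rs (mat_transpose M)")
    (auto simp: ordered_row_reduction_def)

text \<open>Adding row \<open>r\<close> to a later row \<open>k\<close> puts a nonzero entry of
  \<open>S\<close> in position \<open>k\<close>, \<open>r\<close>, hence the order of arguments in
  \<open>Q k r\<close>. With rows listed by decreasing birth this becomes the same direction of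
  inequality as for columns.\<close>

lemma ordered_row_reduction_unit:
  assumes red: "ordered_row_reduction rs cs M = (N, S)"
    and "distinct rs" "M \<in> mat_on (set rs) J" and Q: "reflp Q" "transp Q"
    and "sorted_wrt (\<lambda>r k. r \<notin> Z \<longrightarrow> k \<notin> Z \<longrightarrow> Q k r) rs"
    and "\<And>i j. i \<in> Z \<Longrightarrow> M i j = 0"
  shows "S \<in> incidence_units (set rs) Q \<and> N = S \<star>\<^bsub>set rs\<^esub> M"
proof -
  have "mat_transpose S \<in> incidence_units (set rs) (\<lambda>i j. Q j i) \<and>
      mat_transpose N = mat_transpose M \<star>\<^bsub>set rs\<^esub> mat_transpose S"
    using assms
    by (intro ordered_column_reduction_unit[OF red[unfolded ordered_row_reduction_transpose], where Z = Z and I = J])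
      (simp_all add: mat_transpose_on, auto simp: reflp_def transp_def mat_transpose_def)
  moreover from this have "mat_transpose (mat_transpose S) \<in> incidence_units (set rs) Q"
    using incidence_units_transpose by fastforce
  ultimately show ?thesis
    by (metis mat_transpose_prod mat_transpose_transpose)
qed

text \<open>Whichever reduction comes first makes the leading positions of its rows or columns
  distinct, and from such a matrix the other one ends in a monomial matrix. Zero rows of
  \<open>M\<close> survive column operations, so \<open>Z\<close> serves for both orders.\<close>

lemma row_column_reduction_spec:
  assumes red: "row_column_reduction rs cs M S D T"
    and dist: "distinct rs" "distinct cs" and M: "M \<in> mat_on (set rs) (set cs)"
    and Q: "reflp Q" "transp Q" and Q': "reflp Q'" "transp Q'"
    and rs: "sorted_wrt (\<lambda>r k. r \<notin> Z \<longrightarrow> k \<notin> Z \<longrightarrow> Q k r) rs" and cs: "sorted_wrt Q' cs"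
    and Z: "\<And>i j. i \<in> Z \<Longrightarrow> M i j = 0"
  shows "S \<in> incidence_units (set rs) Q" "T \<in> incidence_units (set cs) Q'"
    and "D = S \<star>\<^bsub>set rs\<^esub> M \<star>\<^bsub>set cs\<^esub> T" "monomial_on (set rs) (set cs) D"
proof -
  have cs': "sorted_wrt (\<lambda>c k. c \<notin> {} \<longrightarrow> k \<notin> {} \<longrightarrow> Q' c k) cs" using cs by simp
  have "S \<in> incidence_units (set rs) Q \<and> T \<in> incidence_units (set cs) Q' \<and>
    D = S \<star>\<^bsub>set rs\<^esub> M \<star>\<^bsub>set cs\<^esub> T \<and> monomial_on (set rs) (set cs) D"
    using red unfolding row_column_reduction_def
  proof (elim disjE exE conjE)
    fix N assume N: "ordered_row_reduction rs cs M = (N, S)" "ordered_column_reduction rs cs N = (D, T)"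
    have S: "S \<in> incidence_units (set rs) Q \<and> N = S \<star>\<^bsub>set rs\<^esub> M"
      using N(1) dist(1) M Q rs Z by (rule ordered_row_reduction_unit)
    then have Non: "N \<in> mat_on (set rs) (set cs)" by (auto intro: mat_prod_on incidence_units_on M)
    have T: "T \<in> incidence_units (set cs) Q' \<and> D = N \<star>\<^bsub>set cs\<^esub> T"
      using N(2) dist(2) Non Q' cs' by (rule ordered_column_reduction_unit) simp
    have "monomial_on (set rs) (set cs) D"
      using N(2) dist(2) Non
    proof (rule ordered_column_reduction_monomial)
      fix r r' p
      assume "r \<in> set rs" "r' \<in> set rs" "find (\<lambda>c. N r c \<noteq> 0) cs = Some p"
        "find (\<lambda>c. N r' c \<noteq> 0) cs = Some p"
      then show "r = r'"
        by (intro ordered_column_reduction_leads[OF N(1)[unfolded ordered_row_reduction_transpose]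
              dist(1) mat_transpose_on[OF M]])
          (simp_all add: mat_transpose_def)
    qed
    with S T show ?thesis by simp
  next
    fix N assume N: "ordered_column_reduction rs cs M = (N, T)" "ordered_row_reduction rs cs N = (D, S)"
    have T: "T \<in> incidence_units (set cs) Q' \<and> N = M \<star>\<^bsub>set cs\<^esub> T"
      using N(1) dist(2) M Q' cs' by (rule ordered_column_reduction_unit) simp
    then have Non: "N \<in> mat_on (set rs) (set cs)" by (auto intro: mat_prod_on incidence_units_on M)
    have NZ: "N i j = 0" if "i \<in> Z" for i j
      using T Z[OF that] by (simp add: mat_prod_def)
    have S: "S \<in> incidence_units (set rs) Q \<and> D = S \<star>\<^bsub>set rs\<^esub> N"
      using N(2) dist(1) Non Q rs NZ by (rule ordered_row_reduction_unit)
    have "monomial_on (set cs) (set rs) (mat_transpose D)"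
      using N(2)[unfolded ordered_row_reduction_transpose] dist(1) mat_transpose_on[OF Non]
    proof (rule ordered_column_reduction_monomial)
      fix c c' p
      assume "c \<in> set cs" "c' \<in> set cs" "find (\<lambda>r. mat_transpose N c r \<noteq> 0) rs = Some p"
        "find (\<lambda>r. mat_transpose N c' r \<noteq> 0) rs = Some p"
      then show "c = c'"
        by (intro ordered_column_reduction_leads[OF N(1) dist(2) M]) (simp_all add: mat_transpose_def)
    qed
    then have "monomial_on (set rs) (set cs) D"
      unfolding monomial_on_def mat_transpose_def by blast
    with S T show ?thesis by (simp add: mat_prod_assoc)
  qed
  then show "S \<in> incidence_units (set rs) Q" "T \<in> incidence_units (set cs) Q'"
    "D = S \<star>\<^bsub>set rs\<^esub> M \<star>\<^bsub>set cs\<^esub> T" "monomial_on (set rs) (set cs) D"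
    by blast+
qed

section \<open>Subspaces and cosets\<close>

definition lin_subspace :: "('f::field, 'v) module \<Rightarrow> 'v set \<Rightarrow> bool" where
  "lin_subspace V Z \<longleftrightarrow> Z \<subseteq> carrier V \<and> \<zero>\<^bsub>V\<^esub> \<in> Z \<and> (\<forall>x\<in>Z. \<forall>y\<in>Z. x \<oplus>\<^bsub>V\<^esub> y \<in> Z) \<and>
     (\<forall>a. \<forall>x\<in>Z. a \<odot>\<^bsub>V\<^esub> x \<in> Z)"

lemma lin_subspaceD:
  assumes "lin_subspace V Z"
  shows "x \<in> Z \<Longrightarrow> x \<in> carrier V" "\<zero>\<^bsub>V\<^esub> \<in> Z" "x \<in> Z \<Longrightarrow> y \<in> Z \<Longrightarrow> x \<oplus>\<^bsub>V\<^esub> y \<in> Z"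
    "x \<in> Z \<Longrightarrow> a \<odot>\<^bsub>V\<^esub> x \<in> Z"
  using assms by (auto simp: lin_subspace_def)

lemma vectorspace_smult:
  assumes "vectorspace (class_ring :: 'f::field ring) V" "x \<in> carrier V"
  shows "a \<odot>\<^bsub>V\<^esub> x \<in> carrier V" "0 \<odot>\<^bsub>V\<^esub> x = \<zero>\<^bsub>V\<^esub>" "1 \<odot>\<^bsub>V\<^esub> x = x"
    "(a + c) \<odot>\<^bsub>V\<^esub> x = a \<odot>\<^bsub>V\<^esub> x \<oplus>\<^bsub>V\<^esub> c \<odot>\<^bsub>V\<^esub> x" "(a * c) \<odot>\<^bsub>V\<^esub> x = a \<odot>\<^bsub>V\<^esub> (c \<odot>\<^bsub>V\<^esub> x)"
    "y \<in> carrier V \<Longrightarrow> a \<odot>\<^bsub>V\<^esub> (x \<oplus>\<^bsub>V\<^esub> y) = a \<odot>\<^bsub>V\<^esub> x \<oplus>\<^bsub>V\<^esub> a \<odot>\<^bsub>V\<^esub> y"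
    "x \<oplus>\<^bsub>V\<^esub> (-1) \<odot>\<^bsub>V\<^esub> x = \<zero>\<^bsub>V\<^esub>"
proof -
  interpret vectorspace "class_ring :: 'f ring" V by (rule assms(1))
  note x = assms(2)
  show "a \<odot>\<^bsub>V\<^esub> x \<in> carrier V" using x smult_closed[of a x] by simp
  show *: "0 \<odot>\<^bsub>V\<^esub> x = \<zero>\<^bsub>V\<^esub>" using x smult_l_null[of x] by simp
  show **: "1 \<odot>\<^bsub>V\<^esub> x = x" using x smult_one[of x] by simp
  show "(a + c) \<odot>\<^bsub>V\<^esub> x = a \<odot>\<^bsub>V\<^esub> x \<oplus>\<^bsub>V\<^esub> c \<odot>\<^bsub>V\<^esub> x" using x smult_l_distr[of a c x] by simp
  show "(a * c) \<odot>\<^bsub>V\<^esub> x = a \<odot>\<^bsub>V\<^esub> (c \<odot>\<^bsub>V\<^esub> x)" using x smult_assoc1[of a c x] by simp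
  show "a \<odot>\<^bsub>V\<^esub> (x \<oplus>\<^bsub>V\<^esub> y) = a \<odot>\<^bsub>V\<^esub> x \<oplus>\<^bsub>V\<^esub> a \<odot>\<^bsub>V\<^esub> y" if "y \<in> carrier V"
    using x that smult_r_distr[of a x y] by simp
  show "x \<oplus>\<^bsub>V\<^esub> (-1) \<odot>\<^bsub>V\<^esub> x = \<zero>\<^bsub>V\<^esub>"
    using x smult_l_distr[of 1 "-1" x] * ** by simp
qed

lemma vectorspace_add:
  assumes "vectorspace (class_ring :: 'f::field ring) V"
  shows "abelian_group V"
  using assms module.axioms(2) unfolding VectorSpace.vectorspace_def by blast

text \<open>The axioms pass to the image under a map compatible with the operations; negatives are
  multiples by -1, so closure of \<open>Z\<close> under addition and scaling suffices. It is meant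
  for \<open>q\<close> sending a cycle to its homology class.\<close>

lemma vectorspace_image:
  fixes V :: "('f::field, 'v) module" and N :: "('f, 'w) module"
  assumes V: "vectorspace (class_ring :: 'f::field ring) V" and Z: "lin_subspace V Z"
    and carrier: "carrier N = q ` Z" and zero: "\<zero>\<^bsub>N\<^esub> = q \<zero>\<^bsub>V\<^esub>"
    and add: "\<And>x y. x \<in> Z \<Longrightarrow> y \<in> Z \<Longrightarrow> q x \<oplus>\<^bsub>N\<^esub> q y = q (x \<oplus>\<^bsub>V\<^esub> y)"
    and smult: "\<And>a x. x \<in> Z \<Longrightarrow> a \<odot>\<^bsub>N\<^esub> q x = q (a \<odot>\<^bsub>V\<^esub> x)"
  shows "vectorspace (class_ring :: 'f ring) N"
proof -
  interpret V: abelian_group V using V by (rule vectorspace_add)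
  note Z = lin_subspaceD[OF Z] and vs = vectorspace_smult[OF V]
  have neg: "\<exists>y\<in>Z. y \<oplus>\<^bsub>V\<^esub> x = \<zero>\<^bsub>V\<^esub>" if "x \<in> Z" for x
  proof
    show "(-1) \<odot>\<^bsub>V\<^esub> x \<in> Z" using that by (rule Z(4))
    then show "(-1) \<odot>\<^bsub>V\<^esub> x \<oplus>\<^bsub>V\<^esub> x = \<zero>\<^bsub>V\<^esub>"
      using vs(7)[OF Z(1)[OF that]] V.a_comm Z(1) that by metis
  qed
  have "abelian_group N"
  proof (rule abelian_groupI)
    show "x \<oplus>\<^bsub>N\<^esub> y \<in> carrier N" if "x \<in> carrier N" "y \<in> carrier N" for x y
      using that by (auto simp: carrier add Z)
    show "\<zero>\<^bsub>N\<^esub> \<in> carrier N" by (auto simp: carrier zero Z)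
    show "(x \<oplus>\<^bsub>N\<^esub> y) \<oplus>\<^bsub>N\<^esub> z = x \<oplus>\<^bsub>N\<^esub> (y \<oplus>\<^bsub>N\<^esub> z)"
      if "x \<in> carrier N" "y \<in> carrier N" "z \<in> carrier N" for x y z
      using that by (auto simp: carrier add Z V.a_assoc)
    show "x \<oplus>\<^bsub>N\<^esub> y = y \<oplus>\<^bsub>N\<^esub> x" if xy: "x \<in> carrier N" "y \<in> carrier N" for x y
    proof -
      obtain u v where "u \<in> Z" "v \<in> Z" "x = q u" "y = q v" using xy by (auto simp: carrier)
      then show ?thesis using V.a_comm[of u v] by (simp add: add Z)
    qed
    show "\<zero>\<^bsub>N\<^esub> \<oplus>\<^bsub>N\<^esub> x = x" if "x \<in> carrier N" for x
      using that by (auto simp: carrier zero add Z)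
    show "\<exists>y\<in>carrier N. y \<oplus>\<^bsub>N\<^esub> x = \<zero>\<^bsub>N\<^esub>" if x: "x \<in> carrier N" for x
    proof -
      obtain u where u: "u \<in> Z" "x = q u" using x by (auto simp: carrier)
      then obtain w where "w \<in> Z" "w \<oplus>\<^bsub>V\<^esub> u = \<zero>\<^bsub>V\<^esub>" using neg by blast
      with u show ?thesis by (intro bexI[where x = "q w"]) (simp_all add: add zero carrier)
    qed
  qed
  moreover have "module (class_ring :: 'f ring) N"
  proof (rule moduleI)
    show "cring (class_ring :: 'f ring)" by (rule class_cring.is_cring)
  qed (use calculation in \<open>auto simp: carrier smult add Z vs\<close>)
  ultimately show ?thesis
    by (simp add: VectorSpace.vectorspace_def class_field)
qed

lemma coset_iff: "u \<in> B +>\<^bsub>V\<^esub> x \<longleftrightarrow> (\<exists>h\<in>B. u = h \<oplus>\<^bsub>V\<^esub> x)"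
  by (auto simp: a_r_coset_def')

context
  fixes V :: "('f::field, 'v) module" and B :: "'v set"
  assumes V: "vectorspace (class_ring :: 'f ring) V" and B: "lin_subspace V B"
begin

interpretation V: abelian_group V using V by (rule vectorspace_add)

lemma coset_absorb:
  assumes "h \<in> B" "x \<in> carrier V"
  shows "B +>\<^bsub>V\<^esub> (h \<oplus>\<^bsub>V\<^esub> x) = B +>\<^bsub>V\<^esub> x"
proof (intro subset_antisym subsetI)
  fix u assume "u \<in> B +>\<^bsub>V\<^esub> (h \<oplus>\<^bsub>V\<^esub> x)"
  then obtain k where "k \<in> B" "u = k \<oplus>\<^bsub>V\<^esub> (h \<oplus>\<^bsub>V\<^esub> x)" by (auto simp: coset_iff)
  with assms show "u \<in> B +>\<^bsub>V\<^esub> x"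
    unfolding coset_iff using lin_subspaceD[OF B]
    by (intro bexI[where x = "k \<oplus>\<^bsub>V\<^esub> h"]) (auto simp: V.a_assoc)
next
  fix u assume "u \<in> B +>\<^bsub>V\<^esub> x"
  then obtain k where k: "k \<in> B" "u = k \<oplus>\<^bsub>V\<^esub> x" by (auto simp: coset_iff)
  let ?m = "(-1) \<odot>\<^bsub>V\<^esub> h"
  have c: "k \<in> carrier V" "h \<in> carrier V" "?m \<in> carrier V"
    using k assms lin_subspaceD[OF B] by auto
  have "(k \<oplus>\<^bsub>V\<^esub> ?m) \<oplus>\<^bsub>V\<^esub> (h \<oplus>\<^bsub>V\<^esub> x) = (k \<oplus>\<^bsub>V\<^esub> (h \<oplus>\<^bsub>V\<^esub> ?m)) \<oplus>\<^bsub>V\<^esub> x"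
    using c assms by (simp add: V.a_ac)
  also have "\<dots> = u" using k c vectorspace_smult(7)[OF V c(2)] by simp
  finally show "u \<in> B +>\<^bsub>V\<^esub> (h \<oplus>\<^bsub>V\<^esub> x)"
    unfolding coset_iff using k assms lin_subspaceD[OF B]
    by (intro bexI[where x = "k \<oplus>\<^bsub>V\<^esub> ?m"]) auto
qed

lemma coset_eqD:
  assumes "x \<in> carrier V" "B +>\<^bsub>V\<^esub> x = B +>\<^bsub>V\<^esub> y"
  obtains h where "h \<in> B" "x = h \<oplus>\<^bsub>V\<^esub> y"
proof -
  have "x \<in> B +>\<^bsub>V\<^esub> x"
    unfolding coset_iff using assms lin_subspaceD(2)[OF B] by (intro bexI[where x = "\<zero>\<^bsub>V\<^esub>"]) auto
  then show thesis using assms(2) that by (auto simp: coset_iff)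
qed

lemma coset_add:
  assumes "x \<in> carrier V" "y \<in> carrier V"
  shows "set_add V (B +>\<^bsub>V\<^esub> x) (B +>\<^bsub>V\<^esub> y) = B +>\<^bsub>V\<^esub> (x \<oplus>\<^bsub>V\<^esub> y)"
proof (intro subset_antisym subsetI)
  fix u assume "u \<in> set_add V (B +>\<^bsub>V\<^esub> x) (B +>\<^bsub>V\<^esub> y)"
  then obtain h k where *: "h \<in> B" "k \<in> B" "u = (h \<oplus>\<^bsub>V\<^esub> x) \<oplus>\<^bsub>V\<^esub> (k \<oplus>\<^bsub>V\<^esub> y)"
    by (auto simp: set_add_def' coset_iff)
  then have "u = (h \<oplus>\<^bsub>V\<^esub> k) \<oplus>\<^bsub>V\<^esub> (x \<oplus>\<^bsub>V\<^esub> y)"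
    using assms lin_subspaceD(1)[OF B] by (simp add: V.a_ac)
  with * show "u \<in> B +>\<^bsub>V\<^esub> (x \<oplus>\<^bsub>V\<^esub> y)"
    unfolding coset_iff using lin_subspaceD(3)[OF B] by blast
next
  fix u assume "u \<in> B +>\<^bsub>V\<^esub> (x \<oplus>\<^bsub>V\<^esub> y)"
  then obtain h where h: "h \<in> B" "u = h \<oplus>\<^bsub>V\<^esub> (x \<oplus>\<^bsub>V\<^esub> y)" by (auto simp: coset_iff)
  then have "u = (h \<oplus>\<^bsub>V\<^esub> x) \<oplus>\<^bsub>V\<^esub> (\<zero>\<^bsub>V\<^esub> \<oplus>\<^bsub>V\<^esub> y)"
    using assms lin_subspaceD(1)[OF B] by (simp add: V.a_ac)
  with h show "u \<in> set_add V (B +>\<^bsub>V\<^esub> x) (B +>\<^bsub>V\<^esub> y)"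
    using lin_subspaceD(2)[OF B] unfolding set_add_def' by (force simp: coset_iff)
qed

end

text \<open>All members of the coset contribute the same set and there is at least one member, so
  the union collapses. This is the common reason why scaling, structure maps and induced maps on
  homology, all defined as unions over a coset, are well defined.\<close>

lemma coset_induced_map:
  assumes V: "vectorspace (class_ring :: 'f::field ring) V" "lin_subspace V B"
    and W: "vectorspace (class_ring :: 'f ring) W" "lin_subspace W B'"
    and g: "\<And>h. h \<in> B \<Longrightarrow> g h \<in> B'" "g x \<in> carrier W"
      "\<And>h. h \<in> B \<Longrightarrow> g (h \<oplus>\<^bsub>V\<^esub> x) = g h \<oplus>\<^bsub>W\<^esub> g x"
  shows "(\<Union>u\<in>B +>\<^bsub>V\<^esub> x. B' +>\<^bsub>W\<^esub> g u) = B' +>\<^bsub>W\<^esub> g x"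
proof -
  have "B' +>\<^bsub>W\<^esub> g u = B' +>\<^bsub>W\<^esub> g x" if "u \<in> B +>\<^bsub>V\<^esub> x" for u
    using that g coset_absorb[OF W] by (auto simp: coset_iff)
  moreover have "B +>\<^bsub>V\<^esub> x \<noteq> {}"
    using lin_subspaceD(2)[OF V(2)] by (auto simp: a_r_coset_def')
  ultimately show ?thesis by blast
qed

section \<open>Coordinates\<close>

text \<open>Vectors are 0 off \<open>K\<close>, not \<open>undefined\<close> as the elements of
  \<open>interval_sum\<close> are off their index set. A vector on a smaller set is then literally
  one on a larger set, and structure maps become the identity on coordinates.\<close>

definition vec_on :: "'j set \<Rightarrow> ('j \<Rightarrow> 'f::zero) set" where
  "vec_on K = {v. \<forall>j. j \<notin> K \<longrightarrow> v j = 0}"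

definition mat_vec :: "('i \<Rightarrow> 'j \<Rightarrow> 'f::field) \<Rightarrow> 'j set \<Rightarrow> ('j \<Rightarrow> 'f) \<Rightarrow> 'i \<Rightarrow> 'f" where
  "mat_vec A J v = (\<lambda>i. \<Sum>j\<in>J. A i j * v j)"

definition single_vec :: "'j \<Rightarrow> 'f::zero \<Rightarrow> 'j \<Rightarrow> 'f" where
  "single_vec j x = (\<lambda>k. if k = j then x else 0)"

lemma vec_onD: "v \<in> vec_on K \<Longrightarrow> v j \<noteq> 0 \<Longrightarrow> j \<in> K"
  by (auto simp: vec_on_def)

lemma vec_on_zero: "v \<in> vec_on K \<Longrightarrow> j \<notin> K \<Longrightarrow> v j = 0"
  by (auto simp: vec_on_def)

lemma vec_on_mono: "v \<in> vec_on K \<Longrightarrow> K \<subseteq> L \<Longrightarrow> v \<in> vec_on L"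
  by (auto simp: vec_on_def)

lemma vec_on_0 [simp]: "(\<lambda>_. 0) \<in> vec_on K"
  by (simp add: vec_on_def)

lemma vec_on_add: "v \<in> vec_on K \<Longrightarrow> w \<in> vec_on K \<Longrightarrow> (\<lambda>j. v j + w j :: 'f::monoid_add) \<in> vec_on K"
  by (simp add: vec_on_def)

lemma vec_on_scale: "v \<in> vec_on K \<Longrightarrow> (\<lambda>j. a * v j :: 'f::mult_zero) \<in> vec_on K"
  by (simp add: vec_on_def)

lemma single_vec_on: "j \<in> K \<Longrightarrow> single_vec j x \<in> vec_on K"
  by (auto simp: vec_on_def single_vec_def)

lemma mat_vec_nonzeroE:
  assumes "mat_vec A J v i \<noteq> 0"
  obtains j where "j \<in> J" "A i j \<noteq> 0" "v j \<noteq> 0"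
proof -
  have "\<exists>j\<in>J. A i j * v j \<noteq> 0"
    using assms unfolding mat_vec_def by (meson sum.neutral)
  with that show thesis by auto
qed

lemma mat_vec_add: "mat_vec A J (\<lambda>j. v j + w j) = (\<lambda>i. mat_vec A J v i + mat_vec A J w i)"
  by (rule ext) (simp add: mat_vec_def sum.distrib distrib_left)

lemma mat_vec_scale: "mat_vec A J (\<lambda>j. a * v j) = (\<lambda>i. a * mat_vec A J v i)"
  by (rule ext) (simp add: mat_vec_def sum_distrib_left algebra_simps)

lemma mat_vec_single: "finite J \<Longrightarrow> j \<in> J \<Longrightarrow> mat_vec A J (single_vec j x) = (\<lambda>i. A i j * x)"
  by (rule ext) (simp add: mat_vec_def single_vec_def if_distrib[of "\<lambda>x. _ * x"] cong: if_cong)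

lemma mat_vec_prod:
  "finite K \<Longrightarrow> finite J \<Longrightarrow> mat_vec (A \<star>\<^bsub>K\<^esub> B) J v = mat_vec A K (mat_vec B J v)"
  by (rule ext)
    (simp add: mat_vec_def mat_prod_def sum_distrib_left sum_distrib_right mult.assoc sum.swap[of _ J K])

lemma mat_vec_id: "finite J \<Longrightarrow> v \<in> vec_on J \<Longrightarrow> mat_vec (mat_id J) J v = v"
proof
  fix i assume *: "finite J" "v \<in> vec_on J"
  have "mat_vec (mat_id J) J v i = (\<Sum>j\<in>J. if j = i then v i else 0)"
    unfolding mat_vec_def by (rule sum.cong) (auto simp: mat_id_def)
  with * show "mat_vec (mat_id J) J v i = v i" by (simp add: vec_on_zero)
qed

definition lin_coords :: "'j set \<Rightarrow> ('f::field, 'v) module \<Rightarrow> (('j \<Rightarrow> 'f) \<Rightarrow> 'v) \<Rightarrow> bool" where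
  "lin_coords K V \<psi> \<longleftrightarrow> bij_betw \<psi> (vec_on K) (carrier V) \<and>
     (\<forall>v\<in>vec_on K. \<forall>w\<in>vec_on K. \<psi> (\<lambda>j. v j + w j) = \<psi> v \<oplus>\<^bsub>V\<^esub> \<psi> w) \<and>
     (\<forall>a. \<forall>v\<in>vec_on K. \<psi> (\<lambda>j. a * v j) = a \<odot>\<^bsub>V\<^esub> \<psi> v)"

lemma lin_coordsD:
  assumes "lin_coords K V \<psi>"
  shows "v \<in> vec_on K \<Longrightarrow> \<psi> v \<in> carrier V"
    and "v \<in> vec_on K \<Longrightarrow> w \<in> vec_on K \<Longrightarrow> \<psi> v = \<psi> w \<longleftrightarrow> v = w"
    and "v \<in> vec_on K \<Longrightarrow> w \<in> vec_on K \<Longrightarrow> \<psi> (\<lambda>j. v j + w j) = \<psi> v \<oplus>\<^bsub>V\<^esub> \<psi> w"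
    and "v \<in> vec_on K \<Longrightarrow> \<psi> (\<lambda>j. a * v j) = a \<odot>\<^bsub>V\<^esub> \<psi> v"
    and "carrier V = \<psi> ` vec_on K"
  using assms by (auto simp: lin_coords_def bij_betw_def inj_on_eq_iff)

lemma lin_coords_zero:
  assumes "vectorspace (class_ring :: 'f::field ring) V" "lin_coords K V \<psi>"
  shows "\<psi> (\<lambda>_. 0) = \<zero>\<^bsub>V\<^esub>"
  using lin_coordsD(4)[OF assms(2) vec_on_0, of 0]
    vectorspace_smult(2)[OF assms(1) lin_coordsD(1)[OF assms(2) vec_on_0]] by simp

lemma lin_coords_subspace:
  fixes V :: "('f::field, 'v) module" and K :: "'j set"
  assumes "vectorspace (class_ring :: 'f::field ring) V" "lin_coords K V \<psi>" "L \<subseteq> K"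
  shows "lin_subspace V (\<psi> ` vec_on L)"
proof -
  have on: "v \<in> vec_on K" if "v \<in> vec_on L" for v :: "'j \<Rightarrow> 'f"
    using that assms(3) by (rule vec_on_mono)
  show ?thesis
    unfolding lin_subspace_def
  proof (intro conjI ballI allI)
    show "\<zero>\<^bsub>V\<^esub> \<in> \<psi> ` vec_on L"
      using lin_coords_zero[OF assms(1,2)] vec_on_0 by (metis imageI)
    show "x \<oplus>\<^bsub>V\<^esub> y \<in> \<psi> ` vec_on L" if "x \<in> \<psi> ` vec_on L" "y \<in> \<psi> ` vec_on L" for x y
      using that by (auto simp: on vec_on_add simp flip: lin_coordsD(3)[OF assms(2)])
    show "a \<odot>\<^bsub>V\<^esub> x \<in> \<psi> ` vec_on L" if "x \<in> \<psi> ` vec_on L" for a x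
      using that by (auto simp: on vec_on_scale simp flip: lin_coordsD(4)[OF assms(2)])
  qed (use lin_coordsD(1)[OF assms(2)] on in auto)
qed

text \<open>\<open>G\<close> is invertible on all of \<open>J\<close>, but only the part
  \<open>K\<close> of the basis is present in \<open>V\<close>. Since both \<open>G\<close> and its
  inverse preserve the vectors on \<open>K\<close>, \<open>G\<close> restricts to a bijection of
  them.\<close>

lemma lin_coords_reparametrise:
  assumes "lin_coords K V \<psi>" and fin: "finite J"
    and G: "G \<star>\<^bsub>J\<^esub> H = mat_id J" "H \<star>\<^bsub>J\<^esub> G = mat_id J" and K: "K \<subseteq> J"
    and on: "\<And>v. v \<in> vec_on K \<Longrightarrow> mat_vec G J v \<in> vec_on K" "\<And>v. v \<in> vec_on K \<Longrightarrow> mat_vec H J v \<in> vec_on K"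
  shows "lin_coords K V (\<lambda>v. \<psi> (mat_vec G J v))"
proof -
  have GH: "mat_vec G J (mat_vec H J v) = v" "mat_vec H J (mat_vec G J v) = v" if "v \<in> vec_on K" for v
    using mat_vec_id[OF fin vec_on_mono[OF that K]] G by (simp_all flip: mat_vec_prod[OF fin fin])
  have "bij_betw (mat_vec G J) (vec_on K) (vec_on K)"
    by (rule bij_betw_byWitness[where f' = "mat_vec H J"]) (auto simp: GH on)
  then have "bij_betw (\<psi> \<circ> mat_vec G J) (vec_on K) (carrier V)"
    using assms(1) unfolding lin_coords_def by (blast intro: bij_betw_trans)
  then show ?thesis
    using assms(1) by (simp add: lin_coords_def comp_def mat_vec_add mat_vec_scale on)
qed

section \<open>Complexes with monomial boundary matrices\<close>

lemma upper_antimono: "c \<le> d \<Longrightarrow> upper d \<subseteq> upper c"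
  by (auto simp: less_eq_cut_def upper_eq)

lemma upper_upclosed: "s \<in> upper c \<Longrightarrow> s \<le> t \<Longrightarrow> t \<in> upper c"
  using cut_less[of t c s] by (auto simp: upper_eq)

lemma lower_infinity [simp]: "lower cut_infinity = UNIV"
  by (simp add: lower_def cut_infinity_def Abs_cut_inverse)

lemma le_cut_infinity [simp]: "c \<le> cut_infinity"
  by (simp add: less_eq_cut_def)

text \<open>This is how finiteness of births is used: at a time when a basis element is alive, its
  column in a matrix can be recovered from the map.\<close>

lemma upper_nonempty: "c < cut_infinity \<Longrightarrow> \<exists>t. t \<in> upper c"
  by (auto simp: less_cut_def upper_eq)

definition alive :: "(nat \<Rightarrow> 'j set) \<Rightarrow> (nat \<Rightarrow> 'j \<Rightarrow> ('r::linorder) cut) \<Rightarrow> nat \<Rightarrow> 'r \<Rightarrow> 'j set" where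
  "alive J b n t = {j \<in> J n. t \<in> upper (b n j)}"

lemma alive_subset: "alive J b n t \<subseteq> J n"
  by (auto simp: alive_def)

lemma alive_mono: "s \<le> t \<Longrightarrow> alive J b n s \<subseteq> alive J b n t"
  by (auto simp: alive_def intro: upper_upclosed)

text \<open>A nonzero entry leads from a column that is already born to a row born no later.\<close>

lemma mat_vec_alive:
  assumes "A \<in> mat_on (J' m) (J n)" "\<And>i j. A i j \<noteq> 0 \<Longrightarrow> b' m i \<le> b n j" "v \<in> vec_on (alive J b n t)"
  shows "mat_vec A (J n) v \<in> vec_on (alive J' b' m t)"
  unfolding vec_on_def
proof (intro CollectI allI impI, rule ccontr)
  fix i assume "i \<notin> alive J' b' m t" "mat_vec A (J n) v i \<noteq> 0"
  then obtain j where j: "A i j \<noteq> 0" "v j \<noteq> 0" by (elim mat_vec_nonzeroE)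
  then have "i \<in> J' m" "t \<in> upper (b n j)"
    using mat_onD[OF assms(1)] vec_onD[OF assms(3)] by (auto simp: alive_def)
  with j \<open>i \<notin> alive J' b' m t\<close> show False
    using upper_antimono[OF assms(2)[OF j(1)]] by (auto simp: alive_def)
qed

lemma interval_sum_carrier:
  "carrier (fib (interval_sum \<D>) t) =
     (\<Pi>\<^sub>E j\<in>idx \<D>. if t \<in> bar (birth \<D> j) (death \<D> j) then UNIV else {0})"
  by (auto simp: interval_sum_def direct_sum_pm_def interval_module_def intro!: PiE_cong)

lemma interval_sum_add:
  "v \<oplus>\<^bsub>fib (interval_sum \<D>) t\<^esub> w = (\<lambda>j\<in>idx \<D>. v j + w j)"
  by (simp add: interval_sum_def direct_sum_pm_def interval_module_def)

lemma interval_sum_smult: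
  "a \<odot>\<^bsub>fib (interval_sum \<D>) t\<^esub> w = (\<lambda>j\<in>idx \<D>. a * w j)"
  by (simp add: interval_sum_def direct_sum_pm_def interval_module_def)

lemma interval_sum_str:
  "str (interval_sum \<D>) s t w = (\<lambda>j\<in>idx \<D>. if s \<in> bar (birth \<D> j) (death \<D> j) \<and>
     t \<in> bar (birth \<D> j) (death \<D> j) then w j else 0)"
  by (auto simp: interval_sum_def direct_sum_pm_def interval_module_def intro!: restrict_ext)

text \<open>The basis of \<open>obj C n\<close> given by \<open>\<psi>\<close> splits into the chains, indexed by \<open>P n\<close>, that kill a class
  in degree \<open>n - 1\<close>, the cycles that get killed and the cycles that live forever.\<close>

locale reduced_complex =
  fixes C :: "('r::linorder, 'f::field, 'v) complex_pm"
    and J :: "nat \<Rightarrow> 'j set" and b :: "nat \<Rightarrow> 'j \<Rightarrow> 'r cut" and \<psi> :: "nat \<Rightarrow> 'r \<Rightarrow> ('j \<Rightarrow> 'f) \<Rightarrow> 'v"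
    and D :: "nat \<Rightarrow> 'j \<Rightarrow> 'j \<Rightarrow> 'f" and P :: "nat \<Rightarrow> 'j set"
  assumes complex: "chain_complex C"
    and fin: "finite (J n)"
    and birth_finite: "j \<in> J n \<Longrightarrow> b n j < cut_infinity"
    and P_0: "P 0 = {}"
    and P_Suc: "P (Suc n) = {j \<in> J (Suc n). \<exists>i\<in>J n. D (Suc n) i j \<noteq> 0}"
    and D_on: "D (Suc n) \<in> mat_on (J n) (J (Suc n))"
    and D_monomial: "monomial_on (J n) (J (Suc n)) (D (Suc n))"
    and D_birth: "D (Suc n) i j \<noteq> 0 \<Longrightarrow> b n i \<le> b (Suc n) j"
    and D_P: "D (Suc n) i j \<noteq> 0 \<Longrightarrow> i \<notin> P n"
    and coords: "lin_coords (alive J b n t) (fib (obj C n) t) (\<psi> n t)"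
    and str_coords: "s \<le> t \<Longrightarrow> v \<in> vec_on (alive J b n s) \<Longrightarrow> str (obj C n) s t (\<psi> n s v) = \<psi> n t v"
    and bd_coords: "v \<in> vec_on (alive J b (Suc n) t) \<Longrightarrow>
      bd C (Suc n) t (\<psi> (Suc n) t v) = \<psi> n t (mat_vec (D (Suc n)) (J (Suc n)) v)"
begin

section \<open>Cycles, boundaries and homology in coordinates\<close>

definition cyc :: "nat \<Rightarrow> 'r \<Rightarrow> 'j set" where
  "cyc n t = alive J b n t - P n"

definition dead :: "nat \<Rightarrow> 'r \<Rightarrow> 'j set" where
  "dead n t = {i \<in> J n. \<exists>p\<in>alive J b (Suc n) t. D (Suc n) i p \<noteq> 0}"

definition bars :: "nat \<Rightarrow> 'r \<Rightarrow> 'j set" where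
  "bars n t = {j \<in> J n - P n. t \<in> bar (b n j) (ph_death J b D n j)}"

definition hclass :: "nat \<Rightarrow> 'r \<Rightarrow> ('j \<Rightarrow> 'f) \<Rightarrow> 'v set" where
  "hclass n t v = homology_class C n t (\<psi> n t v)"

lemma vs: "vectorspace class_ring (fib (obj C n) t)"
  using complex by (simp add: chain_complex_def is_pers_module_def)

lemma D_unique:
  assumes "D (Suc n) i p \<noteq> 0"
  shows "i \<in> J n" "p \<in> J (Suc n)" "D (Suc n) i' p \<noteq> 0 \<Longrightarrow> i' = i" "D (Suc n) i p' \<noteq> 0 \<Longrightarrow> p' = p"
  using assms D_monomial[of n] mat_onD[OF D_on[of n]] unfolding monomial_on_def by blast+

lemma cyc_alive: "cyc n t \<subseteq> alive J b n t"
  by (auto simp: cyc_def)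

text \<open>The coordinate form of the fact that boundaries are cycles: \<open>D_P\<close> keeps
  pivot rows outside \<open>P n\<close>, and \<open>D_birth\<close> has them born no later than
  their pivot columns.\<close>

lemma dead_cyc: "dead n t \<subseteq> cyc n t"
  using D_P D_birth upper_antimono by (fastforce simp: dead_def cyc_def alive_def)

lemma dead_alive: "dead n t \<subseteq> alive J b n t"
  using dead_cyc cyc_alive by blast

lemma cyc_mono: "s \<le> t \<Longrightarrow> cyc n s \<subseteq> cyc n t"
  using alive_mono[of s t J b n] by (auto simp: cyc_def)

lemma dead_mono: "s \<le> t \<Longrightarrow> dead n s \<subseteq> dead n t"
  using alive_mono[of s t J b "Suc n"] by (auto simp: dead_def)

lemma ph_death_pivot:
  assumes "D (Suc n) j p \<noteq> 0"
  shows "ph_death J b D n j = b (Suc n) p"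
proof -
  have "(THE p. p \<in> J (Suc n) \<and> D (Suc n) j p \<noteq> 0) = p"
    using assms D_unique(2,4)[OF assms] by (intro the_equality) blast+
  moreover have "\<exists>p\<in>J (Suc n). D (Suc n) j p \<noteq> 0" using assms D_unique(2)[OF assms] by blast
  ultimately show ?thesis by (simp add: ph_death_def)
qed

lemma ph_death_no_pivot: "(\<And>p. D (Suc n) j p = 0) \<Longrightarrow> ph_death J b D n j = cut_infinity"
  by (simp add: ph_death_def)

lemma birth_le_death: "b n j \<le> ph_death J b D n j"
proof (cases "\<exists>p. D (Suc n) j p \<noteq> 0")
  case True
  then show ?thesis using D_birth ph_death_pivot by fastforce
qed (simp add: ph_death_no_pivot)

text \<open>The death of \<open>j\<close> is the birth of its pivot column, so \<open>t\<close>
  precedes it exactly if that column is not yet alive. Without a pivot the bar never ends and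
  \<open>j\<close> is never in \<open>dead\<close>.\<close>

lemma bars_eq: "bars n t = cyc n t - dead n t"
proof (intro subset_antisym subsetI)
  fix j assume j: "j \<in> bars n t"
  then have "j \<notin> dead n t"
    by (auto simp: bars_def dead_def alive_def bar_def ph_death_pivot upper_eq)
  with j show "j \<in> cyc n t - dead n t"
    by (auto simp: bars_def cyc_def alive_def bar_def)
next
  fix j assume j: "j \<in> cyc n t - dead n t"
  have "t \<in> lower (ph_death J b D n j)"
  proof (cases "\<exists>p. D (Suc n) j p \<noteq> 0")
    case True
    then obtain p where p: "D (Suc n) j p \<noteq> 0" by blast
    from j have "p \<notin> alive J b (Suc n) t" using p D_unique(1)[OF p] unfolding dead_def by blast
    with D_unique(2)[OF p] show ?thesis by (simp add: ph_death_pivot[OF p] alive_def upper_eq)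
  qed (simp add: ph_death_no_pivot)
  with j show "j \<in> bars n t" by (auto simp: bars_def cyc_def alive_def bar_def)
qed

lemma mat_vec_D: "D (Suc n) i p \<noteq> 0 \<Longrightarrow> mat_vec (D (Suc n)) (J (Suc n)) v i = D (Suc n) i p * v p"
proof -
  assume p: "D (Suc n) i p \<noteq> 0"
  have "mat_vec (D (Suc n)) (J (Suc n)) v i = (\<Sum>j\<in>J (Suc n). if j = p then D (Suc n) i p * v p else 0)"
    unfolding mat_vec_def using D_unique(4)[OF p] by (intro sum.cong) auto
  then show ?thesis using D_unique(2)[OF p] fin[of "Suc n"] by simp
qed

lemma mat_vec_D_0: "(\<And>p. D (Suc n) i p = 0) \<Longrightarrow> mat_vec (D (Suc n)) (J (Suc n)) v i = 0"
  by (simp add: mat_vec_def)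

lemma D_alive: "v \<in> vec_on (alive J b (Suc n) t) \<Longrightarrow>
    mat_vec (D (Suc n)) (J (Suc n)) v \<in> vec_on (alive J b n t)"
  using D_on D_birth by (rule mat_vec_alive)

text \<open>Distinct pivot columns of a monomial matrix hit distinct rows, so nothing can cancel and
  a kernel vector vanishes at every pivot column. In degree 0, \<open>P 0 = {}\<close> matches the
  convention that every chain is a cycle.\<close>

lemma cycles_eq: "cycles C n t = \<psi> n t ` vec_on (cyc n t)"
proof (cases n)
  case 0
  then show ?thesis using lin_coordsD(5)[OF coords] by (simp add: cyc_def P_0)
next
  case (Suc m)
  have zero: "bd C n t (\<psi> n t v) = \<zero>\<^bsub>fib (obj C m) t\<^esub> \<longleftrightarrow> v \<in> vec_on (cyc n t)"
    if v: "v \<in> vec_on (alive J b n t)" for v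
  proof -
    have "bd C n t (\<psi> n t v) = \<zero>\<^bsub>fib (obj C m) t\<^esub> \<longleftrightarrow> mat_vec (D n) (J n) v = (\<lambda>_. 0)"
      using v lin_coordsD(2)[OF coords D_alive vec_on_0] bd_coords lin_coords_zero[OF vs coords]
      unfolding Suc by metis
    also have "\<dots> \<longleftrightarrow> (\<forall>p\<in>P n. v p = 0)"
    proof
      assume *: "mat_vec (D n) (J n) v = (\<lambda>_. 0)"
      show "\<forall>p\<in>P n. v p = 0"
        using mat_vec_D[of m _ _ v] fun_cong[OF *] by (force simp: Suc P_Suc)
    next
      assume *: "\<forall>p\<in>P n. v p = 0"
      show "mat_vec (D n) (J n) v = (\<lambda>_. 0)"
      proof
        fix i show "mat_vec (D n) (J n) v i = 0"
          using * by (auto simp: mat_vec_def Suc P_Suc intro!: sum.neutral dest: mat_on_zero[OF D_on])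
            (metis D_unique(1))
      qed
    qed
    also have "\<dots> \<longleftrightarrow> v \<in> vec_on (cyc n t)"
      using v by (auto simp: vec_on_def cyc_def)
    finally show ?thesis .
  qed
  have "cycles C n t = {x \<in> \<psi> n t ` vec_on (alive J b n t). bd C n t x = \<zero>\<^bsub>fib (obj C m) t\<^esub>}"
    by (simp add: Suc a_kernel_def' lin_coordsD(5)[OF coords])
  also have "\<dots> = \<psi> n t ` vec_on (cyc n t)"
    using zero vec_on_mono[OF _ cyc_alive] by blast
  finally show ?thesis .
qed

lemma boundaries_eq: "boundaries C n t = \<psi> n t ` vec_on (dead n t)"
proof -
  have "mat_vec (D (Suc n)) (J (Suc n)) ` vec_on (alive J b (Suc n) t) = vec_on (dead n t)"
  proof (intro subset_antisym subsetI)
    fix w assume "w \<in> mat_vec (D (Suc n)) (J (Suc n)) ` vec_on (alive J b (Suc n) t)"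
    then obtain v where v: "v \<in> vec_on (alive J b (Suc n) t)" "w = mat_vec (D (Suc n)) (J (Suc n)) v"
      by blast
    have "i \<in> dead n t" if "w i \<noteq> 0" for i
      using that unfolding v(2)
      by (rule mat_vec_nonzeroE) (use v(1) D_unique(1) in \<open>auto simp: dead_def dest: vec_onD\<close>)
    then show "w \<in> vec_on (dead n t)" by (auto simp: vec_on_def)
  next
    fix w :: "'j \<Rightarrow> 'f" assume w: "w \<in> vec_on (dead n t)"
    \<comment> \<open>A preimage is found by dividing by the pivot entry. The sum has at most one
      nonzero term and only serves to name the pivot row of column \<open>p\<close>.\<close>
    define v where "v p = (if p \<in> alive J b (Suc n) t
      then \<Sum>i\<in>J n. if D (Suc n) i p \<noteq> 0 then w i / D (Suc n) i p else 0 else 0)" for p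
    have vp: "v p = w i / D (Suc n) i p" if "D (Suc n) i p \<noteq> 0" "p \<in> alive J b (Suc n) t" for i p
    proof -
      have "v p = (\<Sum>i'\<in>J n. if i' = i then w i / D (Suc n) i p else 0)"
        unfolding v_def if_P[OF that(2)]
      proof (rule sum.cong)
        fix i'
        show "(if D (Suc n) i' p \<noteq> 0 then w i' / D (Suc n) i' p else 0)
            = (if i' = i then w i / D (Suc n) i p else 0)"
          using that(1) D_unique(3)[OF that(1), of i'] by (cases "i' = i") auto
      qed simp
      then show ?thesis using D_unique(1)[OF that(1)] fin by simp
    qed
    have "mat_vec (D (Suc n)) (J (Suc n)) v i = w i" for i
    proof (cases "\<exists>p. D (Suc n) i p \<noteq> 0")
      case True
      then obtain p where p: "D (Suc n) i p \<noteq> 0" by blast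
      \<comment> \<open>If the only pivot column of row \<open>i\<close> is not alive, then
        \<open>i\<close> is not in \<open>dead n t\<close>, so \<open>w\<close> vanishes there as
        well.\<close>
      have "w i = 0 \<and> v p = 0" if "p \<notin> alive J b (Suc n) t"
        using that w D_unique(4)[OF p] by (auto simp: v_def vec_on_def dead_def)
      then show ?thesis using vp[OF p] p by (cases "p \<in> alive J b (Suc n) t") (auto simp: mat_vec_D)
    next
      case False
      then show ?thesis using w by (auto simp: mat_vec_D_0 vec_on_def dead_def)
    qed
    moreover have "v \<in> vec_on (alive J b (Suc n) t)" by (simp add: vec_on_def v_def)
    ultimately show "w \<in> mat_vec (D (Suc n)) (J (Suc n)) ` vec_on (alive J b (Suc n) t)"
      by (intro image_eqI[where x = v]) auto
  qed
  then have "\<psi> n t ` vec_on (dead n t) =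
      (\<lambda>v. \<psi> n t (mat_vec (D (Suc n)) (J (Suc n)) v)) ` vec_on (alive J b (Suc n) t)"
    by (simp flip: image_image)
  then show ?thesis
    by (simp add: boundaries_def lin_coordsD(5)[OF coords] image_image bd_coords cong: image_cong)
qed

lemma subspace_cycles: "lin_subspace (fib (obj C n) t) (cycles C n t)"
  unfolding cycles_eq by (rule lin_coords_subspace[OF vs coords cyc_alive])

lemma subspace_boundaries: "lin_subspace (fib (obj C n) t) (boundaries C n t)"
  unfolding boundaries_eq by (rule lin_coords_subspace[OF vs coords dead_alive])

lemma \<psi>_carrier: "v \<in> vec_on (cyc n t) \<Longrightarrow> \<psi> n t v \<in> carrier (fib (obj C n) t)"
  using lin_coordsD(1)[OF coords vec_on_mono[OF _ cyc_alive]] .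

text \<open>The difference of two representatives is a boundary exactly if its coordinates are
  supported on \<open>dead n t\<close>. The coordinates outside that set thus determine a class
  faithfully.\<close>

lemma hclass_eq_iff:
  assumes v: "v \<in> vec_on (cyc n t)" and w: "w \<in> vec_on (cyc n t)"
  shows "hclass n t v = hclass n t w \<longleftrightarrow> (\<forall>j. j \<notin> dead n t \<longrightarrow> v j = w j)"
proof
  assume "hclass n t v = hclass n t w"
  then obtain h where "h \<in> boundaries C n t" "\<psi> n t v = h \<oplus>\<^bsub>fib (obj C n) t\<^esub> \<psi> n t w"
    unfolding hclass_def homology_class_def by (rule coset_eqD[OF vs subspace_boundaries \<psi>_carrier[OF v]])
  then obtain u where u: "u \<in> vec_on (dead n t)" "\<psi> n t v = \<psi> n t u \<oplus>\<^bsub>fib (obj C n) t\<^esub> \<psi> n t w"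
    unfolding boundaries_eq by blast
  note on = vec_on_mono[OF v cyc_alive] vec_on_mono[OF w cyc_alive] vec_on_mono[OF u(1) dead_alive]
  have "\<psi> n t v = \<psi> n t (\<lambda>j. u j + w j)"
    using u on by (simp add: lin_coordsD(3)[OF coords])
  then have "v = (\<lambda>j. u j + w j)"
    using on by (simp add: lin_coordsD(2)[OF coords] vec_on_add)
  with u show "\<forall>j. j \<notin> dead n t \<longrightarrow> v j = w j" by (simp add: vec_on_zero)
next
  assume *: "\<forall>j. j \<notin> dead n t \<longrightarrow> v j = w j"
  define u where "u j = v j - w j" for j
  have u: "u \<in> vec_on (dead n t)" using * by (simp add: vec_on_def u_def)
  have "\<psi> n t v = \<psi> n t (\<lambda>j. u j + w j)" by (simp add: u_def)
  also have "\<dots> = \<psi> n t u \<oplus>\<^bsub>fib (obj C n) t\<^esub> \<psi> n t w"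
    using vec_on_mono[OF w cyc_alive] vec_on_mono[OF u dead_alive] by (simp add: lin_coordsD(3)[OF coords])
  finally show "hclass n t v = hclass n t w"
    unfolding hclass_def homology_class_def using u \<psi>_carrier[OF w]
    by (simp add: coset_absorb[OF vs subspace_boundaries, unfolded boundaries_eq] boundaries_eq)
qed

lemma homology_carrier: "carrier (fib (homology C n) t) = hclass n t ` vec_on (cyc n t)"
  by (auto simp: homology_def quotient_pm_def sub_pm_def A_RCOSETS_def' a_r_coset_def' cycles_eq
      hclass_def homology_class_def)

lemma homology_zero: "\<zero>\<^bsub>fib (homology C n) t\<^esub> = hclass n t (\<lambda>_. 0)"
proof -
  interpret abelian_group "fib (obj C n) t" using vs by (rule vectorspace_add)
  have "boundaries C n t +>\<^bsub>fib (obj C n) t\<^esub> \<zero>\<^bsub>fib (obj C n) t\<^esub> = boundaries C n t"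
    using lin_subspaceD(1)[OF subspace_boundaries] by (auto simp: a_r_coset_def')
  then show ?thesis
    by (simp add: homology_def quotient_pm_def hclass_def homology_class_def lin_coords_zero[OF vs coords])
qed

lemma homology_add:
  assumes v: "v \<in> vec_on (cyc n t)" and w: "w \<in> vec_on (cyc n t)"
  shows "hclass n t v \<oplus>\<^bsub>fib (homology C n) t\<^esub> hclass n t w = hclass n t (\<lambda>j. v j + w j)"
proof -
  have "hclass n t v \<oplus>\<^bsub>fib (homology C n) t\<^esub> hclass n t w = set_add (fib (obj C n) t) (hclass n t v) (hclass n t w)"
    by (simp add: homology_def quotient_pm_def sub_pm_def set_add_def')
  then show ?thesis
    using v w \<psi>_carrier lin_coordsD(3)[OF coords vec_on_mono[OF v cyc_alive] vec_on_mono[OF w cyc_alive]]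
    by (simp add: hclass_def homology_class_def coset_add[OF vs subspace_boundaries])
qed

lemma homology_smult:
  assumes v: "v \<in> vec_on (cyc n t)"
  shows "a \<odot>\<^bsub>fib (homology C n) t\<^esub> hclass n t v = hclass n t (\<lambda>j. a * v j)"
proof -
  have "a \<odot>\<^bsub>fib (homology C n) t\<^esub> hclass n t v =
      (\<Union>u\<in>boundaries C n t +>\<^bsub>fib (obj C n) t\<^esub> \<psi> n t v.
        boundaries C n t +>\<^bsub>fib (obj C n) t\<^esub> (a \<odot>\<^bsub>fib (obj C n) t\<^esub> u))"
    by (simp add: homology_def quotient_pm_def sub_pm_def hclass_def homology_class_def a_r_coset_def')
  also have "\<dots> = boundaries C n t +>\<^bsub>fib (obj C n) t\<^esub> (a \<odot>\<^bsub>fib (obj C n) t\<^esub> \<psi> n t v)"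
  proof (rule coset_induced_map[OF vs subspace_boundaries vs subspace_boundaries])
    show "a \<odot>\<^bsub>fib (obj C n) t\<^esub> h \<in> boundaries C n t" if "h \<in> boundaries C n t" for h
      using that by (rule lin_subspaceD(4)[OF subspace_boundaries])
    show "a \<odot>\<^bsub>fib (obj C n) t\<^esub> \<psi> n t v \<in> carrier (fib (obj C n) t)"
      using \<psi>_carrier[OF v] by (rule vectorspace_smult(1)[OF vs])
    show "a \<odot>\<^bsub>fib (obj C n) t\<^esub> (h \<oplus>\<^bsub>fib (obj C n) t\<^esub> \<psi> n t v)
        = a \<odot>\<^bsub>fib (obj C n) t\<^esub> h \<oplus>\<^bsub>fib (obj C n) t\<^esub> a \<odot>\<^bsub>fib (obj C n) t\<^esub> \<psi> n t v"
      if "h \<in> boundaries C n t" for h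
      using lin_subspaceD(1)[OF subspace_boundaries that] \<psi>_carrier[OF v]
      by (rule vectorspace_smult(6)[OF vs])
  qed
  also have "\<dots> = hclass n t (\<lambda>j. a * v j)"
    using lin_coordsD(4)[OF coords vec_on_mono[OF v cyc_alive]] by (simp add: hclass_def homology_class_def)
  finally show ?thesis .
qed

lemma str_hom: "s \<le> t \<Longrightarrow> str (obj C n) s t \<in> module_hom class_ring (fib (obj C n) s) (fib (obj C n) t)"
  using complex by (simp add: chain_complex_def is_pers_module_def)

text \<open>Coordinates do not change with time and \<open>dead\<close> only grows, so boundaries go
  to boundaries. Coordinates that die between \<open>s\<close> and \<open>t\<close> remain in
  \<open>v\<close>, but no longer affect the class.\<close>

lemma homology_str:
  assumes v: "v \<in> vec_on (cyc n s)" and st: "s \<le> t"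
  shows "str (homology C n) s t (hclass n s v) = hclass n t v"
proof -
  have "str (homology C n) s t (hclass n s v) =
      (\<Union>u\<in>boundaries C n s +>\<^bsub>fib (obj C n) s\<^esub> \<psi> n s v.
        boundaries C n t +>\<^bsub>fib (obj C n) t\<^esub> (str (obj C n) s t u))"
    by (simp add: homology_def quotient_pm_def sub_pm_def hclass_def homology_class_def a_r_coset_def')
  also have "\<dots> = boundaries C n t +>\<^bsub>fib (obj C n) t\<^esub> (str (obj C n) s t (\<psi> n s v))"
  proof (rule coset_induced_map[OF vs subspace_boundaries vs subspace_boundaries])
    show "str (obj C n) s t h \<in> boundaries C n t" if h: "h \<in> boundaries C n s" for h
    proof -
      obtain u where u: "u \<in> vec_on (dead n s)" "h = \<psi> n s u" using h by (auto simp: boundaries_eq)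
      then have "str (obj C n) s t h = \<psi> n t u"
        using str_coords[OF st vec_on_mono[OF u(1) dead_alive]] by simp
      with vec_on_mono[OF u(1) dead_mono[OF st]] show ?thesis by (simp add: boundaries_eq)
    qed
    show "str (obj C n) s t (h \<oplus>\<^bsub>fib (obj C n) s\<^esub> \<psi> n s v)
        = str (obj C n) s t h \<oplus>\<^bsub>fib (obj C n) t\<^esub> str (obj C n) s t (\<psi> n s v)"
      if "h \<in> boundaries C n s" for h
      using str_hom[OF st] lin_subspaceD(1)[OF subspace_boundaries that] \<psi>_carrier[OF v]
      by (rule LinearCombinations.module_hom_add)
    show "str (obj C n) s t (\<psi> n s v) \<in> carrier (fib (obj C n) t)"
      using LinearCombinations.module_hom_closed[OF str_hom[OF st]] \<psi>_carrier[OF v] by blast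
  qed
  also have "\<dots> = hclass n t v"
    using str_coords[OF st vec_on_mono[OF v cyc_alive]] by (simp add: hclass_def homology_class_def)
  finally show ?thesis .
qed

end

section \<open>Interval decomposition of homology\<close>

context reduced_complex
begin

lemma homology_vs: "vectorspace class_ring (fib (homology C n) t)"
proof (rule vectorspace_image[OF vs subspace_cycles, where q = "homology_class C n t"])
  show "carrier (fib (homology C n) t) = homology_class C n t ` cycles C n t"
    unfolding homology_carrier cycles_eq image_image hclass_def ..
  show "\<zero>\<^bsub>fib (homology C n) t\<^esub> = homology_class C n t \<zero>\<^bsub>fib (obj C n) t\<^esub>"
    by (simp add: homology_zero hclass_def lin_coords_zero[OF vs coords])
  show "homology_class C n t x \<oplus>\<^bsub>fib (homology C n) t\<^esub> homology_class C n t y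
      = homology_class C n t (x \<oplus>\<^bsub>fib (obj C n) t\<^esub> y)"
    if xy: "x \<in> cycles C n t" "y \<in> cycles C n t" for x y
  proof -
    obtain v w where "v \<in> vec_on (cyc n t)" "w \<in> vec_on (cyc n t)" "x = \<psi> n t v" "y = \<psi> n t w"
      using xy by (auto simp: cycles_eq)
    then show ?thesis
      using homology_add[of v n t w]
      by (simp add: hclass_def lin_coordsD(3)[OF coords] vec_on_mono[OF _ cyc_alive])
  qed
  show "a \<odot>\<^bsub>fib (homology C n) t\<^esub> homology_class C n t x
      = homology_class C n t (a \<odot>\<^bsub>fib (obj C n) t\<^esub> x)"
    if x: "x \<in> cycles C n t" for a x
  proof -
    obtain v where "v \<in> vec_on (cyc n t)" "x = \<psi> n t v"
      using x by (auto simp: cycles_eq)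
    then show ?thesis
      using homology_smult[of v n t a]
      by (simp add: hclass_def lin_coordsD(4)[OF coords] vec_on_mono[OF _ cyc_alive])
  qed
qed

lemma homology_pers_module: "is_pers_module (homology C n)"
proof -
  have "str (homology C n) s t \<in> module_hom class_ring (fib (homology C n) s) (fib (homology C n) t)"
    if st: "s \<le> t" for s t
  proof -
    have "v \<in> vec_on (cyc n t)" if "v \<in> vec_on (cyc n s)" for v :: "'j \<Rightarrow> 'f"
      using that cyc_mono[OF st] by (rule vec_on_mono)
    then show ?thesis
      by (auto simp only: LinearCombinations.module_hom_def homology_carrier homology_str[OF _ st]
        homology_add homology_smult vec_on_add vec_on_scale Pi_iff mem_Collect_eq image_iff bex_simps ball_simps class_ring_simps UNIV_I)
  qed
  moreover have "str (homology C n) s t (str (homology C n) r s x) = str (homology C n) r t x"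
    if "r \<le> s" "s \<le> t" "x \<in> carrier (fib (homology C n) r)" for r s t x
  proof -
    obtain v where v: "v \<in> vec_on (cyc n r)" "x = hclass n r v"
      using \<open>x \<in> _\<close> by (auto simp: homology_carrier)
    with vec_on_mono[OF v(1) cyc_mono[OF \<open>r \<le> s\<close>]] that show ?thesis
      by (simp add: homology_str)
  qed
  moreover have "str (homology C n) t t x = x" if "x \<in> carrier (fib (homology C n) t)" for t x
    using that by (auto simp: homology_carrier homology_str)
  ultimately show ?thesis
    using homology_vs by (simp add: is_pers_module_def)
qed

text \<open>Gathers a sum of multiples of generators, the form in which
  \<open>ph_decomposition\<close> is defined, into one coordinate vector.\<close>

lemma homology_finsum:
  assumes "finite F" "F \<subseteq> cyc n t" "\<And>j. j \<in> F \<Longrightarrow> g j = hclass n t (single_vec j (v j))"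
  shows "(\<Oplus>\<^bsub>fib (homology C n) t\<^esub> j\<in>F. g j) = hclass n t (\<lambda>j. if j \<in> F then v j else 0)"
proof -
  interpret H: abelian_group "fib (homology C n) t" using homology_vs by (rule vectorspace_add)
  show ?thesis
    using assms
  proof (induction F rule: finite_induct)
    case empty
    then show ?case by (simp add: homology_zero)
  next
    case (insert i F)
    have on: "single_vec i (v i) \<in> vec_on (cyc n t)" "(\<lambda>j. if j \<in> F then v j else 0) \<in> vec_on (cyc n t)"
      using insert.prems(1) by (simp_all add: single_vec_on) (auto simp: vec_on_def)
    have carrier: "g j \<in> carrier (fib (homology C n) t)" if "j \<in> insert i F" for j
      using that insert.prems by (auto simp: homology_carrier single_vec_on)
    have "(\<Oplus>\<^bsub>fib (homology C n) t\<^esub> j\<in>insert i F. g j)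
        = g i \<oplus>\<^bsub>fib (homology C n) t\<^esub> (\<Oplus>\<^bsub>fib (homology C n) t\<^esub> j\<in>F. g j)"
      using insert.hyps carrier by (intro H.finsum_insert) auto
    also have "(\<Oplus>\<^bsub>fib (homology C n) t\<^esub> j\<in>F. g j) = hclass n t (\<lambda>j. if j \<in> F then v j else 0)"
      using insert.prems by (intro insert.IH) auto
    also have "g i \<oplus>\<^bsub>fib (homology C n) t\<^esub> hclass n t (\<lambda>j. if j \<in> F then v j else 0)
        = hclass n t (\<lambda>j. single_vec i (v i) j + (if j \<in> F then v j else 0))"
      using on insert.prems(2)[of i] by (simp add: homology_add)
    also have "(\<lambda>j. single_vec i (v i) j + (if j \<in> F then v j else 0))
        = (\<lambda>j. if j \<in> insert i F then v j else 0)"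
      using insert.hyps by (auto simp: single_vec_def)
    finally show ?case .
  qed
qed

text \<open>The form that \<open>ph_decomposition\<close> takes in coordinates. The cut-off at
  \<open>bars n t\<close> turns vectors of \<open>interval_sum\<close>, which are
  \<open>undefined\<close> off the index set, into vectors that are 0 there.\<close>

definition bar_decomposition :: "nat \<Rightarrow> ('j, 'r, 'f, 'v set) decomposition \<Rightarrow> bool" where
  "bar_decomposition n \<D> \<longleftrightarrow> idx \<D> = J n - P n \<and> birth \<D> = b n \<and> death \<D> = ph_death J b D n \<and>
     (\<forall>t v. iso \<D> t v = hclass n t (\<lambda>j. if j \<in> bars n t then v j else 0))"

lemma bars_on: "(\<lambda>j. if j \<in> bars n t then v j else 0) \<in> vec_on (cyc n t)"
  by (simp add: vec_on_def bars_eq)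

context
  fixes n \<D> assumes \<D>: "bar_decomposition n \<D>"
begin

lemma
  shows idx: "idx \<D> = J n - P n"
    and birth: "birth \<D> = b n"
    and death: "death \<D> = ph_death J b D n"
    and iso: "iso \<D> t v = hclass n t (\<lambda>j. if j \<in> bars n t then v j else 0)"
  using \<D> by (simp_all add: bar_decomposition_def)

lemma bar_iff: "j \<in> idx \<D> \<Longrightarrow> t \<in> bar (birth \<D> j) (death \<D> j) \<longleftrightarrow> j \<in> bars n t"
  by (simp add: idx birth death bars_def)

lemma bars_idx: "bars n t \<subseteq> idx \<D>"
  by (auto simp: idx bars_def)

lemma bars_sum_carrier:
  "carrier (fib (interval_sum \<D>) t) = (\<Pi>\<^sub>E j\<in>idx \<D>. if j \<in> bars n t then UNIV else {0})"
  by (simp add: interval_sum_carrier bar_iff cong: PiE_cong)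

lemma bars_sum_str:
  "str (interval_sum \<D>) s t w = (\<lambda>j\<in>idx \<D>. if j \<in> bars n s \<and> j \<in> bars n t then w j else 0)"
  by (simp add: interval_sum_str bar_iff cong: restrict_cong)

text \<open>By \<open>hclass_eq_iff\<close> the class of a cycle is determined by its coordinates in
  \<open>bars n t\<close>, and its other coordinates can be replaced by 0 without changing the
  class.\<close>

lemma iso_bij: "bij_betw (iso \<D> t) (carrier (fib (interval_sum \<D>) t)) (carrier (fib (homology C n) t))"
proof (rule bij_betw_imageI)
  show "inj_on (iso \<D> t) (carrier (fib (interval_sum \<D>) t))"
  proof (rule inj_onI)
    fix v w assume v: "v \<in> carrier (fib (interval_sum \<D>) t)" and w: "w \<in> carrier (fib (interval_sum \<D>) t)"
      and eq: "iso \<D> t v = iso \<D> t w"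
    have bars: "v j = w j" if "j \<in> bars n t" for j
    proof -
      have "\<forall>j. j \<notin> dead n t \<longrightarrow> (if j \<in> bars n t then v j else 0) = (if j \<in> bars n t then w j else 0)"
        using eq unfolding iso by (simp only: hclass_eq_iff[OF bars_on bars_on])
      with that show ?thesis by (auto simp: bars_eq)
    qed
    show "v = w"
    proof
      fix j show "v j = w j"
      proof (cases "j \<in> idx \<D>")
        case True
        then show ?thesis
          using PiE_mem[OF v[unfolded bars_sum_carrier] True]
            PiE_mem[OF w[unfolded bars_sum_carrier] True] bars[of j] by (auto split: if_splits)
      next
        case False
        then show ?thesis
          using PiE_arb[OF v[unfolded bars_sum_carrier] False]
            PiE_arb[OF w[unfolded bars_sum_carrier] False] by simp
      qed
    qed
  qed
  show "iso \<D> t ` carrier (fib (interval_sum \<D>) t) = carrier (fib (homology C n) t)"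
  proof (intro subset_antisym subsetI)
    fix x assume "x \<in> carrier (fib (homology C n) t)"
    then obtain u where u: "u \<in> vec_on (cyc n t)" "x = hclass n t u" by (auto simp: homology_carrier)
    let ?v = "\<lambda>j\<in>idx \<D>. if j \<in> bars n t then u j else 0"
    have "(\<lambda>j. if j \<in> bars n t then ?v j else 0) = (\<lambda>j. if j \<in> bars n t then u j else 0)"
      using bars_idx by fastforce
    then have "iso \<D> t ?v = hclass n t (\<lambda>j. if j \<in> bars n t then u j else 0)"
      by (simp only: iso)
    also have "\<dots> = x"
      unfolding u(2) hclass_eq_iff[OF bars_on u(1)] using u(1) by (auto simp: bars_eq vec_on_zero)
    finally have "iso \<D> t ?v = x" .
    moreover have "?v \<in> carrier (fib (interval_sum \<D>) t)" by (auto simp: bars_sum_carrier)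
    ultimately show "x \<in> iso \<D> t ` carrier (fib (interval_sum \<D>) t)" by blast
  qed (auto simp: iso homology_carrier bars_on)
qed

lemma interval_decomposition: "interval_decomposition (homology C n) \<D>"
  unfolding interval_decomposition_def pers_iso_def pers_morphism_def
proof (intro conjI allI ballI impI)
  show "finite (idx \<D>)" using fin by (simp add: idx)
  show "birth \<D> j \<le> death \<D> j" for j by (simp add: birth death birth_le_death)
  show "iso \<D> t \<in> module_hom class_ring (fib (interval_sum \<D>) t) (fib (homology C n) t)" for t
  proof -
    have "iso \<D> t (\<lambda>j\<in>idx \<D>. v j + w j) = iso \<D> t v \<oplus>\<^bsub>fib (homology C n) t\<^esub> iso \<D> t w" for v w
    proof -
      have "(\<lambda>j. if j \<in> bars n t then (\<lambda>j\<in>idx \<D>. v j + w j) j else 0)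
          = (\<lambda>j. (if j \<in> bars n t then v j else 0) + (if j \<in> bars n t then w j else 0))"
        using bars_idx by fastforce
      then show ?thesis by (simp only: iso homology_add[OF bars_on bars_on])
    qed
    moreover have "iso \<D> t (\<lambda>j\<in>idx \<D>. a * v j) = a \<odot>\<^bsub>fib (homology C n) t\<^esub> iso \<D> t v" for a v
    proof -
      have "(\<lambda>j. if j \<in> bars n t then (\<lambda>j\<in>idx \<D>. a * v j) j else 0)
          = (\<lambda>j. a * (if j \<in> bars n t then v j else 0))"
        using bars_idx by fastforce
      then show ?thesis by (simp only: iso homology_smult[OF bars_on])
    qed
    ultimately show ?thesis
      using bij_betwE[OF iso_bij]
      by (simp add: LinearCombinations.module_hom_def interval_sum_add interval_sum_smult)
  qed
  show "iso \<D> t (str (interval_sum \<D>) s t x) = str (homology C n) s t (iso \<D> s x)"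
    if st: "s \<le> t" and "x \<in> carrier (fib (interval_sum \<D>) s)" for s t x
  proof -
    have "str (homology C n) s t (iso \<D> s x) = hclass n t (\<lambda>j. if j \<in> bars n s then x j else 0)"
      unfolding iso by (rule homology_str[OF bars_on st])
    \<comment> \<open>An index in \<open>bars n s\<close> is at time \<open>t\<close> either still
      in \<open>bars n t\<close> or in \<open>dead n t\<close>. In the second case the two vectors
      may differ there, which \<open>hclass_eq_iff\<close> ignores.\<close>
    moreover have "iso \<D> t (str (interval_sum \<D>) s t x) = hclass n t (\<lambda>j. if j \<in> bars n s then x j else 0)"
      unfolding iso bars_sum_str
        hclass_eq_iff[OF bars_on vec_on_mono[OF bars_on cyc_mono[OF st]]]
      using bars_idx cyc_mono[OF st, of n] by (auto simp: bars_eq idx)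

    ultimately show ?thesis by simp
  qed
qed (simp_all add: homology_pers_module iso_bij)

lemma summand_incl_eq:
  assumes "j \<in> bars n t"
  shows "summand_incl \<D> j t x = hclass n t (single_vec j x)"
proof -
  have "(\<lambda>i. if i \<in> bars n t then (\<lambda>k\<in>idx \<D>. if k = j then x else 0) i else 0) = single_vec j x"
    using assms bars_idx by (auto simp: single_vec_def fun_eq_iff)
  then show ?thesis by (simp only: summand_incl_def iso)
qed

text \<open>\<open>inv_into\<close> returns a vector with the same class as \<open>u\<close>, hence
  with the same coordinates outside \<open>dead n t\<close>.\<close>

lemma summand_proj_eq:
  assumes u: "u \<in> vec_on (cyc n t)" and i: "i \<in> bars n t"
  shows "summand_proj \<D> i t (hclass n t u) = u i"
proof -
  have "hclass n t u \<in> carrier (fib (homology C n) t)" using u by (auto simp: homology_carrier)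
  then have "iso \<D> t (inv_into (carrier (fib (interval_sum \<D>) t)) (iso \<D> t) (hclass n t u)) = hclass n t u"
    using bij_betw_imp_surj_on[OF iso_bij] by (simp add: f_inv_into_f)
  then have "\<forall>j. j \<notin> dead n t \<longrightarrow>
      (if j \<in> bars n t then inv_into (carrier (fib (interval_sum \<D>) t)) (iso \<D> t) (hclass n t u) j else 0) = u j"
    unfolding iso[of t] hclass_eq_iff[OF bars_on u] .
  with i show ?thesis by (auto simp: summand_proj_def bars_eq)
qed

end

end

section \<open>Chain maps and the induced map on homology\<close>

locale reduced_complex_map =
  A: reduced_complex C J b \<psi> D P + B: reduced_complex C' J' b' \<psi>' D' P'
  for C :: "('r::linorder, 'f::field, 'v) complex_pm" and J :: "nat \<Rightarrow> 'j set" and b \<psi> D P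
    and C' :: "('r, 'f, 'w) complex_pm" and J' :: "nat \<Rightarrow> 'k set" and b' \<psi>' D' P' +
  fixes f :: "nat \<Rightarrow> 'r \<Rightarrow> 'v \<Rightarrow> 'w" and Y :: "nat \<Rightarrow> 'k \<Rightarrow> 'j \<Rightarrow> 'f"
  assumes chain_map: "chain_map C C' f"
    and Y_on: "Y n \<in> mat_on (J' n) (J n)"
    and Y_birth: "Y n i j \<noteq> 0 \<Longrightarrow> b' n i \<le> b n j"
    and f_coords: "v \<in> vec_on (alive J b n t) \<Longrightarrow> f n t (\<psi> n t v) = \<psi>' n t (mat_vec (Y n) (J n) v)"
begin

lemma f_hom: "f n t \<in> module_hom class_ring (fib (obj C n) t) (fib (obj C' n) t)"
  using chain_map by (simp add: chain_map_def pers_morphism_def)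

lemma f_bd: "x \<in> carrier (fib (obj C (Suc n)) t) \<Longrightarrow> f n t (bd C (Suc n) t x) = bd C' (Suc n) t (f (Suc n) t x)"
  using chain_map by (simp add: chain_map_def)

lemma Y_alive: "v \<in> vec_on (alive J b n t) \<Longrightarrow> mat_vec (Y n) (J n) v \<in> vec_on (alive J' b' n t)"
  using Y_on Y_birth by (rule mat_vec_alive)

lemma f_zero: "f n t \<zero>\<^bsub>fib (obj C n) t\<^esub> = \<zero>\<^bsub>fib (obj C' n) t\<^esub>"
  using f_coords[OF vec_on_0] lin_coords_zero[OF A.vs A.coords] lin_coords_zero[OF B.vs B.coords]
  by (simp add: mat_vec_def)

lemma f_cycles: "x \<in> cycles C n t \<Longrightarrow> f n t x \<in> cycles C' n t"
  using LinearCombinations.module_hom_closed[OF f_hom] f_bd f_zero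
  by (cases n) (auto simp: a_kernel_def' simp flip: f_bd)

lemma f_boundaries: "x \<in> boundaries C n t \<Longrightarrow> f n t x \<in> boundaries C' n t"
  using LinearCombinations.module_hom_closed[OF f_hom] f_bd by (fastforce simp: boundaries_def)

text \<open>The chain map sends cycles to cycles, and coordinates are unique, so the image vector
  must have the support of a cycle.\<close>

lemma Y_cyc:
  assumes v: "v \<in> vec_on (A.cyc n t)"
  shows "mat_vec (Y n) (J n) v \<in> vec_on (B.cyc n t)"
proof -
  have v': "v \<in> vec_on (alive J b n t)" using v A.cyc_alive by (rule vec_on_mono)
  have "f n t (\<psi> n t v) \<in> cycles C' n t"
    using v by (intro f_cycles) (simp add: A.cycles_eq)
  then obtain u where u: "u \<in> vec_on (B.cyc n t)" "\<psi>' n t (mat_vec (Y n) (J n) v) = \<psi>' n t u"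
    using f_coords[OF v'] by (auto simp: B.cycles_eq)
  then show ?thesis
    using lin_coordsD(2)[OF B.coords Y_alive[OF v'] vec_on_mono[OF u(1) B.cyc_alive]] by simp
qed

lemma homology_map_hclass:
  assumes v: "v \<in> vec_on (A.cyc n t)"
  shows "homology_map C' f n t (A.hclass n t v) = B.hclass n t (mat_vec (Y n) (J n) v)"
proof -
  have "homology_map C' f n t (A.hclass n t v) =
      (\<Union>u\<in>boundaries C n t +>\<^bsub>fib (obj C n) t\<^esub> \<psi> n t v. boundaries C' n t +>\<^bsub>fib (obj C' n) t\<^esub> (f n t u))"
    by (simp add: homology_map_def A.hclass_def homology_class_def)
  also have "\<dots> = boundaries C' n t +>\<^bsub>fib (obj C' n) t\<^esub> (f n t (\<psi> n t v))"
  proof (rule coset_induced_map[OF A.vs A.subspace_boundaries B.vs B.subspace_boundaries])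
    show "f n t h \<in> boundaries C' n t" if "h \<in> boundaries C n t" for h
      using that by (rule f_boundaries)
    show "f n t (\<psi> n t v) \<in> carrier (fib (obj C' n) t)"
      using LinearCombinations.module_hom_closed[OF f_hom] A.\<psi>_carrier[OF v] by blast
    show "f n t (h \<oplus>\<^bsub>fib (obj C n) t\<^esub> \<psi> n t v) = f n t h \<oplus>\<^bsub>fib (obj C' n) t\<^esub> f n t (\<psi> n t v)"
      if "h \<in> boundaries C n t" for h
      using f_hom lin_subspaceD(1)[OF A.subspace_boundaries that] A.\<psi>_carrier[OF v]
      by (rule LinearCombinations.module_hom_add)
  qed
  also have "\<dots> = B.hclass n t (mat_vec (Y n) (J n) v)"
    using f_coords[OF vec_on_mono[OF v A.cyc_alive]] by (simp add: B.hclass_def homology_class_def)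
  finally show ?thesis .
qed

lemma homology_map_morphism: "pers_morphism (homology C n) (homology C' n) (homology_map C' f n)"
  unfolding pers_morphism_def
proof (intro conjI allI impI ballI)
  show "homology_map C' f n t \<in> module_hom class_ring (fib (homology C n) t) (fib (homology C' n) t)" for t
    by (auto simp: LinearCombinations.module_hom_def A.homology_carrier B.homology_carrier
        homology_map_hclass A.homology_add B.homology_add A.homology_smult B.homology_smult
        vec_on_add vec_on_scale Y_cyc mat_vec_add mat_vec_scale)
  show "homology_map C' f n t (str (homology C n) s t x) = str (homology C' n) s t (homology_map C' f n s x)"
    if st: "s \<le> t" and x: "x \<in> carrier (fib (homology C n) s)" for s t x
  proof -
    obtain v where v: "v \<in> vec_on (A.cyc n s)" "x = A.hclass n s v"
      using x by (auto simp: A.homology_carrier)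
    then show ?thesis
      using vec_on_mono[OF v(1) A.cyc_mono[OF st]]
      by (simp add: A.homology_str[OF _ st] B.homology_str[OF _ st] homology_map_hclass Y_cyc)
  qed
qed

text \<open>Column \<open>p\<close> of \<open>D\<close> has its only nonzero entry in row
  \<open>j\<close>, so evaluating the commuting square on the basis chain \<open>p\<close> isolates
  \<open>Y n i j\<close>. If this is nonzero, row \<open>i\<close> of \<open>D'\<close> has a pivot
  column \<open>k\<close> with \<open>Y (Suc n) k p \<noteq> 0\<close>, and the births of
  \<open>k\<close> and \<open>p\<close> are the two deaths. If row \<open>j\<close> has no pivot,
  its death is \<open>cut_infinity\<close> and the bound is trivial.\<close>

lemma Y_death:
  assumes "Y n i j \<noteq> 0"
  shows "ph_death J' b' D' n i \<le> ph_death J b D n j"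
proof (cases "\<exists>p. D (Suc n) j p \<noteq> 0")
  case True
  then obtain p where p: "D (Suc n) j p \<noteq> 0" by blast
  note pJ = A.D_unique(1,2)[OF p]
  obtain t where t: "t \<in> upper (b (Suc n) p)" using upper_nonempty[OF A.birth_finite[OF pJ(2)]] by blast
  define e where "e = single_vec p (1::'f)"
  have e: "e \<in> vec_on (alive J b (Suc n) t)" using pJ t by (simp add: e_def single_vec_on alive_def)
  have De: "mat_vec (D (Suc n)) (J (Suc n)) e = single_vec j (D (Suc n) j p)"
    unfolding e_def mat_vec_single[OF A.fin pJ(2)] using A.D_unique(3)[OF p]
    by (fastforce simp: single_vec_def fun_eq_iff)
  have Ye: "mat_vec (Y (Suc n)) (J (Suc n)) e = (\<lambda>k. Y (Suc n) k p)"
    using pJ A.fin by (simp add: e_def mat_vec_single)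
  have "f n t (bd C (Suc n) t (\<psi> (Suc n) t e)) = bd C' (Suc n) t (f (Suc n) t (\<psi> (Suc n) t e))"
    using lin_coordsD(1)[OF A.coords e] by (rule f_bd)
  then have "mat_vec (Y n) (J n) (mat_vec (D (Suc n)) (J (Suc n)) e)
      = mat_vec (D' (Suc n)) (J' (Suc n)) (mat_vec (Y (Suc n)) (J (Suc n)) e)"
    using lin_coordsD(2)[OF B.coords Y_alive[OF A.D_alive[OF e]] B.D_alive[OF Y_alive[OF e]]]
    by (simp add: A.bd_coords[OF e] f_coords[OF e] f_coords[OF A.D_alive[OF e]] B.bd_coords[OF Y_alive[OF e]])
  from fun_cong[OF this, of i]
  have "Y n i j * D (Suc n) j p = mat_vec (D' (Suc n)) (J' (Suc n)) (\<lambda>k. Y (Suc n) k p) i"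
    unfolding De Ye using pJ A.fin by (simp add: mat_vec_single)
  with assms p have "mat_vec (D' (Suc n)) (J' (Suc n)) (\<lambda>k. Y (Suc n) k p) i \<noteq> 0" by auto
  then obtain k where k: "D' (Suc n) i k \<noteq> 0" "Y (Suc n) k p \<noteq> 0" by (elim mat_vec_nonzeroE)
  then show ?thesis using Y_birth[OF k(2)] by (simp add: A.ph_death_pivot[OF p] B.ph_death_pivot[OF k(1)])
qed (simp add: A.ph_death_no_pivot)

text \<open>The vanishing conditions are the contrapositives of \<open>Y_birth\<close> and
  \<open>Y_death\<close>. At a common time of two bars, the image of the generator of
  \<open>j\<close> has column \<open>j\<close> of \<open>Y n\<close> as coordinates, and the
  projection to the bar of \<open>i\<close> reads off its entry.\<close>

theorem homology_map_represents:
  assumes \<D>: "A.bar_decomposition n \<D>" and \<D>': "B.bar_decomposition n \<D>'"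
  shows "represents (homology C n) \<D> (homology C' n) \<D>' (homology_map C' f n)
    (mat_restrict (J' n - P' n) (J n - P n) (Y n))"
  unfolding represents_def
proof (intro conjI ballI allI)
  show "mat_restrict (J' n - P' n) (J n - P n) (Y n) \<in> mat_on (idx \<D>') (idx \<D>)"
    by (auto simp: mat_on_def mat_restrict_def A.idx[OF \<D>] B.idx[OF \<D>'])
  fix i j assume i: "i \<in> idx \<D>'" and j: "j \<in> idx \<D>"
  have Yij: "mat_restrict (J' n - P' n) (J n - P n) (Y n) i j = Y n i j"
    using i j by (simp add: mat_restrict_def A.idx[OF \<D>] B.idx[OF \<D>'])
  show "birth \<D> j < birth \<D>' i \<or> death \<D> j < death \<D>' i \<longrightarrow>
      mat_restrict (J' n - P' n) (J n - P n) (Y n) i j = 0"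
    unfolding Yij A.birth[OF \<D>] B.birth[OF \<D>'] A.death[OF \<D>] B.death[OF \<D>']
    using Y_birth[of n i j] Y_death[of n i j] by (meson leD)
  fix t and x :: 'f
  assume "t \<in> bar (birth \<D>' i) (death \<D>' i) \<inter> bar (birth \<D> j) (death \<D> j)"
  then have bars: "i \<in> B.bars n t" "j \<in> A.bars n t"
    using i j A.bar_iff[OF \<D>] B.bar_iff[OF \<D>'] by auto
  then have u: "single_vec j x \<in> vec_on (A.cyc n t)" "j \<in> J n"
    by (auto simp: A.bars_eq single_vec_on, simp add: A.cyc_def alive_def)
  show "summand_proj \<D>' i t (homology_map C' f n t (summand_incl \<D> j t x))
      = mat_restrict (J' n - P' n) (J n - P n) (Y n) i j * x"
    unfolding Yij A.summand_incl_eq[OF \<D> bars(2)] homology_map_hclass[OF u(1)]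
    using B.summand_proj_eq[OF \<D>' Y_cyc[OF u(1)] bars(1)] by (simp add: mat_vec_single[OF A.fin u(2)])
qed (simp_all add: A.interval_decomposition[OF \<D>] B.interval_decomposition[OF \<D>'] homology_map_morphism)

end

section \<open>Sums of rays\<close>

lemma bar_infinity [simp]: "bar c cut_infinity = upper c"
  by (simp add: bar_def)

text \<open>Vectors that are 0 off the index set correspond to extensional functions, by
  \<open>restrict\<close> in one direction and by a cut-off in the other; inside \<open>J\<close>
  both kinds are 0 at indices not yet born.\<close>

lemma ray_coords:
  fixes \<gamma> :: "'r::linorder \<Rightarrow> ('j \<Rightarrow> 'f::field) \<Rightarrow> 'v"
  assumes dec: "interval_decomposition A (ray_decomposition J b \<gamma>)"
  shows "lin_coords {j \<in> J. t \<in> upper (b j)} (fib A t) (\<lambda>v. \<gamma> t (restrict v J))"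
proof -
  let ?\<D> = "ray_decomposition J b \<gamma>" and ?K = "{j \<in> J. t \<in> upper (b j)}"
  let ?I = "fib (interval_sum ?\<D>) t"
  have carrier: "carrier ?I = (\<Pi>\<^sub>E j\<in>J. if t \<in> upper (b j) then UNIV else {0})"
    by (simp add: interval_sum_carrier ray_decomposition_def)
  have restr: "restrict v J \<in> carrier ?I" if "v \<in> vec_on ?K" for v
    using that by (auto simp: carrier vec_on_def)
  have bij: "bij_betw (\<lambda>v. restrict v J) (vec_on ?K) (carrier ?I)"
  proof (rule bij_betw_byWitness[where f' = "\<lambda>w j. if j \<in> ?K then w j else 0"])
    show "\<forall>w\<in>carrier ?I. restrict (\<lambda>j. if j \<in> ?K then w j else 0) J = w"
    proof
      fix w assume w: "w \<in> carrier ?I"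
      show "restrict (\<lambda>j. if j \<in> ?K then w j else 0) J = w"
      proof
        fix j show "restrict (\<lambda>j. if j \<in> ?K then w j else 0) J j = w j"
          using PiE_mem[OF w[unfolded carrier], of j] PiE_arb[OF w[unfolded carrier], of j]
          by (auto split: if_splits)
      qed
    qed
  qed (auto simp: vec_on_def carrier fun_eq_iff)
  have \<gamma>: "bij_betw (\<gamma> t) (carrier ?I) (carrier (fib A t))"
    "\<gamma> t \<in> module_hom class_ring ?I (fib A t)"
    using dec by (simp_all add: interval_decomposition_def pers_iso_def pers_morphism_def ray_decomposition_def)
  have "bij_betw (\<gamma> t \<circ> (\<lambda>v. restrict v J)) (vec_on ?K) (carrier (fib A t))"
    using bij \<gamma>(1) by (rule bij_betw_trans)
  moreover have "\<gamma> t (restrict (\<lambda>j. v j + w j) J) = \<gamma> t (restrict v J) \<oplus>\<^bsub>fib A t\<^esub> \<gamma> t (restrict w J)"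
    if "v \<in> vec_on ?K" "w \<in> vec_on ?K" for v w
  proof -
    have "restrict (\<lambda>j. v j + w j) J = restrict v J \<oplus>\<^bsub>?I\<^esub> restrict w J"
      by (auto simp: interval_sum_add ray_decomposition_def)
    then show ?thesis
      using LinearCombinations.module_hom_add[OF \<gamma>(2) restr restr] that by simp
  qed
  moreover have "\<gamma> t (restrict (\<lambda>j. a * v j) J) = a \<odot>\<^bsub>fib A t\<^esub> \<gamma> t (restrict v J)"
    if "v \<in> vec_on ?K" for a v
  proof -
    have "restrict (\<lambda>j. a * v j) J = a \<odot>\<^bsub>?I\<^esub> restrict v J"
      by (auto simp: interval_sum_smult ray_decomposition_def)
    then show ?thesis
      using LinearCombinations.module_hom_smult[OF \<gamma>(2) _ restr] that by simp
  qed
  ultimately show ?thesis by (simp add: lin_coords_def comp_def)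
qed

lemma ray_str:
  assumes dec: "interval_decomposition A (ray_decomposition J b \<gamma>)"
    and st: "s \<le> t" and v: "v \<in> vec_on {j \<in> J. s \<in> upper (b j)}"
  shows "str A s t (\<gamma> s (restrict v J)) = \<gamma> t (restrict v J)"
proof -
  let ?\<D> = "ray_decomposition J b \<gamma>"
  have "restrict v J \<in> carrier (fib (interval_sum ?\<D>) s)"
    using v by (auto simp: interval_sum_carrier ray_decomposition_def vec_on_def)
  then have "\<gamma> t (str (interval_sum ?\<D>) s t (restrict v J)) = str A s t (\<gamma> s (restrict v J))"
    using dec st by (simp add: interval_decomposition_def pers_iso_def pers_morphism_def ray_decomposition_def)
  moreover have "str (interval_sum ?\<D>) s t (restrict v J) = restrict v J"
    using v upper_upclosed[OF _ st]
    by (auto simp: interval_sum_str ray_decomposition_def vec_on_def intro!: restrict_ext)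
  ultimately show ?thesis by simp
qed

lemma
  assumes rep: "represents A (ray_decomposition J b \<gamma>) B (ray_decomposition J' b' \<gamma>') \<phi> X"
  shows ray_represents_on: "X \<in> mat_on J' J"
    and ray_represents_birth: "X i j \<noteq> 0 \<Longrightarrow> b' i \<le> b j"
proof -
  show on: "X \<in> mat_on J' J"
    using rep by (simp add: represents_def ray_decomposition_def)
  show "b' i \<le> b j" if "X i j \<noteq> 0"
    using that mat_onD[OF on that] rep by (auto simp: represents_def ray_decomposition_def not_less[symmetric])
qed

text \<open>\<open>represents\<close> only describes one summand mapped to one summand at times
  common to both. Entries in rows not yet born at \<open>t\<close> vanish by the birth condition,
  which settles vectors with a single coordinate; linearity extends this to finite supports.\<close>

lemma ray_represents_coords:
  fixes X :: "'i \<Rightarrow> 'j \<Rightarrow> 'f::field"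
  assumes rep: "represents A (ray_decomposition J b \<gamma>) B (ray_decomposition J' b' \<gamma>') \<phi> X"
    and v: "v \<in> vec_on {j \<in> J. t \<in> upper (b j)}"
  shows "\<phi> t (\<gamma> t (restrict v J)) = \<gamma>' t (restrict (mat_vec X J v) J')"
proof -
  let ?K = "{j \<in> J. t \<in> upper (b j)}" and ?K' = "{i \<in> J'. t \<in> upper (b' i)}"
  define \<psi> where "\<psi> v = \<gamma> t (restrict v J)" for v
  define \<psi>' where "\<psi>' v = \<gamma>' t (restrict v J')" for v
  have dec: "interval_decomposition A (ray_decomposition J b \<gamma>)"
    "interval_decomposition B (ray_decomposition J' b' \<gamma>')"
    using rep by (simp_all add: represents_def)
  have fin: "finite J" using dec(1) by (simp add: interval_decomposition_def ray_decomposition_def)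
  have co: "lin_coords ?K (fib A t) \<psi>" "lin_coords ?K' (fib B t) \<psi>'"
    using ray_coords[OF dec(1)] ray_coords[OF dec(2)] by (simp_all add: \<psi>_def[abs_def] \<psi>'_def[abs_def])
  have vsA: "vectorspace class_ring (fib A t)" and vsB: "vectorspace class_ring (fib B t)"
    using dec by (simp_all add: interval_decomposition_def is_pers_module_def)
  have \<phi>: "\<phi> t \<in> module_hom class_ring (fib A t) (fib B t)"
    using rep by (simp add: represents_def pers_morphism_def)
  have X: "X i j = 0" if "i \<notin> ?K'" "j \<in> ?K" for i j
    using that upper_antimono[OF ray_represents_birth[OF rep, of i j]] mat_onD[OF ray_represents_on[OF rep], of i j]
    by auto
  have Xon: "mat_vec X J w \<in> vec_on ?K'" if "w \<in> vec_on ?K" for w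
    unfolding vec_on_def
  proof (intro CollectI allI impI, rule ccontr)
    fix i assume i: "i \<notin> ?K'" "mat_vec X J w i \<noteq> 0"
    then obtain j where "X i j \<noteq> 0" "w j \<noteq> 0" by (elim mat_vec_nonzeroE)
    with X[OF i(1) vec_onD[OF that]] show False by blast
  qed
  have single: "\<phi> t (\<psi> (single_vec j x)) = \<psi>' (mat_vec X J (single_vec j x))" if j: "j \<in> ?K" for j x
  proof -
    have e: "single_vec j x \<in> vec_on ?K" using j by (rule single_vec_on)
    have "\<phi> t (\<psi> (single_vec j x)) \<in> carrier (fib B t)"
      using LinearCombinations.module_hom_closed[OF \<phi>] lin_coordsD(1)[OF co(1) e] by blast
    then obtain u where u: "u \<in> vec_on ?K'" "\<phi> t (\<psi> (single_vec j x)) = \<psi>' u"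
      unfolding lin_coordsD(5)[OF co(2)] by blast
    have "u i = X i j * x" for i
    proof (cases "i \<in> ?K'")
      case True
      let ?\<D>' = "ray_decomposition J' b' \<gamma>'"
      have "restrict u J' \<in> carrier (fib (interval_sum ?\<D>') t)"
        using u(1) by (auto simp: interval_sum_carrier ray_decomposition_def vec_on_def)
      moreover have "inj_on (iso ?\<D>' t) (carrier (fib (interval_sum ?\<D>') t))"
        using dec(2) by (simp add: interval_decomposition_def pers_iso_def bij_betw_def)
      ultimately have "inv_into (carrier (fib (interval_sum ?\<D>') t)) (iso ?\<D>' t) (iso ?\<D>' t (restrict u J')) = restrict u J'"
        by (rule inv_into_f_f[rotated])
      then have "summand_proj ?\<D>' i t (\<psi>' u) = u i"
        using True by (simp add: summand_proj_def \<psi>'_def ray_decomposition_def)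
      moreover have "summand_incl (ray_decomposition J b \<gamma>) j t x = \<psi> (single_vec j x)"
        by (simp add: summand_incl_def ray_decomposition_def \<psi>_def single_vec_def)
      moreover have "summand_proj ?\<D>' i t (\<phi> t (summand_incl (ray_decomposition J b \<gamma>) j t x)) = X i j * x"
        using rep True j by (simp add: represents_def ray_decomposition_def)
      ultimately show ?thesis by (simp add: u(2))
    qed (use u(1) X[OF _ j] in \<open>simp add: vec_on_zero\<close>)
    then have "u = (\<lambda>i. X i j * x)" by (rule ext)
    with fin j show ?thesis by (simp add: u(2) mat_vec_single)
  qed
  have "\<phi> t (\<psi> (\<lambda>j. if j \<in> F then v j else 0)) = \<psi>' (mat_vec X J (\<lambda>j. if j \<in> F then v j else 0))"
    if "finite F" "F \<subseteq> ?K" for F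
    using that
  proof (induction F rule: finite_induct)
    case empty
    have "\<phi> t (\<psi> (\<lambda>_. 0)) = \<phi> t (0 \<odot>\<^bsub>fib A t\<^esub> \<psi> (\<lambda>_. 0))"
      using vectorspace_smult(2)[OF vsA lin_coordsD(1)[OF co(1) vec_on_0]] lin_coords_zero[OF vsA co(1)] by simp
    also have "\<dots> = 0 \<odot>\<^bsub>fib B t\<^esub> \<phi> t (\<psi> (\<lambda>_. 0))"
      using LinearCombinations.module_hom_smult[OF \<phi> _ lin_coordsD(1)[OF co(1) vec_on_0]] by simp
    also have "\<dots> = \<zero>\<^bsub>fib B t\<^esub>"
      using LinearCombinations.module_hom_closed[OF \<phi>] lin_coordsD(1)[OF co(1) vec_on_0]
      by (intro vectorspace_smult(2)[OF vsB]) blast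
    also have "\<dots> = \<psi>' (\<lambda>_. 0)" using lin_coords_zero[OF vsB co(2)] by simp
    finally show ?case by (simp add: mat_vec_def)
  next
    case (insert k F)
    let ?w = "\<lambda>j. if j \<in> F then v j else 0"
    have on: "single_vec k (v k) \<in> vec_on ?K" "?w \<in> vec_on ?K"
      using insert.prems by (simp add: single_vec_on) (use insert.prems in \<open>auto simp: vec_on_def\<close>)
    have split: "(\<lambda>j. if j \<in> insert k F then v j else 0) = (\<lambda>j. single_vec k (v k) j + ?w j)"
      using insert.hyps by (auto simp: single_vec_def)
    have "\<phi> t (\<psi> (\<lambda>j. single_vec k (v k) j + ?w j))
        = \<phi> t (\<psi> (single_vec k (v k))) \<oplus>\<^bsub>fib B t\<^esub> \<phi> t (\<psi> ?w)"
      by (simp only: lin_coordsD(3)[OF co(1) on]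
          LinearCombinations.module_hom_add[OF \<phi> lin_coordsD(1)[OF co(1) on(1)] lin_coordsD(1)[OF co(1) on(2)]])
    also have "\<dots> = \<psi>' (mat_vec X J (single_vec k (v k))) \<oplus>\<^bsub>fib B t\<^esub> \<psi>' (mat_vec X J ?w)"
      using insert single[of k "v k"] by simp
    also have "\<dots> = \<psi>' (mat_vec X J (\<lambda>j. single_vec k (v k) j + ?w j))"
      by (simp only: mat_vec_add lin_coordsD(3)[OF co(2) Xon[OF on(1)] Xon[OF on(2)]])
    finally show ?case unfolding split .
  qed
  from this[of ?K] have "\<phi> t (\<psi> (\<lambda>j. if j \<in> ?K then v j else 0)) = \<psi>' (mat_vec X J (\<lambda>j. if j \<in> ?K then v j else 0))"
    using fin by simp
  moreover have "(\<lambda>j. if j \<in> ?K then v j else 0) = v" using vec_on_zero[OF v] by auto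
  ultimately show ?thesis by (simp only: \<psi>_def \<psi>'_def)
qed

section \<open>The algorithm\<close>

lemma
  assumes fin: "finite J" and A: "A \<in> incidence_units J Q" and X: "X \<in> mat_on J I"
  shows mat_inv_cancel: "mat_inv J A \<star>\<^bsub>J\<^esub> (A \<star>\<^bsub>J\<^esub> X) = X"
    and mat_inv_cancel': "A \<star>\<^bsub>J\<^esub> (mat_inv J A \<star>\<^bsub>J\<^esub> X) = X"
  using X by (simp_all add: mat_inv_left[OF fin A] mat_inv_right[OF fin A] mat_id_left[OF fin]
      flip: mat_prod_assoc[OF fin fin])

locale ph_complex =
  fixes C :: "('r::linorder, 'f::field, 'v) complex_pm"
    and J :: "nat \<Rightarrow> 'j set" and b :: "nat \<Rightarrow> 'j \<Rightarrow> 'r cut" and \<gamma> :: "nat \<Rightarrow> 'r \<Rightarrow> ('j \<Rightarrow> 'f) \<Rightarrow> 'v"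
    and \<Delta> M D S T :: "nat \<Rightarrow> 'j \<Rightarrow> 'j \<Rightarrow> 'f" and P :: "nat \<Rightarrow> 'j set"
  assumes complex: "chain_complex C"
    and rays: "interval_decomposition (obj C n) (ray_decomposition (J n) (b n) (\<gamma> n))"
    and birth_finite: "j \<in> J n \<Longrightarrow> b n j < cut_infinity"
    and boundary: "represents (obj C (Suc n)) (ray_decomposition (J (Suc n)) (b (Suc n)) (\<gamma> (Suc n)))
              (obj C n) (ray_decomposition (J n) (b n) (\<gamma> n)) (bd C (Suc n)) (\<Delta> (Suc n))"
    and algorithm: "ph_algorithm J b \<Delta> M D S T P"
begin

definition coord :: "nat \<Rightarrow> 'r \<Rightarrow> ('j \<Rightarrow> 'f) \<Rightarrow> 'v" where
  "coord n t v = \<gamma> n t (restrict v (J n))"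

definition ble :: "nat \<Rightarrow> 'j \<Rightarrow> 'j \<Rightarrow> bool" where
  "ble n i j \<longleftrightarrow> b n i \<le> b n j"

text \<open>\<open>D n \<star> M (n + 1) = 0\<close> makes the rows \<open>P n\<close> of \<open>M (n + 1)\<close> vanish, and reduction never uses a
  zero row, so \<open>S n\<close> respects the preorder \<open>ble_off\<close>.\<close>

definition ble_off :: "nat \<Rightarrow> 'j \<Rightarrow> 'j \<Rightarrow> bool" where
  "ble_off n i j \<longleftrightarrow> b n i \<le> b n j \<and> (i = j \<or> i \<notin> P n \<and> j \<notin> P n)"

lemma ble_preorder: "reflp (ble n)" "transp (ble n)"
  by (auto simp: reflp_def transp_def ble_def)

lemma ble_off_preorder: "reflp (ble_off n)" "transp (ble_off n)"
  by (auto simp: reflp_def transp_def ble_off_def)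

lemma fin: "finite (J n)"
  using rays[of n] by (simp add: interval_decomposition_def ray_decomposition_def)

lemma coords: "lin_coords (alive J b n t) (fib (obj C n) t) (coord n t)"
  using ray_coords[OF rays[of n]] by (simp add: alive_def coord_def[abs_def])

lemma vs: "vectorspace class_ring (fib (obj C n) t)"
  using complex by (simp add: chain_complex_def is_pers_module_def)

lemma \<Delta>_on: "\<Delta> (Suc n) \<in> mat_on (J n) (J (Suc n))"
  and \<Delta>_birth: "\<Delta> (Suc n) i j \<noteq> 0 \<Longrightarrow> b n i \<le> b (Suc n) j"
  using ray_represents_on[OF boundary] ray_represents_birth[OF boundary] by blast+

lemma \<Delta>_coords: "v \<in> vec_on (alive J b (Suc n) t) \<Longrightarrow>
    bd C (Suc n) t (coord (Suc n) t v) = coord n t (mat_vec (\<Delta> (Suc n)) (J (Suc n)) v)"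
  using ray_represents_coords[OF boundary] by (simp add: alive_def coord_def)

lemma \<Delta>_alive: "v \<in> vec_on (alive J b (Suc n) t) \<Longrightarrow>
    mat_vec (\<Delta> (Suc n)) (J (Suc n)) v \<in> vec_on (alive J b n t)"
  using \<Delta>_on \<Delta>_birth by (rule mat_vec_alive)

text \<open>The maps compose to zero and coordinates are injective, so each column \<open>p\<close>
  of the product vanishes, as seen at a time at which \<open>p\<close> is alive.\<close>

lemma \<Delta>_\<Delta>: "\<Delta> (Suc n) \<star>\<^bsub>J (Suc n)\<^esub> \<Delta> (Suc (Suc n)) = (\<lambda>i j. 0)"
proof (intro ext)
  fix i p
  let ?m = "Suc (Suc n)"
  show "(\<Delta> (Suc n) \<star>\<^bsub>J (Suc n)\<^esub> \<Delta> ?m) i p = 0"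
  proof (cases "p \<in> J ?m")
    case True
    obtain t where t: "t \<in> upper (b ?m p)" using upper_nonempty[OF birth_finite[OF True]] by blast
    define e where "e = single_vec p (1::'f)"
    have e: "e \<in> vec_on (alive J b ?m t)" using True t by (simp add: e_def single_vec_on alive_def)
    have "bd C (Suc n) t (bd C ?m t (coord ?m t e)) = \<zero>\<^bsub>fib (obj C n) t\<^esub>"
      using complex lin_coordsD(1)[OF coords e] by (simp add: chain_complex_def)
    then have "coord n t (mat_vec (\<Delta> (Suc n)) (J (Suc n)) (mat_vec (\<Delta> ?m) (J ?m) e)) = coord n t (\<lambda>_. 0)"
      by (simp add: \<Delta>_coords[OF e] \<Delta>_coords[OF \<Delta>_alive[OF e]] lin_coords_zero[OF vs coords])
    then have "mat_vec (\<Delta> (Suc n)) (J (Suc n)) (mat_vec (\<Delta> ?m) (J ?m) e) = (\<lambda>_. 0)"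
      using lin_coordsD(2)[OF coords \<Delta>_alive[OF \<Delta>_alive[OF e]] vec_on_0] by simp
    then have "mat_vec (\<Delta> (Suc n) \<star>\<^bsub>J (Suc n)\<^esub> \<Delta> ?m) (J ?m) e = (\<lambda>_. 0)"
      by (simp add: mat_vec_prod[OF fin fin])
    then show ?thesis
      unfolding e_def mat_vec_single[OF fin True] by (metis mult.right_neutral)
  next
    case False
    then show ?thesis by (simp add: mat_prod_def mat_on_zero[OF \<Delta>_on])
  qed
qed

lemma T_0: "T 0 = mat_id (J 0)" and P_0: "P 0 = {}"
  and M_Suc: "M (Suc n) = mat_inv (J n) (T n) \<star>\<^bsub>J n\<^esub> \<Delta> (Suc n)"
  and P_Suc: "P (Suc n) = {j \<in> J (Suc n). \<exists>i\<in>J n. D (Suc n) i j \<noteq> 0}"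
  using algorithm by (simp_all add: ph_algorithm_def)

text \<open>\<open>Z\<close> and \<open>Q\<close> are left open because the lemma is used in two
  rounds. With \<open>Z = {}\<close> it bounds births and gives the shape of \<open>D\<close>, from
  which the zero rows of \<open>M\<close> are deduced; with \<open>Z = P n\<close> it then refines
  what is known about \<open>S n\<close>.\<close>

lemma reduction_step:
  assumes T: "T n \<in> incidence_units (J n) (ble n)"
    and Z: "\<And>i j. i \<in> Z \<Longrightarrow> M (Suc n) i j = 0"
    and Q: "reflp Q" "transp Q" "\<And>i j. b n i \<le> b n j \<Longrightarrow> i \<notin> Z \<Longrightarrow> j \<notin> Z \<Longrightarrow> Q i j"
  shows "S n \<in> incidence_units (J n) Q" "T (Suc n) \<in> incidence_units (J (Suc n)) (ble (Suc n))"
    "D (Suc n) = S n \<star>\<^bsub>J n\<^esub> M (Suc n) \<star>\<^bsub>J (Suc n)\<^esub> T (Suc n)"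
    "monomial_on (J n) (J (Suc n)) (D (Suc n))"
proof -
  obtain rs cs where rc: "decreasing_listing (J n) (b n) rs"
    "increasing_listing (J (Suc n)) (b (Suc n)) cs"
    "row_column_reduction rs cs (M (Suc n)) (S n) (D (Suc n)) (T (Suc n))"
    using algorithm unfolding ph_algorithm_def by blast
  then have rs: "distinct rs" "set rs = J n" "sorted_wrt (\<lambda>x y. b n y \<le> b n x) rs"
    and cs: "distinct cs" "set cs = J (Suc n)" "sorted_wrt (\<lambda>x y. b (Suc n) x \<le> b (Suc n) y) cs"
    by (simp_all add: decreasing_listing_def increasing_listing_def)
  have "M (Suc n) \<in> mat_on (set rs) (set cs)"
    unfolding M_Suc rs cs by (intro mat_prod_on incidence_units_on[OF mat_inv_unit[OF fin T]] \<Delta>_on)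
  moreover have "sorted_wrt (\<lambda>r k. r \<notin> Z \<longrightarrow> k \<notin> Z \<longrightarrow> Q k r) rs"
    using rs(3) by (rule sorted_wrt_mono_rel[rotated]) (simp add: Q(3))
  moreover have "sorted_wrt (ble (Suc n)) cs"
    using cs(3) by (simp add: ble_def[abs_def])
  ultimately show "S n \<in> incidence_units (J n) Q" "T (Suc n) \<in> incidence_units (J (Suc n)) (ble (Suc n))"
    "D (Suc n) = S n \<star>\<^bsub>J n\<^esub> M (Suc n) \<star>\<^bsub>J (Suc n)\<^esub> T (Suc n)"
    "monomial_on (J n) (J (Suc n)) (D (Suc n))"
    using row_column_reduction_spec[OF rc(3) rs(1) cs(1) _ Q(1,2) ble_preorder _ _ Z] rs(2) cs(2)
    by simp_all
qed

text \<open>Of the outcome of one step only \<open>T\<close> enters the next matrix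
  \<open>M\<close>, so the induction can run over \<open>T\<close> alone.\<close>

lemma T_unit: "T n \<in> incidence_units (J n) (ble n)"
proof (induction n)
  case 0
  then show ?case by (simp add: T_0 mat_id_unit fin ble_preorder)
next
  case (Suc n)
  show ?case
    using Suc.IH by (rule reduction_step(2)[where Z = "{}" and Q = "ble n"]) (simp_all add: ble_preorder ble_def)
qed

lemma D_eq: "D (Suc n) = S n \<star>\<^bsub>J n\<^esub> M (Suc n) \<star>\<^bsub>J (Suc n)\<^esub> T (Suc n)"
  and D_monomial: "monomial_on (J n) (J (Suc n)) (D (Suc n))"
  and S_unit_ble: "S n \<in> incidence_units (J n) (ble n)"
  using reduction_step[OF T_unit, where Z = "{}" and Q = "ble n"] ble_preorder by (simp_all add: ble_def)

lemma M_on: "M (Suc n) \<in> mat_on (J n) (J (Suc n))"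
  unfolding M_Suc by (intro mat_prod_on incidence_units_on[OF mat_inv_unit[OF fin T_unit]] \<Delta>_on)

lemma M_birth: "M (Suc n) i j \<noteq> 0 \<Longrightarrow> b n i \<le> b (Suc n) j"
  unfolding M_Suc
  using incidence_units_rel[OF mat_inv_unit[OF fin T_unit], of n] \<Delta>_birth
  by (elim mat_prod_nonzeroE) (force simp: ble_def)

lemma D_on: "D (Suc n) \<in> mat_on (J n) (J (Suc n))"
  unfolding D_eq by (intro mat_prod_on M_on incidence_units_on[OF S_unit_ble] incidence_units_on[OF T_unit])

text \<open>The final factor \<open>T (Suc n)\<close> of \<open>D (Suc n)\<close> cancels against
  its inverse at the start of \<open>M (Suc (Suc n))\<close>, leaving two consecutive boundary
  matrices.\<close>

lemma D_M: "D (Suc n) \<star>\<^bsub>J (Suc n)\<^esub> M (Suc (Suc n)) = (\<lambda>i j. 0)"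
proof -
  have "D (Suc n) \<star>\<^bsub>J (Suc n)\<^esub> M (Suc (Suc n))
      = S n \<star>\<^bsub>J n\<^esub> (mat_inv (J n) (T n) \<star>\<^bsub>J n\<^esub> (\<Delta> (Suc n) \<star>\<^bsub>J (Suc n)\<^esub> \<Delta> (Suc (Suc n))))"
    unfolding D_eq M_Suc by (simp add: mat_prod_assoc fin mat_inv_cancel'[OF fin T_unit \<Delta>_on])
  also have "\<dots> = (\<lambda>i j. 0)" unfolding \<Delta>_\<Delta> by (simp add: mat_prod_def)
  finally show ?thesis .
qed

text \<open>Column \<open>i\<close> of \<open>D n\<close> has a pivot in some row \<open>k\<close>,
  and it is the only nonzero entry of that row. Row \<open>k\<close> of the zero product in
  \<open>D_M\<close> is therefore a nonzero multiple of row \<open>i\<close> of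
  \<open>M (Suc n)\<close>.\<close>

lemma M_zero_row: "i \<in> P n \<Longrightarrow> M (Suc n) i j = 0"
proof (cases n)
  case (Suc m)
  assume "i \<in> P n"
  then obtain k where k: "k \<in> J m" "i \<in> J n" "D n k i \<noteq> 0" using Suc by (auto simp: P_Suc)
  have "(D n \<star>\<^bsub>J n\<^esub> M (Suc n)) k j = (\<Sum>l\<in>J n. if l = i then D n k i * M (Suc n) i j else 0)"
    unfolding mat_prod_def
  proof (rule sum.cong)
    fix l assume "l \<in> J n"
    then have "l \<noteq> i \<Longrightarrow> D n k l = 0"
      using k D_monomial[of m] unfolding monomial_on_def Suc by metis
    then show "D n k l * M (Suc n) l j = (if l = i then D n k i * M (Suc n) i j else 0)" by auto
  qed simp
  also have "\<dots> = D n k i * M (Suc n) i j" using k(2) fin by simp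
  finally show ?thesis using D_M[of m] k(3) by (simp add: Suc)
qed (simp add: P_0)

lemma S_unit: "S n \<in> incidence_units (J n) (ble_off n)"
  by (rule reduction_step(1)[OF T_unit, where Z = "P n"])
    (simp_all add: M_zero_row ble_off_preorder, simp_all add: ble_off_def)

lemma D_birth: "D (Suc n) i j \<noteq> 0 \<Longrightarrow> b n i \<le> b (Suc n) j"
proof -
  assume "D (Suc n) i j \<noteq> 0"
  then obtain k l where "S n i k \<noteq> 0" "M (Suc n) k l \<noteq> 0" "T (Suc n) l j \<noteq> 0"
    unfolding D_eq by (elim mat_prod_nonzeroE)
  then have "b n i \<le> b n k" "b n k \<le> b (Suc n) l" "b (Suc n) l \<le> b (Suc n) j"
    using M_birth incidence_units_rel[OF S_unit_ble, unfolded ble_def]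
      incidence_units_rel[OF T_unit, unfolded ble_def] by blast+
  then show ?thesis by (blast intro: order_trans)
qed

text \<open>For \<open>i \<in> P n\<close>, row \<open>i\<close> of \<open>S n\<close> is
  concentrated on the diagonal, so row \<open>i\<close> of \<open>D (Suc n)\<close> comes from row
  \<open>i\<close> of \<open>M (Suc n)\<close> alone, which is zero.\<close>

lemma D_P: "D (Suc n) i j \<noteq> 0 \<Longrightarrow> i \<notin> P n"
proof
  assume "D (Suc n) i j \<noteq> 0" "i \<in> P n"
  then obtain k l where "S n i k \<noteq> 0" "M (Suc n) k l \<noteq> 0"
    unfolding D_eq by (elim mat_prod_nonzeroE)
  with M_zero_row \<open>i \<in> P n\<close> show False
    using incidence_units_rel[OF S_unit, unfolded ble_off_def] by blast
qed

section \<open>Generator bases and the boundary map in them\<close>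

definition gen :: "nat \<Rightarrow> 'j \<Rightarrow> 'j \<Rightarrow> 'f" where
  "gen n = T n \<star>\<^bsub>J n\<^esub> mat_inv (J n) (S n)"

definition gen_inv :: "nat \<Rightarrow> 'j \<Rightarrow> 'j \<Rightarrow> 'f" where
  "gen_inv n = S n \<star>\<^bsub>J n\<^esub> mat_inv (J n) (T n)"

lemma gen_unit: "gen n \<in> incidence_units (J n) (ble n)"
  and gen_inv_unit: "gen_inv n \<in> incidence_units (J n) (ble n)"
  unfolding gen_def gen_inv_def
  by (intro incidence_units_prod fin ble_preorder T_unit S_unit_ble mat_inv_unit)+

lemma gen_gen_inv: "gen n \<star>\<^bsub>J n\<^esub> gen_inv n = mat_id (J n)" "gen_inv n \<star>\<^bsub>J n\<^esub> gen n = mat_id (J n)"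
  unfolding gen_def gen_inv_def
  by (simp_all add: mat_prod_assoc fin mat_inv_right[OF fin T_unit] mat_inv_right[OF fin S_unit_ble]
      mat_inv_cancel[OF fin T_unit incidence_units_on[OF mat_inv_unit[OF fin S_unit_ble]]]
      mat_inv_cancel[OF fin S_unit_ble incidence_units_on[OF mat_inv_unit[OF fin T_unit]]])

text \<open>\<open>S n\<close> is diagonal on \<open>P n\<close>, so passing from \<open>D n\<close> to the boundary matrix in the generator bases
  only rescales columns.\<close>

definition gen_bd :: "nat \<Rightarrow> 'j \<Rightarrow> 'j \<Rightarrow> 'f" where
  "gen_bd n = D n \<star>\<^bsub>J n\<^esub> mat_inv (J n) (S n)"

text \<open>Once \<open>D (Suc n)\<close> is written out, its factors \<open>S n\<close> and the
  inverse of \<open>T n\<close> cancel against \<open>gen n\<close>.\<close>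

lemma \<Delta>_gen: "\<Delta> (Suc n) \<star>\<^bsub>J (Suc n)\<^esub> gen (Suc n) = gen n \<star>\<^bsub>J n\<^esub> gen_bd (Suc n)"
proof -
  have on: "mat_inv (J n) (T n) \<star>\<^bsub>J n\<^esub> (\<Delta> (Suc n) \<star>\<^bsub>J (Suc n)\<^esub> gen (Suc n)) \<in> mat_on (J n) (J (Suc n))"
    "\<Delta> (Suc n) \<star>\<^bsub>J (Suc n)\<^esub> gen (Suc n) \<in> mat_on (J n) (J (Suc n))"
    by (intro mat_prod_on \<Delta>_on incidence_units_on[OF gen_unit]
        incidence_units_on[OF mat_inv_unit[OF fin T_unit]])+
  have "gen n \<star>\<^bsub>J n\<^esub> gen_bd (Suc n) = T n \<star>\<^bsub>J n\<^esub> (mat_inv (J n) (S n) \<star>\<^bsub>J n\<^esub>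
      (S n \<star>\<^bsub>J n\<^esub> (mat_inv (J n) (T n) \<star>\<^bsub>J n\<^esub> (\<Delta> (Suc n) \<star>\<^bsub>J (Suc n)\<^esub> gen (Suc n)))))"
    unfolding gen_def gen_bd_def D_eq M_Suc by (simp add: mat_prod_assoc fin)
  also have "\<dots> = \<Delta> (Suc n) \<star>\<^bsub>J (Suc n)\<^esub> gen (Suc n)"
    by (simp only: mat_inv_cancel[OF fin S_unit_ble on(1)] mat_inv_cancel'[OF fin T_unit on(2)])
  finally show ?thesis ..
qed

text \<open>A nonzero summand over \<open>k\<close> needs \<open>k \<in> P (Suc n)\<close>, and
  there \<open>ble_off\<close> forces \<open>k = j\<close>. Each entry of the product is thus a
  multiple of the entry of \<open>X\<close> in the same place.\<close>

lemma D_scale: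
  assumes U: "U \<in> incidence_units (J (Suc n)) (ble_off (Suc n))"
    and X: "\<And>i j. X i j \<noteq> 0 \<Longrightarrow> j \<in> P (Suc n)" and "(X \<star>\<^bsub>J (Suc n)\<^esub> U) i j \<noteq> 0"
  shows "X i j \<noteq> 0"
  using assms(3)
proof (rule mat_prod_nonzeroE)
  fix k assume "X i k \<noteq> 0" "U k j \<noteq> 0"
  then show ?thesis using X incidence_units_rel[OF U, of k j] by (auto simp: ble_off_def)
qed

text \<open>Both \<open>S\<close> and its inverse are units for \<open>ble_off\<close>, so
  \<open>D_scale\<close> applies in either direction.\<close>

lemma gen_bd_nonzero: "gen_bd (Suc n) i j \<noteq> 0 \<longleftrightarrow> D (Suc n) i j \<noteq> 0"
proof
  let ?n = "Suc n"
  have DP: "j \<in> P ?n" if "D ?n i j \<noteq> 0" for i j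
    using that mat_onD[OF D_on that] by (auto simp: P_Suc)
  show D: "D ?n i j \<noteq> 0" if "gen_bd ?n i j \<noteq> 0" for i j
    using mat_inv_unit[OF fin S_unit] DP that[unfolded gen_bd_def] by (rule D_scale)
  have "D ?n = gen_bd ?n \<star>\<^bsub>J ?n\<^esub> S ?n"
    unfolding gen_bd_def by (simp add: mat_prod_assoc fin mat_inv_left[OF fin S_unit] mat_id_right[OF fin D_on])
  then show "gen_bd ?n i j \<noteq> 0" if "D ?n i j \<noteq> 0"
    using that D_scale[OF S_unit, of "gen_bd ?n" n i j] DP D by metis
qed

definition gen_coord :: "nat \<Rightarrow> 'r \<Rightarrow> ('j \<Rightarrow> 'f) \<Rightarrow> 'v" where
  "gen_coord n t v = coord n t (mat_vec (gen n) (J n) v)"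

lemma gen_alive: "v \<in> vec_on (alive J b n t) \<Longrightarrow> mat_vec (gen n) (J n) v \<in> vec_on (alive J b n t)"
  and gen_inv_alive: "v \<in> vec_on (alive J b n t) \<Longrightarrow> mat_vec (gen_inv n) (J n) v \<in> vec_on (alive J b n t)"
  using incidence_units_rel[OF gen_unit, unfolded ble_def] incidence_units_rel[OF gen_inv_unit, unfolded ble_def]
  by (auto intro!: mat_vec_alive incidence_units_on[OF gen_unit] incidence_units_on[OF gen_inv_unit])

lemma reduced: "reduced_complex C J b gen_coord gen_bd P"
proof
  show "lin_coords (alive J b n t) (fib (obj C n) t) (gen_coord n t)" for n t
    unfolding gen_coord_def[abs_def]
    using coords fin gen_gen_inv alive_subset gen_alive gen_inv_alive by (rule lin_coords_reparametrise)
  show "str (obj C n) s t (gen_coord n s v) = gen_coord n t v"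
    if "s \<le> t" "v \<in> vec_on (alive J b n s)" for s t n v
    using ray_str[OF rays that(1)] gen_alive[OF that(2)] by (simp add: gen_coord_def coord_def alive_def)
  show "bd C (Suc n) t (gen_coord (Suc n) t v) = gen_coord n t (mat_vec (gen_bd (Suc n)) (J (Suc n)) v)"
    if v: "v \<in> vec_on (alive J b (Suc n) t)" for n t v
    unfolding gen_coord_def \<Delta>_coords[OF gen_alive[OF v]]
    by (simp add: \<Delta>_gen flip: mat_vec_prod[OF fin fin])
  show "gen_bd (Suc n) \<in> mat_on (J n) (J (Suc n))" for n
    using mat_onD[OF D_on] by (intro mat_onI) (simp add: gen_bd_nonzero)
  show "monomial_on (J n) (J (Suc n)) (gen_bd (Suc n))" for n
    using D_monomial by (simp add: monomial_on_def gen_bd_nonzero)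
qed (simp_all add: complex fin birth_finite P_0 P_Suc gen_bd_nonzero D_birth D_P)

sublocale reduced: reduced_complex C J b gen_coord gen_bd P
  by (rule reduced)

lemma ph_death_gen_bd: "ph_death J b gen_bd n j = ph_death J b D n j"
  by (simp add: ph_death_def gen_bd_nonzero)

lemma ph_generator_eq: "j \<in> J n \<Longrightarrow> ph_generator C J \<gamma> S T n t j = reduced.hclass n t (single_vec j 1)"
  by (simp add: ph_generator_def reduced.hclass_def gen_coord_def coord_def mat_vec_single[OF fin] gen_def)

lemma bar_decomposition: "reduced.bar_decomposition n (ph_decomposition C J b \<gamma> D S T P n)"
proof -
  have "(\<Oplus>\<^bsub>fib (homology C n) t\<^esub> j\<in>reduced.bars n t.
      v j \<odot>\<^bsub>fib (homology C n) t\<^esub> ph_generator C J \<gamma> S T n t j)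
      = reduced.hclass n t (\<lambda>j. if j \<in> reduced.bars n t then v j else 0)" for t v
  proof (rule reduced.homology_finsum)
    show "finite (reduced.bars n t)" using fin[of n] by (simp add: reduced.bars_def)
    show "reduced.bars n t \<subseteq> reduced.cyc n t" by (auto simp: reduced.bars_eq)
    fix j assume j: "j \<in> reduced.bars n t"
    then have e: "single_vec j 1 \<in> vec_on (reduced.cyc n t)" by (simp add: reduced.bars_eq single_vec_on)
    have "(\<lambda>k. v j * single_vec j 1 k) = single_vec j (v j)" by (auto simp: single_vec_def)
    with j show "v j \<odot>\<^bsub>fib (homology C n) t\<^esub> ph_generator C J \<gamma> S T n t j
        = reduced.hclass n t (single_vec j (v j))"
      by (simp add: ph_generator_eq reduced.homology_smult[OF e] reduced.bars_def)
  qed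
  then show ?thesis
    by (simp add: reduced.bar_decomposition_def ph_decomposition_def reduced.bars_def ph_death_gen_bd
        fun_eq_iff)
qed

end

theorem mainTheorem9:
  fixes C :: "('r::linorder, 'f::field, 'v) complex_pm"
    and C' :: "('r, 'f, 'w) complex_pm"
    and f :: "nat \<Rightarrow> 'r \<Rightarrow> 'v \<Rightarrow> 'w"
    and J P :: "nat \<Rightarrow> 'j set" and J' P' :: "nat \<Rightarrow> 'k set"
    and b :: "nat \<Rightarrow> 'j \<Rightarrow> 'r cut" and b' :: "nat \<Rightarrow> 'k \<Rightarrow> 'r cut"
    and \<gamma> :: "nat \<Rightarrow> 'r \<Rightarrow> ('j \<Rightarrow> 'f) \<Rightarrow> 'v" and \<gamma>' :: "nat \<Rightarrow> 'r \<Rightarrow> ('k \<Rightarrow> 'f) \<Rightarrow> 'w"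
    and \<Delta> M D S T :: "nat \<Rightarrow> 'j \<Rightarrow> 'j \<Rightarrow> 'f"
    and \<Delta>' M' D' S' T' :: "nat \<Rightarrow> 'k \<Rightarrow> 'k \<Rightarrow> 'f"
    and X :: "nat \<Rightarrow> 'k \<Rightarrow> 'j \<Rightarrow> 'f"
  assumes "chain_complex C" and "chain_complex C'" and "chain_map C C' f"
    and "\<And>n. interval_decomposition (obj C n) (ray_decomposition (J n) (b n) (\<gamma> n))"
    and "\<And>n. interval_decomposition (obj C' n) (ray_decomposition (J' n) (b' n) (\<gamma>' n))"
    and "\<And>n j. j \<in> J n \<Longrightarrow> b n j < cut_infinity"
    and "\<And>n j. j \<in> J' n \<Longrightarrow> b' n j < cut_infinity"
    and "\<And>n. represents (obj C n) (ray_decomposition (J n) (b n) (\<gamma> n))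
              (obj C' n) (ray_decomposition (J' n) (b' n) (\<gamma>' n)) (f n) (X n)"
    and "\<And>n. represents (obj C (Suc n)) (ray_decomposition (J (Suc n)) (b (Suc n)) (\<gamma> (Suc n)))
              (obj C n) (ray_decomposition (J n) (b n) (\<gamma> n)) (bd C (Suc n)) (\<Delta> (Suc n))"
    and "\<And>n. represents (obj C' (Suc n)) (ray_decomposition (J' (Suc n)) (b' (Suc n)) (\<gamma>' (Suc n)))
              (obj C' n) (ray_decomposition (J' n) (b' n) (\<gamma>' n)) (bd C' (Suc n)) (\<Delta>' (Suc n))"
    and "ph_algorithm J b \<Delta> M D S T P"
    and "ph_algorithm J' b' \<Delta>' M' D' S' T' P'"
  shows "represents
           (homology C n) (ph_decomposition C J b \<gamma> D S T P n)
           (homology C' n) (ph_decomposition C' J' b' \<gamma>' D' S' T' P' n)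
           (homology_map C' f n)
           (mat_restrict (J' n - P' n) (J n - P n)
              (S' n \<star>\<^bsub>J' n\<^esub> mat_inv (J' n) (T' n) \<star>\<^bsub>J' n\<^esub> X n
                 \<star>\<^bsub>J n\<^esub> T n \<star>\<^bsub>J n\<^esub> mat_inv (J n) (S n)))"
proof -
  interpret A: ph_complex C J b \<gamma> \<Delta> M D S T P
    using assms(1,4,6,9,11) by unfold_locales
  interpret B: ph_complex C' J' b' \<gamma>' \<Delta>' M' D' S' T' P'
    using assms(2,5,7,10,12) by unfold_locales
  define Y where "Y n = B.gen_inv n \<star>\<^bsub>J' n\<^esub> (X n \<star>\<^bsub>J n\<^esub> A.gen n)" for n
  have X_on: "X n \<in> mat_on (J' n) (J n)" and X_birth: "X n i j \<noteq> 0 \<Longrightarrow> b' n i \<le> b n j" for n i j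
    using ray_represents_on[OF assms(8)] ray_represents_birth[OF assms(8)] by blast+
  interpret reduced_complex_map C J b A.gen_coord A.gen_bd P C' J' b' B.gen_coord B.gen_bd P' f Y
  proof
    show "chain_map C C' f" by (rule assms(3))
    show "Y n \<in> mat_on (J' n) (J n)" for n
      unfolding Y_def
      by (intro mat_prod_on X_on incidence_units_on[OF A.gen_unit] incidence_units_on[OF B.gen_inv_unit])
    show "b' n i \<le> b n j" if Yij: "Y n i j \<noteq> 0" for n i j
    proof -
      obtain k l where "B.gen_inv n i k \<noteq> 0" "X n k l \<noteq> 0" "A.gen n l j \<noteq> 0"
        using Yij unfolding Y_def by (elim mat_prod_nonzeroE)
      then have "b' n i \<le> b' n k" "b' n k \<le> b n l" "b n l \<le> b n j"
        using X_birth incidence_units_rel[OF B.gen_inv_unit, unfolded B.ble_def]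
          incidence_units_rel[OF A.gen_unit, unfolded A.ble_def] by blast+
      then show ?thesis by (blast intro: order_trans)
    qed
    show "f n t (A.gen_coord n t v) = B.gen_coord n t (mat_vec (Y n) (J n) v)"
      if v: "v \<in> vec_on (alive J b n t)" for n t v
    proof -
      have "f n t (A.gen_coord n t v) = B.coord n t (mat_vec (X n \<star>\<^bsub>J n\<^esub> A.gen n) (J n) v)"
        using ray_represents_coords[OF assms(8), folded alive_def, OF A.gen_alive[OF v]]
        by (simp add: A.gen_coord_def A.coord_def B.coord_def mat_vec_prod[OF A.fin A.fin])
      \<comment> \<open>Inserting \<open>B.gen n\<close> times \<open>B.gen_inv n\<close>, which is
        the identity, leaves \<open>B.gen n\<close> to be absorbed into
        \<open>B.gen_coord\<close>.\<close>
      also have "X n \<star>\<^bsub>J n\<^esub> A.gen n = B.gen n \<star>\<^bsub>J' n\<^esub> Y n"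
        unfolding Y_def mat_prod_assoc[OF B.fin B.fin, symmetric] B.gen_gen_inv
        by (rule mat_id_left[OF B.fin mat_prod_on[OF X_on incidence_units_on[OF A.gen_unit]], symmetric])
      finally show ?thesis
        by (simp add: B.gen_coord_def mat_vec_prod[OF B.fin A.fin])
    qed
  qed
  have "S' n \<star>\<^bsub>J' n\<^esub> mat_inv (J' n) (T' n) \<star>\<^bsub>J' n\<^esub> X n \<star>\<^bsub>J n\<^esub> T n \<star>\<^bsub>J n\<^esub> mat_inv (J n) (S n) = Y n"
    unfolding Y_def A.gen_def B.gen_inv_def by (simp add: mat_prod_assoc A.fin B.fin)
  then show ?thesis
    using homology_map_represents[OF A.bar_decomposition B.bar_decomposition] by simp
qed

end
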